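(* Let $\sigma\subset N_{\mathbb R}$ be a strongly convex rational polyhedral cone with $\dim\sigma=\dim N_{\mathbb R}$, let $Q\subset\sigma$ be a rational polyhedron with $0\notin Q$, and let $Q=Q_0+Q_1+\cdots+Q_k$ be a Minkowski sum decomposition into polyhedra such that for every vertex $q$ of $Q$ the induced decomposition $q=q_0+\cdots+q_k$ ($q_i$ a vertex of $Q_i$) has at most one summand not in $N$. Let $$\tilde\sigma=\Big\langle\sigma,\ Q_0-\sum_{i=1}^ke_i,\ Q_1+e_1,\dots,Q_k+e_k\Big\rangle\subset\tilde N_{\mathbb R}.$$ Then there is a natural ring isomorphism $$\mathbb C[\sigma^\vee\cap M]\simeq\big(\mathbb C[x_\xi\mid\xi\in\tilde\sigma(1)]/I\big)^{G(\tilde\sigma)},$$ where the ideal $I$ is generated by the binomials $$\prod_{\langle e_i^*,v_\xi\rangle>0}x_\xi^{\langle e_i^*,v_\xi\rangle}-\prod_{\langle e_i^*,v_\xi\rangle<0}x_\xi^{-\langle e_i^*,v_\xi\rangle},\qquad i=1,\dots,k,$$ which form a regular sequence in $\mathbb C[x_\xi\mid\xi\in\tilde\sigma(1)]$. Moreover, the ideal $I$ is prime.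
   Context: $N$ is a lattice, $M=\mathrm{Hom}(N,\mathbb Z)$, $\tilde N=N\oplus\mathbb Z^k$ with standard basis $e_1,\dots,e_k$ of $\mathbb Z^k$, $\tilde M=M\oplus\mathbb Z^k$ with dual basis $e_1^*,\dots,e_k^*$. $\langle\cdots\rangle$ applied to sets denotes the convex cone they generate; $\sigma^\vee$ is the dual cone. Convention: in a Minkowski sum decomposition of an unbounded polyhedron all summands have the same recession cone as the polyhedron. $\tilde\sigma(1)$ is the set of edges (one-dimensional faces) of $\tilde\sigma$, and $v_\xi$ is the primitive lattice generator of $\xi\in\tilde\sigma(1)$. The group $$G(\tilde\sigma)=\Big\{(\mu_\xi)\in(\mathbb C^* )^{\tilde\sigma(1)}\ \Big|\ \prod_{\xi\in\tilde\sigma(1)}\mu_\xi^{\langle u,v_\xi\rangle}=1\ \forall u\in\tilde M\Big\}$$ acts diagonally on $\mathbb C[x_\xi\mid\xi\in\tilde\sigma(1)]$, and there is the standard isomorphism $\mathbb C[\tilde\sigma^\vee\cap\tilde M]\simeq\mathbb C[x_\xi\mid\xi\in\tilde\sigma(1)]^{G(\tilde\sigma)}$, $\chi^u\mapsto x^u:=\prod_\xi x_\xi^{\langle u,v_\xi\rangle}$. "Natural" refers to compatibility with this isomorphism and the homomorphism $\mathbb C[\tilde\sigma^\vee\cap\tilde M]\to\mathbb C[\sigma^\vee\cap M]$ induced by the projection $\tilde M\to M$. *)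

theory Defs
  imports
    "HOL-Analysis.Analysis"
    "HOL-Library.Set_Algebras"
    "HOL-Library.FuncSet"
    "HOL-Library.Poly_Mapping"
    "HOL-Algebra.Ideal"
    "HOL-Algebra.QuotRing"
begin

section \<open>Lattices\<close>

text \<open>
  A lattice \<open>L\<close> is realised as a full lattice in its real span \<open>L\<^sub>\<real>\<close>, a Euclidean space
  which here is a type. The inner product is only an auxiliary device: it identifies the dual
  vector space with \<open>L\<^sub>\<real>\<close>, and thereby \<open>Hom(L, \<int>)\<close> with \<open>dual_lattice L\<close>.
\<close>

definition full_lattice :: "'v::euclidean_space set \<Rightarrow> bool" where
  "full_lattice L \<longleftrightarrow>
     (\<exists>B. independent B \<and> span B = UNIV \<and> L = {\<Sum>b\<in>B. of_int (c b) *\<^sub>R b | c :: 'v \<Rightarrow> int. True})"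

definition dual_lattice :: "'v::euclidean_space set \<Rightarrow> 'v set" where
  "dual_lattice L = {u. \<forall>v\<in>L. u \<bullet> v \<in> \<int>}"

text \<open>The floor is harmless: it is only used for \<open>u \<in> dual_lattice L\<close> and \<open>v \<in> L\<close>.\<close>

definition pairing :: "'v::euclidean_space \<Rightarrow> 'v \<Rightarrow> int" where
  "pairing u v = \<lfloor>u \<bullet> v\<rfloor>"

definition ext_lattice :: "'a::euclidean_space set \<Rightarrow> ('a \<times> (real ^ 'k)) set" where
  "ext_lattice N = N \<times> {c. \<forall>i. c $ i \<in> \<int>}"

text \<open>The primitive generator of a ray \<open>\<xi>\<close> is the generator of the monoid \<open>\<xi> \<inter> L\<close>.\<close>

definition primitive_generator :: "'v::euclidean_space set \<Rightarrow> 'v set \<Rightarrow> 'v" where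
  "primitive_generator L \<xi> = (THE v. v \<noteq> 0 \<and> \<xi> \<inter> L = range (\<lambda>n::nat. of_nat n *\<^sub>R v))"


section \<open>Cones and polyhedra\<close>

definition dual_cone :: "'v::euclidean_space set \<Rightarrow> 'v set" where
  "dual_cone C = {u. \<forall>x\<in>C. 0 \<le> u \<bullet> x}"

definition rational_polyhedral_cone :: "'v::euclidean_space set \<Rightarrow> 'v set \<Rightarrow> bool" where
  "rational_polyhedral_cone L C \<longleftrightarrow> (\<exists>S. finite S \<and> S \<subseteq> L \<and> C = convex_cone hull S)"

definition strongly_convex :: "'v::euclidean_space set \<Rightarrow> bool" where
  "strongly_convex C \<longleftrightarrow> C \<inter> uminus ` C = {0}"

definition rational_polyhedron :: "'v::euclidean_space set \<Rightarrow> 'v set \<Rightarrow> bool" where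
  "rational_polyhedron L Q \<longleftrightarrow>
     (\<exists>F. finite F \<and> F \<subseteq> dual_lattice L \<times> \<rat> \<and> Q = {x. \<forall>(u, c)\<in>F. c \<le> u \<bullet> x})"

definition recession_cone :: "'v::euclidean_space set \<Rightarrow> 'v set" where
  "recession_cone Q = {d. \<forall>x\<in>Q. \<forall>t\<ge>0. x + t *\<^sub>R d \<in> Q}"

text \<open>
  The summands \<open>Q\<^sub>0, \<dots>, Q\<^sub>k\<close> are indexed by \<open>'k option\<close>, where \<open>'k\<close> plays the role of
  \<open>{1, \<dots>, k}\<close>: \<open>Qs None\<close> is \<open>Q\<^sub>0\<close> and \<open>Qs (Some i)\<close> is \<open>Q\<^sub>i\<close>. The condition on recession cones
  is a convention for unbounded \<open>Q\<close>; for bounded nonempty \<open>Q\<close> it holds automatically.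
\<close>

definition minkowski_decomposition ::
  "'a::euclidean_space set \<Rightarrow> ('k::finite option \<Rightarrow> 'a set) \<Rightarrow> bool" where
  "minkowski_decomposition Q Qs \<longleftrightarrow>
     (\<forall>j. polyhedron (Qs j)) \<and> Q = (\<Sum>j\<in>UNIV. Qs j) \<and>
     (\<forall>j. recession_cone (Qs j) = recession_cone Q)"

text \<open>Extreme points are vertices; the decomposition of a vertex of \<open>Q\<close> exists and is unique.\<close>

definition almost_integral_decomposition ::
  "'a::euclidean_space set \<Rightarrow> 'a set \<Rightarrow> ('k::finite option \<Rightarrow> 'a set) \<Rightarrow> bool" where
  "almost_integral_decomposition N Q Qs \<longleftrightarrow>
     (\<forall>q qs. q extreme_point_of Q \<and> (\<forall>j. qs j extreme_point_of Qs j) \<and> q = (\<Sum>j\<in>UNIV. qs j)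
        \<longrightarrow> card {j. qs j \<notin> N} \<le> 1)"

definition tilde_cone ::
  "'a::euclidean_space set \<Rightarrow> ('k::finite option \<Rightarrow> 'a set) \<Rightarrow> ('a \<times> (real ^ 'k)) set" where
  "tilde_cone \<sigma> Qs = convex_cone hull
     ({(s, 0) | s. s \<in> \<sigma>} \<union>
      {(q, - (\<Sum>i\<in>UNIV. axis i 1)) | q. q \<in> Qs None} \<union>
      (\<Union>i. {(q, axis i 1) | q. q \<in> Qs (Some i)}))"

definition edges :: "'v::euclidean_space set \<Rightarrow> 'v set set" where
  "edges C = {\<xi>. \<xi> edge_of C}"

definition dual_basis_vector :: "'k::finite \<Rightarrow> 'a::euclidean_space \<times> (real ^ 'k)" where
  "dual_basis_vector i = (0, axis i 1)"


section \<open>Monoid algebras and polynomial rings\<close>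

text \<open>
  For a submonoid \<open>S\<close>, this is \<open>\<complex>[S]\<close>: finitely supported functions with convolution,
  \<open>single u 1\<close> being the character \<open>\<chi>\<^sup>u\<close>. The polynomial ring in variables indexed by a set \<open>E\<close> is
  the case of the monoid of exponents supported in \<open>E\<close>.
\<close>

definition monoid_algebra :: "'m::comm_monoid_add set \<Rightarrow> ('m \<Rightarrow>\<^sub>0 complex) ring" where
  "monoid_algebra S =
     \<lparr>carrier = {p. Poly_Mapping.keys p \<subseteq> S}, mult = (*), one = 1, zero = 0, add = (+)\<rparr>"

definition monoid_algebra_map :: "('m \<Rightarrow> 'n) \<Rightarrow> ('m \<Rightarrow>\<^sub>0 complex) \<Rightarrow> ('n \<Rightarrow>\<^sub>0 complex)" where
  "monoid_algebra_map h p =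
     (\<Sum>u\<in>Poly_Mapping.keys p. Poly_Mapping.single (h u) (Poly_Mapping.lookup p u))"

definition toric_ring :: "'v::euclidean_space set \<Rightarrow> 'v set \<Rightarrow> ('v \<Rightarrow>\<^sub>0 complex) ring" where
  "toric_ring L C = monoid_algebra (dual_cone C \<inter> dual_lattice L)"

definition cox_ring :: "'v::euclidean_space set \<Rightarrow> (('v set \<Rightarrow>\<^sub>0 nat) \<Rightarrow>\<^sub>0 complex) ring" where
  "cox_ring C = monoid_algebra {a. Poly_Mapping.keys a \<subseteq> edges C}"

definition cox_var :: "'v set \<Rightarrow> (('v set \<Rightarrow>\<^sub>0 nat) \<Rightarrow>\<^sub>0 complex)" where
  "cox_var \<xi> = Poly_Mapping.single (Poly_Mapping.single \<xi> 1) 1"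

text \<open>The exponent of \<open>x\<^sup>u\<close>; for \<open>u\<close> in the dual cone all pairings are nonnegative.\<close>

definition cox_exponent ::
  "'v::euclidean_space set \<Rightarrow> 'v set \<Rightarrow> 'v \<Rightarrow> ('v set \<Rightarrow>\<^sub>0 nat)" where
  "cox_exponent L C u =
     (\<Sum>\<xi>\<in>edges C. Poly_Mapping.single \<xi> (nat (pairing u (primitive_generator L \<xi>))))"

definition cox_group :: "'v::euclidean_space set \<Rightarrow> 'v set \<Rightarrow> ('v set \<Rightarrow> complex) set" where
  "cox_group L C =
     {\<mu> \<in> edges C \<rightarrow>\<^sub>E (UNIV - {0}).
        \<forall>u\<in>dual_lattice L. (\<Prod>\<xi>\<in>edges C. \<mu> \<xi> powi pairing u (primitive_generator L \<xi>)) = 1}"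

text \<open>The diagonal action, substituting \<open>\<mu>\<^sub>\<xi> x\<^sub>\<xi>\<close> for \<open>x\<^sub>\<xi>\<close>.\<close>

definition diag_act ::
  "('x \<Rightarrow> complex) \<Rightarrow> (('x \<Rightarrow>\<^sub>0 nat) \<Rightarrow>\<^sub>0 complex) \<Rightarrow> (('x \<Rightarrow>\<^sub>0 nat) \<Rightarrow>\<^sub>0 complex)" where
  "diag_act \<mu> p =
     (\<Sum>a\<in>Poly_Mapping.keys p.
        Poly_Mapping.single a ((\<Prod>\<xi>\<in>Poly_Mapping.keys a. \<mu> \<xi> ^ Poly_Mapping.lookup a \<xi>) * Poly_Mapping.lookup p a))"

text \<open>
  Elements of \<open>R Quot I\<close> are cosets, that is, sets of polynomials. If \<open>I\<close> is stable, the induced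
  action sends the coset \<open>X\<close> to its image \<open>diag_act \<mu> ` X\<close>.
\<close>

definition invariant_quotient ::
  "('x \<Rightarrow> complex) set \<Rightarrow> (('x \<Rightarrow>\<^sub>0 nat) \<Rightarrow>\<^sub>0 complex) ring \<Rightarrow> (('x \<Rightarrow>\<^sub>0 nat) \<Rightarrow>\<^sub>0 complex) set
     \<Rightarrow> (('x \<Rightarrow>\<^sub>0 nat) \<Rightarrow>\<^sub>0 complex) set ring" where
  "invariant_quotient G R I =
     (R Quot I)\<lparr>carrier := {X \<in> carrier (R Quot I). \<forall>\<mu>\<in>G. diag_act \<mu> ` X = X}\<rparr>"

definition cox_binomial ::
  "'a::euclidean_space set \<Rightarrow> ('a \<times> (real ^ 'k::finite)) set \<Rightarrow> 'k
     \<Rightarrow> ((('a \<times> (real ^ 'k)) set \<Rightarrow>\<^sub>0 nat) \<Rightarrow>\<^sub>0 complex)" where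
  "cox_binomial N C i =
     (let w = (\<lambda>\<xi>. pairing (dual_basis_vector i) (primitive_generator (ext_lattice N) \<xi>)) in
       (\<Prod>\<xi> | \<xi> \<in> edges C \<and> w \<xi> > 0. cox_var \<xi> ^ nat (w \<xi>)) -
       (\<Prod>\<xi> | \<xi> \<in> edges C \<and> w \<xi> < 0. cox_var \<xi> ^ nat (- w \<xi>)))"

definition regular_sequence :: "('r, 'z) ring_scheme \<Rightarrow> 'r list \<Rightarrow> bool" where
  "regular_sequence R fs \<longleftrightarrow>
     set fs \<subseteq> carrier R \<and>
     (\<forall>i<length fs. \<forall>p\<in>carrier R.
        fs ! i \<otimes>\<^bsub>R\<^esub> p \<in> Idl\<^bsub>R\<^esub> (set (take i fs)) \<longrightarrow> p \<in> Idl\<^bsub>R\<^esub> (set (take i fs))) \<and>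
     Idl\<^bsub>R\<^esub> (set fs) \<noteq> carrier R"

end

theory Submission
  imports Defs
begin

text \<open>
  The edges of the extended cone fall into blocks: those coming from \<open>\<sigma>\<close>, where all \<open>e\<^sub>i\<^sup>*\<close> vanish, and
  for each summand \<open>Q\<^sub>j\<close> the multiples \<open>m (q, e\<^sub>j)\<close> with \<open>q\<close> a vertex of \<open>Q\<^sub>j\<close> and \<open>m\<close> its denominator. So the
  binomials are \<open>y\<^sub>i - y\<^sub>0\<close>, where \<open>y\<^sub>0, \<dots>, y\<^sub>k\<close> are monomials in disjoint sets of variables. The
  vertex of \<open>Q\<close> at which a functional positive on \<open>\<sigma>\<close> is minimal yields an edge in every block, and
  all but one of its summands are lattice points; hence all \<open>y\<^sub>j\<close> except possibly one contain a
  variable with exponent 1. Eliminating these variables shows that every subset of the binomials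
  generates the kernel of a map to the group algebra of an ordered group, that is, a prime ideal.
  This gives both primality and, since no binomial lies in the ideal of the others, regularity.
  As \<open>\<complex>\<^sup>*\<close> is divisible, the invariant monomials are the \<open>x\<^sup>u\<close> with \<open>u\<close> in the dual of the extended cone,
  and two of them agree modulo \<open>I\<close> exactly if the projections to \<open>M\<close> agree. Finally, \<open>u \<in> \<sigma>\<^sup>\<or>\<close> lifts to the
  dual of the extended cone by rounding the minima of \<open>u\<close> on the summands; at most one of these is
  not an integer, so rounding does not make their sum negative.
\<close>

section \<open>Monoid algebras\<close>

text \<open>The unit exponents decide primality: already \<open>x\<^sup>2 - y\<^sup>2\<close>
  factors, and in general the exponents modulo the lattice of relations may have torsion. One block
  without a variable of exponent 1 does no harm, because its monomial can stay as the common value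
  of the others. Regularity follows from primality for subsets since, modulo a prime ideal, being a
  non-zero-divisor means being nonzero. Rationality is assumed of \<open>Q\<close> alone; a vertex
  of a summand is completed to a vertex of \<open>Q\<close>, and if it is not integral itself, all
  other summands are. The edges of the extended cone are never listed: every edge has one of the two
  shapes, and only above one well chosen vertex are edges produced. An invariant class modulo the
  ideal must be represented by an invariant polynomial without averaging over the group: the ideal
  is homogeneous for the grading by the ordered group, each element of the Cox group scales a graded
  piece of the polynomial ring by one factor, and pieces scaled nontrivially are dropped.\<close>

abbreviation keys where "keys \<equiv> Poly_Mapping.keys"
abbreviation lookup where "lookup \<equiv> Poly_Mapping.lookup"
abbreviation single where "single \<equiv> Poly_Mapping.single"

lemma poly_mapping_eq_sum_single: "p = (\<Sum>u\<in>keys p. single u (lookup p u))"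
proof (rule poly_mapping_eqI)
  fix k
  show "lookup p k = lookup (\<Sum>u\<in>keys p. single u (lookup p u)) k"
    by (cases "k \<in> keys p")
      (auto simp: lookup_sum lookup_single when_def sum.delta' in_keys_iff intro!: sum.neutral)
qed

lemma monoid_algebra_map_superset:
  assumes "finite S" "keys p \<subseteq> S"
  shows "monoid_algebra_map h p = (\<Sum>u\<in>S. single (h u) (lookup p u))"
  unfolding monoid_algebra_map_def
  by (rule sum.mono_neutral_left) (use assms in \<open>auto simp: in_keys_iff\<close>)

lemma monoid_algebra_map_zero [simp]: "monoid_algebra_map h 0 = 0"
  by (simp add: monoid_algebra_map_def)

lemma monoid_algebra_map_single [simp]: "monoid_algebra_map h (single a c) = single (h a) c"
  by (simp add: monoid_algebra_map_def)

lemma monoid_algebra_map_one [simp]: "h 0 = 0 \<Longrightarrow> monoid_algebra_map h 1 = 1"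
  by (metis monoid_algebra_map_single single_one)

lemma monoid_algebra_map_add:
  "monoid_algebra_map h (p + q) = monoid_algebra_map h p + monoid_algebra_map h q"
proof -
  let ?S = "keys p \<union> keys q"
  have "keys (p + q) \<subseteq> ?S" by (rule keys_add)
  then have "monoid_algebra_map h (p + q) = (\<Sum>u\<in>?S. single (h u) (lookup (p + q) u))"
    by (intro monoid_algebra_map_superset) auto
  also have "\<dots> = (\<Sum>u\<in>?S. single (h u) (lookup p u)) + (\<Sum>u\<in>?S. single (h u) (lookup q u))"
    by (simp add: lookup_add single_add sum.distrib)
  also have "\<dots> = monoid_algebra_map h p + monoid_algebra_map h q"
    by (subst (1 2) monoid_algebra_map_superset[where S = ?S]) auto
  finally show ?thesis .
qed

lemma monoid_algebra_map_uminus: "monoid_algebra_map h (- p) = - monoid_algebra_map h p"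
  using monoid_algebra_map_add[of h p "- p"] by (simp add: eq_neg_iff_add_eq_0 add.commute)

lemma monoid_algebra_map_diff:
  "monoid_algebra_map h (p - q) = monoid_algebra_map h p - monoid_algebra_map h q"
  using monoid_algebra_map_add[of h p "- q"] by (simp add: monoid_algebra_map_uminus)

lemma monoid_algebra_map_sum:
  "monoid_algebra_map h (\<Sum>i\<in>S. p i) = (\<Sum>i\<in>S. monoid_algebra_map h (p i))"
  by (induction S rule: infinite_finite_induct) (auto simp: monoid_algebra_map_add)

lemma monoid_algebra_map_cong:
  "(\<And>u. u \<in> keys p \<Longrightarrow> h u = h' u) \<Longrightarrow> monoid_algebra_map h p = monoid_algebra_map h' p"
  by (simp add: monoid_algebra_map_def)

lemma monoid_algebra_map_comp:
  "monoid_algebra_map g (monoid_algebra_map h p) = monoid_algebra_map (\<lambda>u. g (h u)) p"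
  by (simp add: monoid_algebra_map_def[of h] monoid_algebra_map_sum) (simp add: monoid_algebra_map_def)

lemma keys_sum_subset: "keys (\<Sum>i\<in>S. p i) \<subseteq> (\<Union>i\<in>S. keys (p i))"
proof (induction S rule: infinite_finite_induct)
  case (insert x F)
  then show ?case using keys_add[of "p x" "\<Sum>i\<in>F. p i"] by auto
qed auto

lemma keys_monoid_algebra_map: "keys (monoid_algebra_map h p) \<subseteq> h ` keys p"
  unfolding monoid_algebra_map_def
  using keys_sum_subset[of "\<lambda>u. single (h u) (lookup p u)" "keys p"] by (fastforce split: if_splits)

lemma lookup_monoid_algebra_map:
  "lookup (monoid_algebra_map h p) g = (\<Sum>u | u \<in> keys p \<and> h u = g. lookup p u)"
proof -
  have "lookup (monoid_algebra_map h p) g = (\<Sum>u\<in>keys p. if h u = g then lookup p u else 0)"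
    by (simp add: monoid_algebra_map_def lookup_sum lookup_single when_def)
  also have "\<dots> = (\<Sum>u | u \<in> keys p \<and> h u = g. lookup p u)"
    by (simp add: sum.inter_filter)
  finally show ?thesis .
qed

text \<open>Without collisions in \<open>S\<close>, every coefficient of \<open>p\<close> reappears
  as a coefficient of the image.\<close>

lemma monoid_algebra_map_eq_0_imp:
  assumes "inj_on h S" "keys p \<subseteq> S" "monoid_algebra_map h p = 0"
  shows "p = 0"
proof (rule poly_mapping_eqI)
  fix k
  show "lookup p k = lookup 0 k"
  proof (cases "k \<in> keys p")
    case True
    have "{u. u \<in> keys p \<and> h u = h k} = {k}" using assms(1,2) True by (auto dest: inj_onD)
    then have "lookup (monoid_algebra_map h p) (h k) = lookup p k"
      by (simp add: lookup_monoid_algebra_map)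
    then show ?thesis using assms(3) by simp
  qed (simp add: in_keys_iff)
qed

text \<open>Additivity of \<open>h\<close> is required on \<open>S\<close> only:
  \<open>cox_exponent\<close> truncates negative pairings by \<open>nat\<close> and is additive on
  the dual cone, where none occur.\<close>

lemma monoid_algebra_map_mult:
  assumes "\<And>a b. a \<in> S \<Longrightarrow> b \<in> S \<Longrightarrow> h (a + b) = h a + h b"
    and "keys p \<subseteq> S" "keys q \<subseteq> S"
  shows "monoid_algebra_map h (p * q) = monoid_algebra_map h p * monoid_algebra_map h q"
proof -
  have "p * q = (\<Sum>u\<in>keys p. \<Sum>v\<in>keys q. single (u + v) (lookup p u * lookup q v))"
    by (subst (1) poly_mapping_eq_sum_single[of p], subst (1) poly_mapping_eq_sum_single[of q])
      (simp add: sum_product mult_single)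
  then have "monoid_algebra_map h (p * q) =
      (\<Sum>u\<in>keys p. \<Sum>v\<in>keys q. single (h (u + v)) (lookup p u * lookup q v))"
    by (simp add: monoid_algebra_map_sum)
  also have "\<dots> = (\<Sum>u\<in>keys p. \<Sum>v\<in>keys q. single (h u) (lookup p u) * single (h v) (lookup q v))"
    using assms by (intro sum.cong refl) (auto simp: mult_single subset_iff)
  also have "\<dots> = monoid_algebra_map h p * monoid_algebra_map h q"
    by (simp add: monoid_algebra_map_def sum_product)
  finally show ?thesis .
qed

section \<open>Monoid algebras as commutative rings\<close>

definition submonoid_add :: "'m::comm_monoid_add set \<Rightarrow> bool" where
  "submonoid_add S \<longleftrightarrow> 0 \<in> S \<and> (\<forall>a\<in>S. \<forall>b\<in>S. a + b \<in> S)"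

lemma monoid_algebra_simps [simp]:
  "carrier (monoid_algebra S) = {p. keys p \<subseteq> S}"
  "mult (monoid_algebra S) = (*)"
  "one (monoid_algebra S) = 1"
  "zero (monoid_algebra S) = 0"
  "add (monoid_algebra S) = (+)" by (simp_all add: monoid_algebra_def)

lemma cring_monoid_algebra:
  assumes "submonoid_add S"
  shows "cring (monoid_algebra S)"
proof (rule cringI)
  have add: "keys (p + q) \<subseteq> S" if "keys p \<subseteq> S" "keys q \<subseteq> S" for p q :: "'a \<Rightarrow>\<^sub>0 complex"
    using that keys_add[of p q] by blast
  have mult: "keys (p * q) \<subseteq> S" if "keys p \<subseteq> S" "keys q \<subseteq> S" for p q :: "'a \<Rightarrow>\<^sub>0 complex"
    using that keys_mult[of p q] assms unfolding submonoid_add_def by blast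
  show "abelian_group (monoid_algebra S)"
  proof (rule abelian_groupI)
    fix x assume "x \<in> carrier (monoid_algebra S)"
    then show "\<exists>y\<in>carrier (monoid_algebra S). y \<oplus>\<^bsub>monoid_algebra S\<^esub> x = \<zero>\<^bsub>monoid_algebra S\<^esub>"
      by (intro bexI[of _ "- x"]) (auto simp: in_keys_iff)
  qed (use add in \<open>auto simp: ac_simps\<close>)
  show "comm_monoid (monoid_algebra S)"
    by (rule comm_monoidI) (use mult assms in \<open>auto simp: ac_simps submonoid_add_def\<close>)
qed (simp add: distrib_right)

lemma monoid_algebra_a_inv:
  assumes "submonoid_add S" "keys p \<subseteq> S"
  shows "\<ominus>\<^bsub>monoid_algebra S\<^esub> p = - p"
proof -
  interpret cring "monoid_algebra S" by (rule cring_monoid_algebra) fact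
  have "keys (- p) \<subseteq> S" using assms(2) by (auto simp: in_keys_iff)
  then show ?thesis using minus_equality[of "- p" p] assms(2) by simp
qed

lemma monoid_algebra_a_minus:
  assumes "submonoid_add S" "keys p \<subseteq> S" "keys q \<subseteq> S"
  shows "p \<ominus>\<^bsub>monoid_algebra S\<^esub> q = p - q"
  using assms by (simp add: a_minus_def monoid_algebra_a_inv)

lemma ideal_monoid_algebra_diff:
  assumes "submonoid_add S" "ideal I (monoid_algebra S)" "p \<in> I" "q \<in> I"
  shows "p - q \<in> I"
proof -
  interpret ideal I "monoid_algebra S" by fact
  have "p \<ominus>\<^bsub>monoid_algebra S\<^esub> q \<in> I" unfolding a_minus_def
    by (intro additive_subgroup.a_closed[OF is_additive_subgroup]
        additive_subgroup.a_inv_closed[OF is_additive_subgroup] assms(3,4))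
  then show ?thesis using assms Icarr by (simp add: monoid_algebra_a_minus)
qed

lemma ideal_monoid_algebra_sum:
  assumes "ideal I (monoid_algebra S)" "\<And>i. i \<in> A \<Longrightarrow> p i \<in> I"
  shows "(\<Sum>i\<in>A. p i) \<in> I"
proof -
  interpret ideal I "monoid_algebra S" by fact
  show ?thesis using assms(2)
  proof (induction A rule: infinite_finite_induct)
    case (insert x F)
    then show ?case
      using additive_subgroup.a_closed[OF is_additive_subgroup, of "p x" "\<Sum>i\<in>F. p i"] by simp
  qed (use additive_subgroup.zero_closed[OF is_additive_subgroup] in auto)
qed

lemma r_coset_monoid_algebra: "I +>\<^bsub>monoid_algebra S\<^esub> p = (\<lambda>i. i + p) ` I"
  by (auto simp: a_r_coset_def r_coset_def)

lemma r_coset_monoid_algebra_eq_iff: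
  assumes "submonoid_add S" "ideal I (monoid_algebra S)" "keys p \<subseteq> S" "keys q \<subseteq> S"
  shows "I +>\<^bsub>monoid_algebra S\<^esub> p = I +>\<^bsub>monoid_algebra S\<^esub> q \<longleftrightarrow> p - q \<in> I"
proof -
  interpret cring "monoid_algebra S" by (rule cring_monoid_algebra) fact
  show ?thesis
    using quotient_eq_iff_same_a_r_cos[of I p q] assms by (simp add: monoid_algebra_a_minus)
qed

lemma submonoid_add_exponents: "submonoid_add {a :: 'x \<Rightarrow>\<^sub>0 nat. keys a \<subseteq> E}"
  unfolding submonoid_add_def using keys_add by fastforce

section \<open>Binomial ideals with disjoint supports\<close>

text \<open>The exponent of the monomial in which \<open>y\<^sub>j\<close>, the monomial with
  exponent \<open>Y j\<close>, occurs \<open>n j\<close> times.\<close>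

definition nat_comb :: "('j \<Rightarrow> 'x \<Rightarrow>\<^sub>0 nat) \<Rightarrow> 'j set \<Rightarrow> ('j \<Rightarrow> nat) \<Rightarrow> 'x \<Rightarrow>\<^sub>0 nat" where
  "nat_comb Y J n = (\<Sum>j\<in>J. \<Sum>t<n j. Y j)"

lemma lookup_nat_comb: "lookup (nat_comb Y J n) \<xi> = (\<Sum>j\<in>J. n j * lookup (Y j) \<xi>)"
  by (simp add: nat_comb_def lookup_sum)

text \<open>What the geometry has to provide. The index exempted by \<open>unit_Y\<close> is
  arbitrary; it may be the base index \<open>z\<^sub>0\<close>, whose monomial is subtracted in all
  binomials.\<close>

locale binomial_data =
  fixes E :: "'x set" and Y :: "'j::finite \<Rightarrow> 'x \<Rightarrow>\<^sub>0 nat" and z\<^sub>0 :: 'j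
  assumes finite_E: "finite E"
    and keys_Y: "keys (Y j) \<subseteq> E"
    and disjoint_Y: "i \<noteq> j \<Longrightarrow> keys (Y i) \<inter> keys (Y j) = {}"
    and nonzero_Y: "Y j \<noteq> 0"
    and unit_Y: "\<exists>j\<^sub>0. \<forall>j. j \<noteq> j\<^sub>0 \<longrightarrow> (\<exists>\<xi>. lookup (Y j) \<xi> = 1)"
begin

definition exponents :: "('x \<Rightarrow>\<^sub>0 nat) set" where
  "exponents = {a. keys a \<subseteq> E}"

definition poly_ring :: "(('x \<Rightarrow>\<^sub>0 nat) \<Rightarrow>\<^sub>0 complex) ring" where
  "poly_ring = monoid_algebra exponents"

definition binom :: "'j \<Rightarrow> ('x \<Rightarrow>\<^sub>0 nat) \<Rightarrow>\<^sub>0 complex" where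
  "binom i = single (Y i) 1 - single (Y z\<^sub>0) 1"

definition binom_ideal :: "'j set \<Rightarrow> (('x \<Rightarrow>\<^sub>0 nat) \<Rightarrow>\<^sub>0 complex) set" where
  "binom_ideal J = Idl\<^bsub>poly_ring\<^esub> (binom ` J)"

text \<open>Congruence modulo the lattice spanned by \<open>Y j - Y z\<^sub>0\<close> for
  \<open>j \<in> J\<close>. Coefficients with sum 0 treat \<open>z\<^sub>0\<close> like any other
  index, so that another base index can be used in \<open>ordered_quotient\<close>.\<close>

definition lattice_equiv :: "'j set \<Rightarrow> ('x \<Rightarrow>\<^sub>0 nat) \<Rightarrow> ('x \<Rightarrow>\<^sub>0 nat) \<Rightarrow> bool" where
  "lattice_equiv J a b \<longleftrightarrow> (\<exists>c :: 'j \<Rightarrow> int. (\<Sum>j\<in>insert z\<^sub>0 J. c j) = 0 \<and>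
     (\<forall>\<xi>. int (lookup a \<xi>) - int (lookup b \<xi>) = (\<Sum>j\<in>insert z\<^sub>0 J. c j * int (lookup (Y j) \<xi>))))"

lemma submonoid_exponents: "submonoid_add exponents"
  unfolding exponents_def by (rule submonoid_add_exponents)

lemma Y_in_exponents [simp]: "Y j \<in> exponents" using keys_Y by (simp add: exponents_def)

lemma exponents_sum: "(\<And>i. i \<in> A \<Longrightarrow> f i \<in> exponents) \<Longrightarrow> sum f A \<in> exponents"
  using submonoid_exponents
  by (induction A rule: infinite_finite_induct) (auto simp: submonoid_add_def)

lemma nat_comb_in_exponents: "nat_comb Y J n \<in> exponents"
  unfolding nat_comb_def by (intro exponents_sum) simp

lemma cring_poly_ring: "cring poly_ring"
  unfolding poly_ring_def by (rule cring_monoid_algebra) (rule submonoid_exponents)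

lemma carrier_poly_ring: "carrier poly_ring = {p. keys p \<subseteq> exponents}"
  by (simp add: poly_ring_def)

lemma single_in_carrier: "a \<in> exponents \<Longrightarrow> single a c \<in> carrier poly_ring"
  by (simp add: carrier_poly_ring)

lemma diff_in_carrier:
  "p \<in> carrier poly_ring \<Longrightarrow> q \<in> carrier poly_ring \<Longrightarrow> p - q \<in> carrier poly_ring"
  by (auto simp: carrier_poly_ring in_keys_iff lookup_minus subset_iff) metis

lemma binom_in_carrier: "binom i \<in> carrier poly_ring"
  by (simp add: binom_def diff_in_carrier single_in_carrier)

lemma ideal_binom_ideal: "ideal (binom_ideal J) poly_ring"
proof -
  interpret cring poly_ring by (rule cring_poly_ring)
  show ?thesis unfolding binom_ideal_def by (rule genideal_ideal) (use binom_in_carrier in auto)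
qed

lemma binom_ideal_subset: "binom_ideal J \<subseteq> carrier poly_ring"
  by (rule subsetI) (rule ideal.Icarr[OF ideal_binom_ideal])

lemma binom_in_binom_ideal: "i \<in> insert z\<^sub>0 J \<Longrightarrow> binom i \<in> binom_ideal J"
proof -
  interpret cring poly_ring by (rule cring_poly_ring)
  have *: "binom ` J \<subseteq> binom_ideal J"
    unfolding binom_ideal_def by (rule genideal_self) (use binom_in_carrier in auto)
  interpret ideal "binom_ideal J" poly_ring by (rule ideal_binom_ideal)
  have "\<zero>\<^bsub>poly_ring\<^esub> \<in> binom_ideal J"
    by (rule additive_subgroup.zero_closed[OF is_additive_subgroup])
  then have "binom z\<^sub>0 \<in> binom_ideal J" by (simp add: binom_def poly_ring_def)
  with * show "i \<in> insert z\<^sub>0 J \<Longrightarrow> binom i \<in> binom_ideal J" by auto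
qed

lemma binom_ideal_add: "p \<in> binom_ideal J \<Longrightarrow> q \<in> binom_ideal J \<Longrightarrow> p + q \<in> binom_ideal J"
  using additive_subgroup.a_closed[OF ideal.axioms(1)[OF ideal_binom_ideal], of p J q]
  by (simp add: poly_ring_def)

lemma binom_ideal_diff: "p \<in> binom_ideal J \<Longrightarrow> q \<in> binom_ideal J \<Longrightarrow> p - q \<in> binom_ideal J"
  using ideal_monoid_algebra_diff[OF submonoid_exponents] ideal_binom_ideal
  unfolding poly_ring_def by blast

lemma binom_ideal_sum: "(\<And>i. i \<in> A \<Longrightarrow> p i \<in> binom_ideal J) \<Longrightarrow> sum p A \<in> binom_ideal J"
  using ideal_monoid_algebra_sum ideal_binom_ideal unfolding poly_ring_def by metis

lemma binom_ideal_mult: "p \<in> carrier poly_ring \<Longrightarrow> q \<in> binom_ideal J \<Longrightarrow> p * q \<in> binom_ideal J"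
  using ideal.I_l_closed[OF ideal_binom_ideal, of q J p] by (simp add: poly_ring_def)

lemma single_diff_add_mem:
  assumes "single a 1 - single b 1 \<in> binom_ideal J" "single a' 1 - single b' 1 \<in> binom_ideal J"
    "b \<in> exponents" "a' \<in> exponents"
  shows "single (a + a') 1 - single (b + b') (1 :: complex) \<in> binom_ideal J"
proof -
  have "single (a + a') 1 - single (b + b') (1 :: complex) =
      single a' 1 * (single a 1 - single b 1) + single b 1 * (single a' 1 - single b' 1)"
    by (simp add: algebra_simps mult_single)
  also have "\<dots> \<in> binom_ideal J"
    by (intro binom_ideal_add binom_ideal_mult assms single_in_carrier)
  finally show ?thesis .
qed

lemma zero_in_binom_ideal: "0 \<in> binom_ideal J" using binom_ideal_sum[of "{}"] by simp

text \<open>Modulo the ideal all \<open>y\<^sub>j\<close> with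
  \<open>j \<in> insert z\<^sub>0 J\<close> equal \<open>y\<^sub>0\<close>, so a product of them
  depends only on the number of factors.\<close>

lemma nat_comb_mem:
  assumes "K \<subseteq> insert z\<^sub>0 J"
  shows "single (nat_comb Y K n) 1 - single (\<Sum>t<sum n K. Y z\<^sub>0) (1 :: complex) \<in> binom_ideal J"
proof -
  have *: "single (\<Sum>t<m. Y j) 1 - single (\<Sum>t<m. Y z\<^sub>0) (1 :: complex) \<in> binom_ideal J"
    if "j \<in> insert z\<^sub>0 J" for m :: nat and j
  proof (induction m)
    case (Suc m)
    have "single (Y j) 1 - single (Y z\<^sub>0) (1 :: complex) \<in> binom_ideal J"
      using binom_in_binom_ideal[OF that] by (simp add: binom_def)
    then show ?case
      using single_diff_add_mem[OF Suc.IH] exponents_sum[of "{..<m}" "\<lambda>_. Y z\<^sub>0"] by (simp add: add.commute)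
  qed (simp add: zero_in_binom_ideal)
  have "finite K" by simp
  then show ?thesis using assms
  proof (induction K)
    case (insert j K)
    have eq: "(\<Sum>t<sum n (insert j K). Y z\<^sub>0) = (\<Sum>t<n j. Y z\<^sub>0) + (\<Sum>t<sum n K. Y z\<^sub>0)"
      by (rule poly_mapping_eqI) (use insert in \<open>simp add: lookup_sum lookup_add algebra_simps\<close>)
    have eq': "nat_comb Y (insert j K) n = (\<Sum>t<n j. Y j) + nat_comb Y K n"
      using insert by (simp add: nat_comb_def)
    show ?case unfolding eq eq' by (rule single_diff_add_mem[OF *])
        (use insert in \<open>auto intro!: nat_comb_in_exponents exponents_sum\<close>)
  qed (simp add: zero_in_binom_ideal nat_comb_def)
qed

text \<open>
  Since the exponents \<open>Y j\<close> have disjoint supports, the negative part of a lattice vector divides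
  one monomial and the positive part the other.
\<close>

lemma lattice_equiv_imp_mem:
  assumes "lattice_equiv J a b" "a \<in> exponents"
  shows "single a 1 - single b (1 :: complex) \<in> binom_ideal J"
proof -
  let ?K = "insert z\<^sub>0 J"
  obtain c :: "'j \<Rightarrow> int" where c: "(\<Sum>j\<in>?K. c j) = 0"
    "\<And>\<xi>. int (lookup a \<xi>) - int (lookup b \<xi>) = (\<Sum>j\<in>?K. c j * int (lookup (Y j) \<xi>))"
    using assms(1) unfolding lattice_equiv_def by blast
  \<comment> \<open>With the positive and negative parts of \<open>c\<close>, the relation becomes
    \<open>a + M = b + P\<close>.\<close>
  define P where "P = nat_comb Y ?K (\<lambda>j. nat (c j))"
  define M where "M = nat_comb Y ?K (\<lambda>j. nat (- c j))"
  have PM: "lookup a \<xi> + lookup M \<xi> = lookup b \<xi> + lookup P \<xi>" for \<xi>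
  proof -
    have "int (lookup P \<xi>) - int (lookup M \<xi>) = (\<Sum>j\<in>?K. (int (nat (c j)) - int (nat (- c j))) * int (lookup (Y j) \<xi>))"
      by (simp only: P_def M_def lookup_nat_comb of_nat_sum of_nat_mult left_diff_distrib sum_subtractf)
    also have "\<dots> = (\<Sum>j\<in>?K. c j * int (lookup (Y j) \<xi>))" by (intro sum.cong) auto
    finally show ?thesis using c(2)[of \<xi>] by linarith
  qed
  have le: "lookup P \<xi> \<le> lookup a \<xi>" for \<xi>
  proof (cases "lookup P \<xi> = 0")
    case False
    then obtain j where j: "j \<in> ?K" "nat (c j) * lookup (Y j) \<xi> \<noteq> 0"
      unfolding P_def lookup_nat_comb by (meson sum.not_neutral_contains_not_neutral)
    have "nat (- c i) * lookup (Y i) \<xi> = 0" if "i \<in> ?K" for i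
    proof (cases "i = j")
      case False
      then have "lookup (Y i) \<xi> = 0" using disjoint_Y[OF False] j(2) by (auto simp: in_keys_iff)
      then show ?thesis by simp
    qed (use j in auto)
    then have "lookup M \<xi> = 0" unfolding M_def lookup_nat_comb by (intro sum.neutral) auto
    then show ?thesis using PM[of \<xi>] by simp
  qed auto
  define r where "r = a - P"
  have a: "a = r + P"
    by (rule poly_mapping_eqI) (use le in \<open>simp add: r_def lookup_add lookup_minus\<close>)
  have b: "b = r + M"
    by (rule poly_mapping_eqI) (use le PM in \<open>simp add: r_def lookup_add lookup_minus; metis diff_add_assoc2 diff_add_inverse2\<close>)
  have "keys r \<subseteq> keys a" by (auto simp: r_def in_keys_iff lookup_minus)
  then have r: "r \<in> exponents" using assms(2) by (auto simp: exponents_def)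
  \<comment> \<open>Coefficient sum 0 gives both monomials the same number of factors, so both are
    congruent to the same power of \<open>y\<^sub>0\<close>.\<close>
  have "int (\<Sum>j\<in>?K. nat (c j)) - int (\<Sum>j\<in>?K. nat (- c j)) = (\<Sum>j\<in>?K. c j)"
    unfolding of_nat_sum sum_subtractf[symmetric] by (intro sum.cong) auto
  then have "(\<Sum>j\<in>?K. nat (c j)) = (\<Sum>j\<in>?K. nat (- c j))" using c(1) by linarith
  then have "single P 1 - single M (1 :: complex) \<in> binom_ideal J"
    using binom_ideal_diff[OF nat_comb_mem[of ?K J "\<lambda>j. nat (c j)"] nat_comb_mem[of ?K J "\<lambda>j. nat (- c j)"]]
    by (simp add: P_def M_def)
  then have "single r 1 * (single P 1 - single M (1 :: complex)) \<in> binom_ideal J"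
    by (intro binom_ideal_mult single_in_carrier r)
  then show ?thesis by (simp add: a b algebra_simps mult_single)
qed

text \<open>The kernel is an ideal containing the generators. Conversely, replacing each monomial by
  a fixed representative of its fibre changes \<open>p\<close> only by elements of the ideal, and
  the result depends on the image of \<open>p\<close> alone. Only the fibres of \<open>h\<close>
  matter, so its target is left open.\<close>

lemma binom_ideal_iff:
  fixes h :: "('x \<Rightarrow>\<^sub>0 nat) \<Rightarrow> 'g::comm_monoid_add"
  assumes add: "\<And>a b. h (a + b) = h a + h b"
    and eq: "\<And>a b. a \<in> exponents \<Longrightarrow> b \<in> exponents \<Longrightarrow> h a = h b \<longleftrightarrow> lattice_equiv J a b"
    and p: "p \<in> carrier poly_ring"
  shows "p \<in> binom_ideal J \<longleftrightarrow> monoid_algebra_map h p = 0"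
proof
  interpret cring poly_ring by (rule cring_poly_ring)
  let ?K = "{q \<in> carrier poly_ring. monoid_algebra_map h q = 0}"
  have mult: "monoid_algebra_map h (q * r) = monoid_algebra_map h q * monoid_algebra_map h r" for q r
    using monoid_algebra_map_mult[of UNIV h q r] add by simp
  have "ideal ?K poly_ring"
  proof (rule idealI[OF ring_axioms])
    have um: "\<ominus>\<^bsub>poly_ring\<^esub> q = - q" if "q \<in> carrier poly_ring" for q
      using monoid_algebra_a_inv[OF submonoid_exponents] that by (simp add: poly_ring_def)
    show "subgroup ?K (add_monoid poly_ring)"
    proof (rule add.subgroupI)
      fix q assume q: "q \<in> ?K"
      then have "\<ominus>\<^bsub>poly_ring\<^esub> q \<in> carrier poly_ring" by simp
      then show "\<ominus>\<^bsub>poly_ring\<^esub> q \<in> ?K"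
        using q um by (simp add: monoid_algebra_map_uminus)
      fix r assume r: "r \<in> ?K"
      have "q \<oplus>\<^bsub>poly_ring\<^esub> r \<in> carrier poly_ring" using q r by simp
      then show "q \<oplus>\<^bsub>poly_ring\<^esub> r \<in> ?K"
        using q r by (simp add: monoid_algebra_map_add poly_ring_def)
    qed (auto intro!: exI[of _ 0] simp: carrier_poly_ring)
  next
    fix q r assume q: "q \<in> ?K" and r: "r \<in> carrier poly_ring"
    then have "r \<otimes>\<^bsub>poly_ring\<^esub> q \<in> carrier poly_ring" "q \<otimes>\<^bsub>poly_ring\<^esub> r \<in> carrier poly_ring"
      by simp_all
    then show "r \<otimes>\<^bsub>poly_ring\<^esub> q \<in> ?K" "q \<otimes>\<^bsub>poly_ring\<^esub> r \<in> ?K"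
      using q by (simp_all add: mult poly_ring_def)
  qed
  moreover have "binom ` J \<subseteq> ?K"
  proof clarify
    fix i assume i: "i \<in> J"
    have "lattice_equiv J (Y i) (Y z\<^sub>0)"
    proof (cases "i = z\<^sub>0")
      case True
      then show ?thesis unfolding lattice_equiv_def by (intro exI[of _ "\<lambda>_. 0"]) simp
    next
      case False
      have *: "(\<Sum>j\<in>insert z\<^sub>0 J. (of_bool (j = i) - of_bool (j = z\<^sub>0)) * f j) = f i - f z\<^sub>0" for f :: "'j \<Rightarrow> int"
        using i by (simp add: left_diff_distrib sum_subtractf of_bool_def if_distrib[of "\<lambda>x. x * _"] sum.delta cong: if_cong)
      show ?thesis unfolding lattice_equiv_def
        using *[of "\<lambda>_. 1"] *[of "\<lambda>j. int (lookup (Y j) _)"]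
        by (intro exI[of _ "\<lambda>j. of_bool (j = i) - of_bool (j = z\<^sub>0)"]) auto
    qed
    then have "h (Y i) = h (Y z\<^sub>0)" using eq by simp
    then show "binom i \<in> carrier poly_ring \<and> monoid_algebra_map h (binom i) = 0"
      by (simp add: binom_in_carrier) (simp add: binom_def monoid_algebra_map_diff)
  qed
  ultimately have "binom_ideal J \<subseteq> ?K"
    unfolding binom_ideal_def by (rule genideal_minimal)
  then show "p \<in> binom_ideal J \<Longrightarrow> monoid_algebra_map h p = 0" by auto
next
  assume 0: "monoid_algebra_map h p = 0"
  \<comment> \<open>One representative per fibre, so that \<open>a \<mapsto> r (h a)\<close> factors
    through \<open>h\<close>.\<close>
  define r where "r g = (SOME a. a \<in> exponents \<and> h a = g)" for g
  have r: "r (h a) \<in> exponents \<and> h (r (h a)) = h a" if "a \<in> exponents" for a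
    unfolding r_def by (rule someI[of _ a]) (use that in simp)
  have "single a (lookup p a) - single (r (h a)) (lookup p a) \<in> binom_ideal J" if "a \<in> keys p" for a
  proof -
    have a: "a \<in> exponents" using p that by (auto simp: carrier_poly_ring)
    have "single 0 (lookup p a) * (single a 1 - single (r (h a)) 1) \<in> binom_ideal J"
      using eq[OF a, of "r (h a)"] r[OF a] a submonoid_exponents
      by (intro binom_ideal_mult lattice_equiv_imp_mem single_in_carrier) (auto simp: submonoid_add_def)
    then show ?thesis by (simp add: algebra_simps mult_single)
  qed
  then have "(\<Sum>a\<in>keys p. single a (lookup p a) - single (r (h a)) (lookup p a)) \<in> binom_ideal J"
    by (rule binom_ideal_sum)
  then have "p - monoid_algebra_map (\<lambda>a. r (h a)) p \<in> binom_ideal J"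
    by (simp add: sum_subtractf monoid_algebra_map_def flip: poly_mapping_eq_sum_single)
  moreover have "monoid_algebra_map (\<lambda>a. r (h a)) p = 0"
    using 0 by (simp flip: monoid_algebra_map_comp)
  ultimately show "p \<in> binom_ideal J" by simp
qed

text \<open>
  Away from one index every \<open>Y j\<close> contains a variable with exponent 1; eliminating these variables
  identifies \<open>\<int>\<^sup>E\<close> modulo the lattice with a free abelian group, which can be ordered
  lexicographically.
\<close>

lemma ordered_quotient:
  obtains h :: "('x \<Rightarrow>\<^sub>0 nat) \<Rightarrow> (nat \<Rightarrow>\<^sub>0 int)"
  where "\<And>a b. h (a + b) = h a + h b"
    and "\<And>a b. a \<in> exponents \<Longrightarrow> b \<in> exponents \<Longrightarrow> h a = h b \<longleftrightarrow> lattice_equiv J a b"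
proof -
  let ?K = "insert z\<^sub>0 J"
  obtain j\<^sub>1 where j\<^sub>1: "\<And>j. j \<noteq> j\<^sub>1 \<Longrightarrow> \<exists>\<xi>. lookup (Y j) \<xi> = 1"
    using unit_Y by blast
  \<comment> \<open>In a subfamily without the exceptional index any other index may take its place;
    \<open>z\<^sub>0\<close> is always present.\<close>
  define j\<^sub>0 where "j\<^sub>0 = (if j\<^sub>1 \<in> ?K then j\<^sub>1 else z\<^sub>0)"
  have j\<^sub>0: "j\<^sub>0 \<in> ?K" by (simp add: j\<^sub>0_def)
  have "\<exists>\<xi>. lookup (Y j) \<xi> = 1" if "j \<in> ?K - {j\<^sub>0}" for j
    using that j\<^sub>1[of j] by (auto simp: j\<^sub>0_def split: if_splits)
  then obtain \<zeta> where \<zeta>: "\<And>j. j \<in> ?K - {j\<^sub>0} \<Longrightarrow> lookup (Y j) (\<zeta> j) = 1"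
    by metis
  \<comment> \<open>Numbering the variables puts the values of \<open>h\<close> into
    \<open>nat \<Rightarrow>\<^sub>0 int\<close>, which is linearly ordered; hence its group algebra
    has no zero divisors.\<close>
  obtain e :: "'x \<Rightarrow> nat" where e: "inj_on e E"
    using finite_imp_inj_to_nat_seg[OF finite_E] by blast
  \<comment> \<open>Adding \<open>a (\<zeta> j)\<close> times the lattice vector
    \<open>Y j\<^sub>0 - Y j\<close> clears the coordinate \<open>\<zeta> j\<close>, since there
    \<open>Y j\<close> is 1 and all other blocks vanish.\<close>
  define H :: "('x \<Rightarrow> int) \<Rightarrow> 'x \<Rightarrow> int" where
    "H a \<xi> = a \<xi> + (\<Sum>j\<in>?K - {j\<^sub>0}. a (\<zeta> j) * (int (lookup (Y j\<^sub>0) \<xi>) - int (lookup (Y j) \<xi>)))" for a \<xi>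
  define h :: "('x \<Rightarrow>\<^sub>0 nat) \<Rightarrow> (nat \<Rightarrow>\<^sub>0 int)" where
    "h a = (\<Sum>\<xi>\<in>E. single (e \<xi>) (H (\<lambda>\<xi>. int (lookup a \<xi>)) \<xi>))" for a
  have H_add: "H (\<lambda>\<xi>. a \<xi> + b \<xi>) \<xi> = H a \<xi> + H b \<xi>" for a b \<xi>
    by (simp add: H_def distrib_right sum.distrib)
  have H_diff: "H (\<lambda>\<xi>. a \<xi> - b \<xi>) \<xi> = H a \<xi> - H b \<xi>" for a b \<xi>
    by (simp add: H_def left_diff_distrib sum_subtractf)
  show thesis
  proof (rule that)
    show "h (a + b) = h a + h b" for a b
      by (simp add: h_def lookup_add H_add single_add sum.distrib)
    have h_iff: "h a = h b \<longleftrightarrow> (\<forall>\<xi>\<in>E. H (\<lambda>\<xi>. int (lookup a \<xi>)) \<xi> = H (\<lambda>\<xi>. int (lookup b \<xi>)) \<xi>)" for a b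
    proof
      have lk: "lookup (h c) (e \<xi>) = H (\<lambda>\<xi>. int (lookup c \<xi>)) \<xi>" if "\<xi> \<in> E" for c \<xi>
      proof -
        have "lookup (h c) (e \<xi>) = (\<Sum>\<eta>\<in>E. if \<eta> = \<xi> then H (\<lambda>\<xi>. int (lookup c \<xi>)) \<eta> else 0)"
          unfolding h_def lookup_sum lookup_single when_def
          by (intro sum.cong) (use e that in \<open>auto dest: inj_onD\<close>)
        then show ?thesis using that finite_E by simp
      qed
      show "h a = h b \<Longrightarrow> \<forall>\<xi>\<in>E. H (\<lambda>\<xi>. int (lookup a \<xi>)) \<xi> = H (\<lambda>\<xi>. int (lookup b \<xi>)) \<xi>"
        by (metis lk)
    qed (simp add: h_def)
    show "h a = h b \<longleftrightarrow> lattice_equiv J a b" if a: "a \<in> exponents" and b: "b \<in> exponents" for a b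
    proof -
      define D where "D \<xi> = int (lookup a \<xi>) - int (lookup b \<xi>)" for \<xi>
      have "h a = h b \<longleftrightarrow> (\<forall>\<xi>\<in>E. H D \<xi> = 0)"
        unfolding h_iff D_def H_diff by simp
      also have "\<dots> \<longleftrightarrow> (\<forall>\<xi>. H D \<xi> = 0)"
      proof -
        have "H D \<xi> = 0" if "\<xi> \<notin> E" for \<xi>
        proof -
          have "\<xi> \<notin> keys a" "\<xi> \<notin> keys b" "\<And>j. \<xi> \<notin> keys (Y j)"
            using that a b keys_Y by (auto simp: exponents_def)
          then show ?thesis by (simp add: H_def D_def in_keys_iff)
        qed
        then show ?thesis by blast
      qed
      also have "\<dots> \<longleftrightarrow> lattice_equiv J a b"
      proof
        assume H: "\<forall>\<xi>. H D \<xi> = 0"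
        \<comment> \<open>\<open>H D = 0\<close> writes \<open>D\<close> as a combination of the
          \<open>Y j - Y j\<^sub>0\<close>; the coefficient at \<open>j\<^sub>0\<close> is what
          makes the sum vanish.\<close>
        define c where "c j = (if j = j\<^sub>0 then - (\<Sum>j\<in>?K - {j\<^sub>0}. D (\<zeta> j)) else D (\<zeta> j))" for j
        have split: "(\<Sum>j\<in>?K. c j * f j) = (\<Sum>j\<in>?K - {j\<^sub>0}. D (\<zeta> j) * (f j - f j\<^sub>0))" for f :: "'j \<Rightarrow> int"
        proof -
          have "(\<Sum>j\<in>?K. c j * f j) = c j\<^sub>0 * f j\<^sub>0 + (\<Sum>j\<in>?K - {j\<^sub>0}. c j * f j)"
            by (rule sum.remove) (use j\<^sub>0 in auto)
          also have "\<dots> = (\<Sum>j\<in>?K - {j\<^sub>0}. D (\<zeta> j) * (f j - f j\<^sub>0))"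
            by (simp add: c_def right_diff_distrib sum_subtractf sum_distrib_right sum_negf)
          finally show ?thesis .
        qed
        have "D \<xi> = (\<Sum>j\<in>?K. c j * int (lookup (Y j) \<xi>))" for \<xi>
          using H[rule_format, of \<xi>] unfolding split H_def
          by (simp add: right_diff_distrib sum_subtractf)
        moreover have "(\<Sum>j\<in>?K. c j) = 0" using split[of "\<lambda>_. 1"] by simp
        ultimately show "lattice_equiv J a b" unfolding lattice_equiv_def D_def by blast
      next
        assume "lattice_equiv J a b"
        then obtain c where c: "(\<Sum>j\<in>?K. c j) = 0" "\<And>\<xi>. D \<xi> = (\<Sum>j\<in>?K. c j * int (lookup (Y j) \<xi>))"
          unfolding lattice_equiv_def D_def by blast
        \<comment> \<open>Among the blocks only \<open>Y j\<close> is nonzero at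
          \<open>\<zeta> j\<close>, with value 1, so the coefficients of a lattice vector can be
          read off at these variables.\<close>
        have D\<zeta>: "D (\<zeta> j) = c j" if j: "j \<in> ?K - {j\<^sub>0}" for j
        proof -
          have "lookup (Y i) (\<zeta> j) = (if i = j then 1 else 0)" for i
            using disjoint_Y[of i j] \<zeta>[OF j] by (force simp: in_keys_iff)
          then have "D (\<zeta> j) = (\<Sum>i\<in>?K. if i = j then c i else 0)"
            unfolding c(2) by (intro sum.cong) auto
          then show ?thesis using j by simp
        qed
        have cj: "c j\<^sub>0 = - (\<Sum>j\<in>?K - {j\<^sub>0}. c j)"
          using c(1) sum.remove[of ?K j\<^sub>0 c] j\<^sub>0 by simp
        show "\<forall>\<xi>. H D \<xi> = 0"
        proof
          fix \<xi>
          have "H D \<xi> = D \<xi> + (\<Sum>j\<in>?K - {j\<^sub>0}. c j * (int (lookup (Y j\<^sub>0) \<xi>) - int (lookup (Y j) \<xi>)))"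
            by (simp add: H_def D\<zeta>)
          moreover have "D \<xi> = c j\<^sub>0 * int (lookup (Y j\<^sub>0) \<xi>) + (\<Sum>j\<in>?K - {j\<^sub>0}. c j * int (lookup (Y j) \<xi>))"
            unfolding c(2) by (rule sum.remove) (use j\<^sub>0 in auto)
          ultimately show "H D \<xi> = 0"
            by (simp add: cj right_diff_distrib sum_subtractf sum_distrib_right)
        qed
      qed
      finally show ?thesis .
    qed
  qed
qed

text \<open>The quotient embeds into the group algebra of a linearly ordered group, where a product
  of leading terms cannot cancel. Arbitrary \<open>J\<close> is needed for the initial segments in
  \<open>regular_sequence_binom\<close>.\<close>

lemma primeideal_binom_ideal: "primeideal (binom_ideal J) poly_ring"
proof -
  obtain h :: "('x \<Rightarrow>\<^sub>0 nat) \<Rightarrow> (nat \<Rightarrow>\<^sub>0 int)" where h: "\<And>a b. h (a + b) = h a + h b"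
    "\<And>a b. a \<in> exponents \<Longrightarrow> b \<in> exponents \<Longrightarrow> h a = h b \<longleftrightarrow> lattice_equiv J a b"
    using ordered_quotient[of J] by blast
  note iff = binom_ideal_iff[of h J, OF h]
  show ?thesis
  proof (rule primeidealI[OF ideal_binom_ideal cring_poly_ring])
    have "h 0 = 0" using h(1)[of 0 0] by simp
    then have "1 \<notin> binom_ideal J"
      using iff[of 1] submonoid_exponents by (simp add: carrier_poly_ring submonoid_add_def)
    then show "carrier poly_ring \<noteq> binom_ideal J"
      using submonoid_exponents by (auto simp: carrier_poly_ring submonoid_add_def)
  next
    fix p q assume pq: "p \<in> carrier poly_ring" "q \<in> carrier poly_ring" "p \<otimes>\<^bsub>poly_ring\<^esub> q \<in> binom_ideal J"
    then have "p * q \<in> binom_ideal J" by (simp add: poly_ring_def)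
    then have "monoid_algebra_map h (p * q) = 0" using iff[of "p * q"] binom_ideal_subset by blast
    then have "monoid_algebra_map h p * monoid_algebra_map h q = 0"
      using monoid_algebra_map_mult[of UNIV h p q] h(1) by simp
    then show "p \<in> binom_ideal J \<or> q \<in> binom_ideal J" using iff pq by auto
  qed
qed

text \<open>A variable of \<open>Y i\<close> occurs in none of the blocks indexed by
  \<open>insert z\<^sub>0 J\<close>, so a lattice vector equal to \<open>Y i - Y z\<^sub>0\<close>
  would force its exponent to be 0.\<close>

lemma binom_notin:
  assumes "i \<notin> insert z\<^sub>0 J"
  shows "binom i \<notin> binom_ideal J"
proof
  assume mem: "binom i \<in> binom_ideal J"
  obtain h :: "('x \<Rightarrow>\<^sub>0 nat) \<Rightarrow> (nat \<Rightarrow>\<^sub>0 int)" where h: "\<And>a b. h (a + b) = h a + h b"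
    "\<And>a b. a \<in> exponents \<Longrightarrow> b \<in> exponents \<Longrightarrow> h a = h b \<longleftrightarrow> lattice_equiv J a b"
    using ordered_quotient[of J] by blast
  have "single (h (Y i)) (1::complex) = single (h (Y z\<^sub>0)) 1"
    using mem binom_ideal_iff[of h J "binom i", OF h binom_in_carrier]
    by (simp add: binom_def monoid_algebra_map_diff)
  then have "h (Y i) = h (Y z\<^sub>0)"
    by (metis lookup_single_eq lookup_single_not_eq zero_neq_one)
  then obtain c where c: "\<And>\<xi>. int (lookup (Y i) \<xi>) - int (lookup (Y z\<^sub>0) \<xi>) = (\<Sum>j\<in>insert z\<^sub>0 J. c j * int (lookup (Y j) \<xi>))"
    using h(2) by (auto simp: lattice_equiv_def)
  obtain \<xi> where \<xi>: "\<xi> \<in> keys (Y i)"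
    using nonzero_Y[of i] by (metis in_keys_iff lookup_zero poly_mapping_eqI)
  have "lookup (Y j) \<xi> = 0" if "j \<in> insert z\<^sub>0 J" for j
  proof -
    have "i \<noteq> j" using that assms by auto
    then have "\<xi> \<notin> keys (Y j)" using disjoint_Y[of i j] \<xi> by blast
    then show ?thesis by (simp add: in_keys_iff)
  qed
  then have "int (lookup (Y i) \<xi>) = 0" using c[of \<xi>] by simp
  with \<xi> show False by (simp add: in_keys_iff)
qed

text \<open>Modulo a prime ideal every element outside the ideal is a non-zero-divisor, so
  \<open>binom_notin\<close> for the initial segments suffices.\<close>

lemma regular_sequence_binom:
  assumes "distinct js" "z\<^sub>0 \<notin> set js"
  shows "regular_sequence poly_ring (map binom js)" unfolding regular_sequence_def
proof (intro conjI allI impI ballI)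
  show "set (map binom js) \<subseteq> carrier poly_ring" using binom_in_carrier by auto
  show "Idl\<^bsub>poly_ring\<^esub> (set (map binom js)) \<noteq> carrier poly_ring"
    using primeideal.I_notcarr[OF primeideal_binom_ideal, of "set js"] by (simp add: binom_ideal_def)
next
  fix i p assume i: "i < length (map binom js)" and p: "p \<in> carrier poly_ring"
  let ?J = "set (take i js)"
  have Idl: "Idl\<^bsub>poly_ring\<^esub> (set (take i (map binom js))) = binom_ideal ?J"
    by (simp add: binom_ideal_def take_map)
  assume "map binom js ! i \<otimes>\<^bsub>poly_ring\<^esub> p \<in> Idl\<^bsub>poly_ring\<^esub> (set (take i (map binom js)))"
  then have "binom (js ! i) \<otimes>\<^bsub>poly_ring\<^esub> p \<in> binom_ideal ?J"
    using i unfolding Idl by simp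
  then have "binom (js ! i) \<in> binom_ideal ?J \<or> p \<in> binom_ideal ?J"
    by (rule primeideal.I_prime[OF primeideal_binom_ideal binom_in_carrier p])
  moreover have "js ! i \<notin> insert z\<^sub>0 ?J"
    using assms i by (auto simp: in_set_conv_nth nth_eq_iff_index_eq)
  ultimately show "p \<in> Idl\<^bsub>poly_ring\<^esub> (set (take i (map binom js)))"
    using binom_notin unfolding Idl by blast
qed

end

section \<open>Diagonal actions and invariants\<close>

text \<open>The factor by which \<open>\<mu>\<close> scales the monomial
  \<open>x\<^sup>a\<close>.\<close>

definition monomial_weight :: "('x \<Rightarrow> complex) \<Rightarrow> ('x \<Rightarrow>\<^sub>0 nat) \<Rightarrow> complex" where
  "monomial_weight \<mu> a = (\<Prod>\<xi>\<in>keys a. \<mu> \<xi> ^ lookup a \<xi>)"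

lemma monomial_weight_superset:
  "finite S \<Longrightarrow> keys a \<subseteq> S \<Longrightarrow> monomial_weight \<mu> a = (\<Prod>\<xi>\<in>S. \<mu> \<xi> ^ lookup a \<xi>)"
  unfolding monomial_weight_def by (rule prod.mono_neutral_left) (auto simp: in_keys_iff)

lemma lookup_diag_act: "lookup (diag_act \<mu> p) a = monomial_weight \<mu> a * lookup p a"
proof -
  have "lookup (diag_act \<mu> p) a = (\<Sum>b\<in>keys p. if b = a then monomial_weight \<mu> a * lookup p a else 0)"
    unfolding diag_act_def lookup_sum lookup_single when_def
    by (intro sum.cong) (auto simp: monomial_weight_def)
  then show ?thesis by (auto simp: in_keys_iff)
qed

lemma keys_diag_act: "keys (diag_act \<mu> p) \<subseteq> keys p"
  by (auto simp: in_keys_iff lookup_diag_act)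

lemma diag_act_add: "diag_act \<mu> (p + q) = diag_act \<mu> p + diag_act \<mu> q"
  by (rule poly_mapping_eqI) (simp add: lookup_diag_act lookup_add algebra_simps)

lemma diag_act_trivial:
  "(\<And>a. a \<in> keys p \<Longrightarrow> monomial_weight \<mu> a = 1) \<Longrightarrow> diag_act \<mu> p = p"
  by (rule poly_mapping_eqI) (auto simp: lookup_diag_act in_keys_iff)

lemma diag_act_inverse:
  assumes "finite E" "\<And>a. a \<in> keys p \<Longrightarrow> keys a \<subseteq> E" "\<And>\<xi>. \<xi> \<in> E \<Longrightarrow> \<mu> \<xi> * \<nu> \<xi> = 1"
  shows "diag_act \<mu> (diag_act \<nu> p) = p"
proof (rule poly_mapping_eqI)
  fix a
  show "lookup (diag_act \<mu> (diag_act \<nu> p)) a = lookup p a"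
  proof (cases "a \<in> keys p")
    case True
    have "monomial_weight \<mu> a * monomial_weight \<nu> a = (\<Prod>\<xi>\<in>E. (\<mu> \<xi> * \<nu> \<xi>) ^ lookup a \<xi>)"
      unfolding monomial_weight_superset[OF assms(1) assms(2)[OF True]] by (simp only: prod.distrib power_mult_distrib)
    also have "\<dots> = 1" by (rule prod.neutral) (simp add: assms(3))
    finally have "monomial_weight \<mu> a * (monomial_weight \<nu> a * lookup p a) = lookup p a"
      by (metis mult.assoc mult_1)
    then show ?thesis by (simp only: lookup_diag_act)
  qed (simp add: lookup_diag_act in_keys_iff)
qed

text \<open>A weight that is constant on the fibre over \<open>g\<close> can be pulled out of the
  coefficient sum. An empty fibre admits every \<open>w\<close>; this is used with
  \<open>w = 0\<close>.\<close>

lemma lookup_monoid_algebra_map_diag_act: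
  assumes "\<And>a. a \<in> keys p \<Longrightarrow> h a = g \<Longrightarrow> monomial_weight \<mu> a = w"
  shows "lookup (monoid_algebra_map h (diag_act \<mu> p)) g = w * lookup (monoid_algebra_map h p) g"
proof -
  have "lookup (monoid_algebra_map h (diag_act \<mu> p)) g
      = (\<Sum>a\<in>keys p. if h a = g then w * lookup p a else 0)"
    unfolding monoid_algebra_map_superset[OF finite_keys keys_diag_act] lookup_sum lookup_single when_def lookup_diag_act
    by (intro sum.cong) (use assms in auto)
  then show ?thesis by (simp add: lookup_monoid_algebra_map sum_distrib_left flip: sum.inter_filter)
qed

section \<open>Diagonal actions modulo the binomial ideal\<close>

context binomial_data
begin

text \<open>The condition under which the action of \<open>\<mu>\<close> descends to the quotient by
  \<open>binom_ideal J\<close>.\<close>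

definition lattice_invariant :: "'j set \<Rightarrow> ('x \<Rightarrow> complex) \<Rightarrow> bool" where
  "lattice_invariant J \<mu> \<longleftrightarrow> (\<forall>a\<in>exponents. \<forall>b\<in>exponents.
     lattice_equiv J a b \<longrightarrow> monomial_weight \<mu> a = monomial_weight \<mu> b)"

lemma lattice_invariantD:
  "lattice_invariant J \<mu> \<Longrightarrow> a \<in> exponents \<Longrightarrow> b \<in> exponents \<Longrightarrow> lattice_equiv J a b
    \<Longrightarrow> monomial_weight \<mu> a = monomial_weight \<mu> b"
  unfolding lattice_invariant_def by blast

lemma diag_act_in_carrier: "p \<in> carrier poly_ring \<Longrightarrow> diag_act \<mu> p \<in> carrier poly_ring"
  using keys_diag_act by (auto simp: carrier_poly_ring)

text \<open>Each fibre of \<open>h\<close> is scaled by a single factor, so vanishing of the image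
  under \<open>h\<close> is preserved coefficient by coefficient.\<close>

lemma diag_act_mem_binom_ideal:
  assumes \<mu>: "lattice_invariant J \<mu>" and p: "p \<in> binom_ideal J"
  shows "diag_act \<mu> p \<in> binom_ideal J"
proof -
  obtain h :: "('x \<Rightarrow>\<^sub>0 nat) \<Rightarrow> (nat \<Rightarrow>\<^sub>0 int)" where h: "\<And>a b. h (a + b) = h a + h b"
    "\<And>a b. a \<in> exponents \<Longrightarrow> b \<in> exponents \<Longrightarrow> h a = h b \<longleftrightarrow> lattice_equiv J a b"
    using ordered_quotient[of J] by blast
  have iff: "q \<in> binom_ideal J \<longleftrightarrow> monoid_algebra_map h q = 0" if "q \<in> carrier poly_ring" for q
    by (rule binom_ideal_iff[OF h(1) _ that]) (rule h(2))
  have carr: "p \<in> carrier poly_ring" using p binom_ideal_subset by blast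
  then have ex: "a \<in> exponents" if "a \<in> keys p" for a
    using that by (auto simp: carrier_poly_ring)
  have "lookup (monoid_algebra_map h (diag_act \<mu> p)) g = 0" for g
  proof (cases "\<exists>a\<in>keys p. h a = g")
    case True
    then obtain a where a: "a \<in> keys p" "h a = g" by blast
    have "lookup (monoid_algebra_map h (diag_act \<mu> p)) g = monomial_weight \<mu> a * lookup (monoid_algebra_map h p) g"
    proof (rule lookup_monoid_algebra_map_diag_act)
      fix b assume b: "b \<in> keys p" "h b = g"
      have "lattice_equiv J b a" using h(2)[OF ex[OF b(1)] ex[OF a(1)]] a(2) b(2) by simp
      then show "monomial_weight \<mu> b = monomial_weight \<mu> a"
        by (rule lattice_invariantD[OF \<mu> ex[OF b(1)] ex[OF a(1)]])
    qed
    then show ?thesis using iff[OF carr] p by simp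
  next
    case False
    then have "lookup (monoid_algebra_map h (diag_act \<mu> p)) g = 0 * lookup (monoid_algebra_map h p) g"
      by (intro lookup_monoid_algebra_map_diag_act) auto
    then show ?thesis by simp
  qed
  then have "monoid_algebra_map h (diag_act \<mu> p) = 0" by (intro poly_mapping_eqI) simp
  then show ?thesis using iff[OF diag_act_in_carrier[OF carr]] by simp
qed

text \<open>The terms of \<open>p\<close> over one value of \<open>h\<close> are either all fixed by
  \<open>G\<close>, or some \<open>\<mu>\<close> scales them by a common factor other than 1. In the
  second case their coefficients add up to 0, so they can be deleted modulo the ideal.\<close>

lemma invariant_representative:
  assumes G: "\<And>\<mu>. \<mu> \<in> G \<Longrightarrow> lattice_invariant J \<mu>"
    and p: "p \<in> carrier poly_ring"
    and inv: "\<And>\<mu>. \<mu> \<in> G \<Longrightarrow> diag_act \<mu> p - p \<in> binom_ideal J"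
  obtains q where "q \<in> carrier poly_ring" "p - q \<in> binom_ideal J"
    "\<And>a \<mu>. a \<in> keys q \<Longrightarrow> \<mu> \<in> G \<Longrightarrow> monomial_weight \<mu> a = 1"
proof -
  obtain h :: "('x \<Rightarrow>\<^sub>0 nat) \<Rightarrow> (nat \<Rightarrow>\<^sub>0 int)" where h: "\<And>a b. h (a + b) = h a + h b"
    "\<And>a b. a \<in> exponents \<Longrightarrow> b \<in> exponents \<Longrightarrow> h a = h b \<longleftrightarrow> lattice_equiv J a b"
    using ordered_quotient[of J] by blast
  have iff: "q \<in> binom_ideal J \<longleftrightarrow> monoid_algebra_map h q = 0" if "q \<in> carrier poly_ring" for q
    by (rule binom_ideal_iff[OF h(1) _ that]) (rule h(2))
  have ex: "a \<in> exponents" if "a \<in> keys p" for a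
    using p that by (auto simp: carrier_poly_ring)
  have wt: "monomial_weight \<mu> a = monomial_weight \<mu> b" if "a \<in> keys p" "b \<in> keys p" "h a = h b" "\<mu> \<in> G" for a b \<mu>
    using lattice_invariantD[OF G[OF that(4)] ex[OF that(1)] ex[OF that(2)]]
      h(2)[OF ex[OF that(1)] ex[OF that(2)]] that(3) by simp
  define B where "B = {a. \<forall>\<mu>\<in>G. monomial_weight \<mu> a = 1}"
  define q where "q = (\<Sum>a\<in>keys p \<inter> B. single a (lookup p a))"
  have lq: "lookup q a = (if a \<in> B then lookup p a else 0)" for a
  proof -
    have "lookup q a = (\<Sum>b\<in>keys p \<inter> B. if b = a then lookup p a else 0)"
      unfolding q_def lookup_sum lookup_single when_def by (intro sum.cong) auto
    then show ?thesis by (auto simp: in_keys_iff)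
  qed
  have qB: "keys q \<subseteq> keys p \<inter> B" by (auto simp: in_keys_iff lq split: if_splits)
  have q: "q \<in> carrier poly_ring" using qB p by (auto simp: carrier_poly_ring)
  have "lookup (monoid_algebra_map h (p - q)) g = 0" for g
  proof -
    have kpq: "keys (p - q) = keys p - B"
      by (auto simp: in_keys_iff lookup_minus lq split: if_splits)
    show ?thesis
    proof (cases "\<exists>a\<in>keys p - B. h a = g")
      case True
      then obtain a where a: "a \<in> keys p" "a \<notin> B" "h a = g" by blast
      then obtain \<mu> where \<mu>: "\<mu> \<in> G" "monomial_weight \<mu> a \<noteq> 1"
        by (auto simp: B_def)
      have "b \<notin> B" if "b \<in> keys p" "h b = g" for b
        using wt[OF a(1) that(1) _ \<mu>(1)] a(3) \<mu> that(2) by (auto simp: B_def)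
      then have "{b \<in> keys (p - q). h b = g} = {b \<in> keys p. h b = g}" unfolding kpq by blast
      moreover have "lookup (p - q) b = lookup p b" if "b \<in> keys (p - q)" for b
        using that by (simp add: kpq lookup_minus lq)
      ultimately have eq: "lookup (monoid_algebra_map h (p - q)) g = lookup (monoid_algebra_map h p) g"
        unfolding lookup_monoid_algebra_map by (intro sum.cong) auto
      \<comment> \<open>At \<open>g\<close> the image is unchanged by \<open>\<mu>\<close> and yet
        multiplied by a factor other than 1, so this coefficient vanishes.\<close>
      have "monoid_algebra_map h (diag_act \<mu> p - p) = 0"
        using inv[OF \<mu>(1)] iff[of "diag_act \<mu> p - p"] binom_ideal_subset by blast
      then have "lookup (monoid_algebra_map h (diag_act \<mu> p)) g = lookup (monoid_algebra_map h p) g"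
        by (simp add: monoid_algebra_map_diff)
      moreover have "lookup (monoid_algebra_map h (diag_act \<mu> p)) g = monomial_weight \<mu> a * lookup (monoid_algebra_map h p) g"
      proof (rule lookup_monoid_algebra_map_diag_act)
        fix b assume "b \<in> keys p" "h b = g"
        then show "monomial_weight \<mu> b = monomial_weight \<mu> a"
          by (intro wt[OF _ a(1) _ \<mu>(1)]) (use a(3) in simp_all)
      qed
      ultimately show ?thesis using eq \<mu>(2) by auto
    next
      case False
      then show ?thesis unfolding lookup_monoid_algebra_map kpq by (intro sum.neutral) auto
    qed
  qed
  then have "monoid_algebra_map h (p - q) = 0" by (intro poly_mapping_eqI) simp
  then have "p - q \<in> binom_ideal J" using iff diff_in_carrier[OF p q] by blast
  with q show thesis using qB by (intro that[of q]) (auto simp: B_def)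
qed

end

section \<open>Characters of finitely generated free abelian groups\<close>
definition int_subgroup :: "('x \<Rightarrow> int) set \<Rightarrow> bool" where
  "int_subgroup H \<longleftrightarrow> (\<lambda>_. 0) \<in> H \<and> (\<forall>a\<in>H. \<forall>b\<in>H. (\<lambda>\<xi>. a \<xi> - b \<xi>) \<in> H)"

text \<open>Only the values of \<open>\<theta>\<close> on \<open>H\<close> matter. With
  non-vanishing, the law for differences contains multiplicativity and
  \<open>\<theta> 0 = 1\<close>.\<close>

definition is_character :: "('x \<Rightarrow> int) set \<Rightarrow> (('x \<Rightarrow> int) \<Rightarrow> complex) \<Rightarrow> bool" where
  "is_character H \<theta> \<longleftrightarrow> (\<forall>a\<in>H. \<theta> a \<noteq> 0) \<and> (\<forall>a\<in>H. \<forall>b\<in>H. \<theta> (\<lambda>\<xi>. a \<xi> - b \<xi>) = \<theta> a / \<theta> b)"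

lemma is_character_nonzero: "is_character H \<theta> \<Longrightarrow> a \<in> H \<Longrightarrow> \<theta> a \<noteq> 0"
  by (simp add: is_character_def)

lemma is_character_diff:
  "is_character H \<theta> \<Longrightarrow> a \<in> H \<Longrightarrow> b \<in> H \<Longrightarrow> \<theta> (\<lambda>\<xi>. a \<xi> - b \<xi>) = \<theta> a / \<theta> b"
  by (simp add: is_character_def)

lemma int_subgroup_0: "int_subgroup H \<Longrightarrow> (\<lambda>_. 0) \<in> H"
  by (simp add: int_subgroup_def)

lemma int_subgroup_diff: "int_subgroup H \<Longrightarrow> a \<in> H \<Longrightarrow> b \<in> H \<Longrightarrow> (\<lambda>\<xi>. a \<xi> - b \<xi>) \<in> H"
  by (simp add: int_subgroup_def)

lemma int_subgroup_add: "int_subgroup H \<Longrightarrow> a \<in> H \<Longrightarrow> b \<in> H \<Longrightarrow> (\<lambda>\<xi>. a \<xi> + b \<xi>) \<in> H"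
proof -
  assume *: "int_subgroup H" "a \<in> H" "b \<in> H"
  have "(\<lambda>\<xi>. 0 - b \<xi>) \<in> H"
    by (rule int_subgroup_diff[OF *(1) int_subgroup_0[OF *(1)] *(3)])
  then have "(\<lambda>\<xi>. a \<xi> - (0 - b \<xi>)) \<in> H"
    by (rule int_subgroup_diff[OF *(1,2)])
  then show ?thesis by simp
qed

lemma is_character_0: "int_subgroup H \<Longrightarrow> is_character H \<theta> \<Longrightarrow> \<theta> (\<lambda>_. 0) = 1"
  using is_character_diff[OF _ int_subgroup_0 int_subgroup_0, of H \<theta>]
    is_character_nonzero[OF _ int_subgroup_0, of H \<theta>] by simp

lemma is_character_add:
  assumes "int_subgroup H" "is_character H \<theta>" "a \<in> H" "b \<in> H"
  shows "\<theta> (\<lambda>\<xi>. a \<xi> + b \<xi>) = \<theta> a * \<theta> b"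
proof -
  have "\<theta> (\<lambda>\<xi>. (a \<xi> + b \<xi>) - b \<xi>) = \<theta> (\<lambda>\<xi>. a \<xi> + b \<xi>) / \<theta> b"
    by (rule is_character_diff[OF assms(2) int_subgroup_add[OF assms(1,3,4)] assms(4)])
  moreover have "\<theta> b \<noteq> 0" by (rule is_character_nonzero[OF assms(2,4)])
  ultimately show ?thesis by simp
qed

lemma int_subgroup_mult:
  assumes "int_subgroup H" "a \<in> H"
  shows "(\<lambda>\<xi>. n * a \<xi>) \<in> H"
proof (induction n rule: int_induct[where k = 0])
  case base
  then show ?case using assms by (simp add: int_subgroup_def)
next
  case (step1 i)
  then show ?case using int_subgroup_add[OF assms(1) step1(2) assms(2)] by (simp add: algebra_simps)
next
  case (step2 i)
  then have "(\<lambda>\<xi>. i * a \<xi> - a \<xi>) \<in> H"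
    by (intro int_subgroup_diff[OF assms(1) step2(2) assms(2)])
  then show ?case by (simp add: algebra_simps)
qed

lemma is_character_mult:
  assumes "int_subgroup H" "is_character H \<theta>" "a \<in> H"
  shows "\<theta> (\<lambda>\<xi>. n * a \<xi>) = \<theta> a powi n"
proof -
  have nz: "\<theta> a \<noteq> 0" by (rule is_character_nonzero[OF assms(2,3)])
  show ?thesis
  proof (induction n rule: int_induct[where k = 0])
    case base
    then show ?case using is_character_0[OF assms(1,2)] by simp
  next
    case (step1 i)
    have "\<theta> (\<lambda>\<xi>. i * a \<xi> + a \<xi>) = \<theta> (\<lambda>\<xi>. i * a \<xi>) * \<theta> a"
      by (rule is_character_add[OF assms(1,2) int_subgroup_mult[OF assms(1,3)] assms(3)])
    then show ?case using step1 nz by (simp add: algebra_simps power_int_add)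
  next
    case (step2 i)
    have "\<theta> (\<lambda>\<xi>. i * a \<xi> - a \<xi>) = \<theta> (\<lambda>\<xi>. i * a \<xi>) / \<theta> a"
      by (rule is_character_diff[OF assms(2) int_subgroup_mult[OF assms(1,3)] assms(3)])
    then show ?case using step2 nz by (simp add: algebra_simps power_int_diff)
  qed
qed

text \<open>
  The hypothesis on \<open>\<zeta>\<close> is exactly what makes \<open>b + n g \<mapsto> \<theta> b * \<zeta> powi n\<close> well defined.
\<close>

lemma extend_character:
  assumes H: "int_subgroup H" and \<theta>: "is_character H \<theta>" and "\<zeta> \<noteq> 0"
    and \<zeta>: "\<And>n. (\<lambda>\<xi>. n * g \<xi>) \<in> H \<Longrightarrow> \<theta> (\<lambda>\<xi>. n * g \<xi>) = \<zeta> powi n"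
  obtains H' \<theta>' where "int_subgroup H'" "is_character H' \<theta>'" "H \<subseteq> H'" "g \<in> H'"
    "\<And>b. b \<in> H \<Longrightarrow> \<theta>' b = \<theta> b" "\<theta>' g = \<zeta>"
proof -
  define H' where "H' = {x. \<exists>n. (\<lambda>\<xi>. x \<xi> - n * g \<xi>) \<in> H}"
  define \<theta>' where "\<theta>' x = (let n = SOME n. (\<lambda>\<xi>. x \<xi> - n * g \<xi>) \<in> H in \<theta> (\<lambda>\<xi>. x \<xi> - n * g \<xi>) * \<zeta> powi n)" for x
  \<comment> \<open>The chosen \<open>n\<close> is irrelevant: two choices differ by a multiple of
    \<open>g\<close> in \<open>H\<close>, where the hypothesis on \<open>\<zeta>\<close>
    applies.\<close>
  have \<theta>'_eq: "\<theta>' x = \<theta> (\<lambda>\<xi>. x \<xi> - n * g \<xi>) * \<zeta> powi n" if n: "(\<lambda>\<xi>. x \<xi> - n * g \<xi>) \<in> H" for x n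
  proof -
    define m where "m = (SOME n. (\<lambda>\<xi>. x \<xi> - n * g \<xi>) \<in> H)"
    have m: "(\<lambda>\<xi>. x \<xi> - m * g \<xi>) \<in> H"
      unfolding m_def by (rule someI) (rule n)
    have eq: "(\<lambda>\<xi>. (x \<xi> - m * g \<xi>) - (x \<xi> - n * g \<xi>)) = (\<lambda>\<xi>. (n - m) * g \<xi>)"
      by (simp add: algebra_simps)
    have "(\<lambda>\<xi>. (n - m) * g \<xi>) \<in> H"
      unfolding eq[symmetric] by (rule int_subgroup_diff[OF H m n])
    then have "\<zeta> powi (n - m) = \<theta> (\<lambda>\<xi>. x \<xi> - m * g \<xi>) / \<theta> (\<lambda>\<xi>. x \<xi> - n * g \<xi>)"
      using \<zeta>[of "n - m"] is_character_diff[OF \<theta> m n] unfolding eq by simp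
    moreover have "\<theta> (\<lambda>\<xi>. x \<xi> - n * g \<xi>) \<noteq> 0"
      by (rule is_character_nonzero[OF \<theta> n])
    moreover have "\<theta>' x = \<theta> (\<lambda>\<xi>. x \<xi> - m * g \<xi>) * \<zeta> powi m"
      by (simp add: \<theta>'_def m_def Let_def)
    moreover have "\<zeta> powi m * \<zeta> powi (n - m) = \<zeta> powi n"
      using \<open>\<zeta> \<noteq> 0\<close> by (simp flip: power_int_add)
    ultimately show ?thesis
      by (metis (no_types, lifting) mult.assoc mult.commute nonzero_eq_divide_eq)
  qed
  have sub: "(\<lambda>\<xi>. (x \<xi> - y \<xi>) - (n - m) * g \<xi>) \<in> H \<and>
      \<theta> (\<lambda>\<xi>. (x \<xi> - y \<xi>) - (n - m) * g \<xi>) = \<theta> (\<lambda>\<xi>. x \<xi> - n * g \<xi>) / \<theta> (\<lambda>\<xi>. y \<xi> - m * g \<xi>)"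
    if "(\<lambda>\<xi>. x \<xi> - n * g \<xi>) \<in> H" "(\<lambda>\<xi>. y \<xi> - m * g \<xi>) \<in> H" for x y n m
  proof -
    have eq: "(\<lambda>\<xi>. (x \<xi> - y \<xi>) - (n - m) * g \<xi>) = (\<lambda>\<xi>. (x \<xi> - n * g \<xi>) - (y \<xi> - m * g \<xi>))"
      by (simp add: algebra_simps)
    show ?thesis
      unfolding eq using int_subgroup_diff[OF H that] is_character_diff[OF \<theta> that] by simp
  qed
  have H0: "x \<in> H \<Longrightarrow> (\<lambda>\<xi>. x \<xi> - 0 * g \<xi>) \<in> H" for x
    by simp
  have g: "(\<lambda>\<xi>. g \<xi> - 1 * g \<xi>) \<in> H" using H by (simp add: int_subgroup_def)
  show thesis
  proof (rule that)
    show HH': "H \<subseteq> H'" using H0 unfolding H'_def by blast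
    show "int_subgroup H'" unfolding int_subgroup_def
    proof (intro conjI ballI)
      show "(\<lambda>_. 0) \<in> H'" using HH' H by (auto simp: int_subgroup_def)
      show "(\<lambda>\<xi>. x \<xi> - y \<xi>) \<in> H'" if "x \<in> H'" "y \<in> H'" for x y
        using that sub unfolding H'_def by blast
    qed
    show "is_character H' \<theta>'" unfolding is_character_def
    proof (intro conjI ballI)
      fix x assume "x \<in> H'"
      then obtain n where n: "(\<lambda>\<xi>. x \<xi> - n * g \<xi>) \<in> H"
        by (auto simp: H'_def)
      then show "\<theta>' x \<noteq> 0"
        using is_character_nonzero[OF \<theta> n] \<open>\<zeta> \<noteq> 0\<close> by (simp add: \<theta>'_eq[OF n])
      fix y assume "y \<in> H'"
      then obtain m where m: "(\<lambda>\<xi>. y \<xi> - m * g \<xi>) \<in> H"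
        by (auto simp: H'_def)
      show "\<theta>' (\<lambda>\<xi>. x \<xi> - y \<xi>) = \<theta>' x / \<theta>' y"
        using \<theta>'_eq[OF conjunct1[OF sub[OF n m]]] conjunct2[OF sub[OF n m]] \<theta>'_eq[OF n] \<theta>'_eq[OF m] \<open>\<zeta> \<noteq> 0\<close>
        by (simp add: power_int_diff)
    qed
    show "g \<in> H'" using g unfolding H'_def by blast
    show "\<theta>' b = \<theta> b" if "b \<in> H" for b using \<theta>'_eq[OF H0[OF that]] by simp
    show "\<theta>' g = \<zeta>" using \<theta>'_eq[OF g] is_character_0[OF H \<theta>] by simp
  qed
qed

text \<open>The admissible multipliers form an ideal of \<int>, hence a principal one;
  \<open>d\<close> is the order of \<open>g\<close> modulo \<open>H\<close>, with
  \<open>d = 0\<close> for infinite order.\<close>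

lemma multiples_in_subgroup:
  fixes g :: "'x \<Rightarrow> int"
  assumes H: "int_subgroup H"
  obtains d :: nat where "\<And>n. (\<lambda>\<xi>. n * g \<xi>) \<in> H \<longleftrightarrow> int d dvd n"
proof (cases "\<exists>d>0. (\<lambda>\<xi>. int d * g \<xi>) \<in> H")
  case True
  define d where "d = (LEAST d. d > 0 \<and> (\<lambda>\<xi>. int d * g \<xi>) \<in> H)"
  have d: "d > 0" "(\<lambda>\<xi>. int d * g \<xi>) \<in> H"
    unfolding d_def using LeastI_ex[OF True] by auto
  have least: "\<not> (m > 0 \<and> (\<lambda>\<xi>. int m * g \<xi>) \<in> H)" if "m < d" for m
    using not_less_Least[OF that[unfolded d_def]] .
  have "int d dvd n" if n: "(\<lambda>\<xi>. n * g \<xi>) \<in> H" for n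
  proof -
    have "(\<lambda>\<xi>. n * g \<xi> - (n div int d) * (int d * g \<xi>)) \<in> H"
      by (rule int_subgroup_diff[OF H n int_subgroup_mult[OF H d(2)]])
    moreover have "n * g \<xi> - (n div int d) * (int d * g \<xi>) = int (nat (n mod int d)) * g \<xi>" for \<xi>
    proof -
      have "int (nat (n mod int d)) = n - n div int d * int d"
        using d(1) by (simp add: minus_div_mult_eq_mod)
      then show ?thesis by (simp only: left_diff_distrib mult.assoc)
    qed
    moreover have "nat (n mod int d) < d" using d(1) by (simp add: nat_less_iff)
    ultimately have "\<not> nat (n mod int d) > 0" using least[of "nat (n mod int d)"] by simp
    then have "int (nat (n mod int d)) = 0" by (metis gr0I of_nat_0)
    moreover have "int (nat (n mod int d)) = n mod int d"
      by (rule nat_0_le) (rule pos_mod_sign, use d(1) in simp)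
    ultimately have "n mod int d = 0" by linarith
    then show ?thesis by (rule mod_0_imp_dvd)
  qed
  moreover have "(\<lambda>\<xi>. n * g \<xi>) \<in> H" if "int d dvd n" for n
    using int_subgroup_mult[OF H d(2), of "n div int d"] that by (simp flip: mult.assoc)
  ultimately show thesis using that by blast
next
  case False
  have "n = 0" if n: "(\<lambda>\<xi>. n * g \<xi>) \<in> H" for n
  proof (rule ccontr)
    assume "n \<noteq> 0"
    then have "nat \<bar>n\<bar> > 0" by simp
    moreover have "(\<lambda>\<xi>. int (nat \<bar>n\<bar>) * g \<xi>) \<in> H"
      using n int_subgroup_mult[OF H n, of "-1"] by (cases "n \<ge> 0") auto
    ultimately show False using False by blast
  qed
  then show thesis using H by (intro that[of 0]) (auto simp: int_subgroup_def)
qed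

text \<open>A new element of order \<open>d\<close> modulo the subgroup may be sent to any
  \<open>d\<close>-th root of the value already prescribed at its \<open>d\<close>-fold, and such
  roots exist in the nonzero complex numbers.\<close>

lemma extend_character_finite:
  assumes "finite F" "int_subgroup H" "is_character H \<theta>"
  shows "\<exists>H' \<theta>'. int_subgroup H' \<and> is_character H' \<theta>' \<and> H \<subseteq> H' \<and> (\<forall>b\<in>H. \<theta>' b = \<theta> b) \<and> F \<subseteq> H'"
  using assms(1)
proof (induction F)
  case empty
  then show ?case using assms by blast
next
  case (insert g F)
  then obtain H' \<theta>' where H': "int_subgroup H'" "is_character H' \<theta>'" "H \<subseteq> H'" "\<forall>b\<in>H. \<theta>' b = \<theta> b" "F \<subseteq> H'"
    by blast
  obtain d :: nat where d: "\<And>n. (\<lambda>\<xi>. n * g \<xi>) \<in> H' \<longleftrightarrow> int d dvd n"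
    using multiples_in_subgroup[OF H'(1)] by blast
  define c where "c = \<theta>' (\<lambda>\<xi>. int d * g \<xi>)"
  have c: "c \<noteq> 0" using d[of "int d"] H'(2) by (auto simp: c_def is_character_def)
  \<comment> \<open>For \<open>d = 0\<close> no value is prescribed except \<open>c = 1\<close> at
    0, and 1 is as good as any other.\<close>
  obtain \<zeta> where \<zeta>: "\<zeta> \<noteq> 0" "\<zeta> ^ d = c"
  proof (cases "d = 0")
    case True
    then have "c = 1" using is_character_0[OF H'(1,2)] by (simp add: c_def)
    then show ?thesis using that[of 1] by simp
  next
    case False
    have "exp (Ln c / of_nat d) ^ d = c" using c False by (simp flip: exp_of_nat_mult)
    then show ?thesis using that[of "exp (Ln c / of_nat d)"] by simp
  qed
  have pow: "\<theta>' (\<lambda>\<xi>. n * g \<xi>) = \<zeta> powi n" if n: "(\<lambda>\<xi>. n * g \<xi>) \<in> H'" for n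
  proof -
    obtain m where m: "n = int d * m" using iffD1[OF d n] by (rule dvdE)
    have "\<theta>' (\<lambda>\<xi>. m * (int d * g \<xi>)) = c powi m"
      unfolding c_def by (rule is_character_mult[OF H'(1,2)]) (simp add: d)
    moreover have "(\<lambda>\<xi>. m * (int d * g \<xi>)) = (\<lambda>\<xi>. n * g \<xi>)"
      by (simp add: m algebra_simps)
    moreover have "\<zeta> powi n = (\<zeta> powi int d) powi m" by (simp only: m power_int_mult)
    ultimately show ?thesis by (simp add: \<zeta>(2))
  qed
  obtain H'' \<theta>'' where "int_subgroup H''" "is_character H'' \<theta>''" "H' \<subseteq> H''" "g \<in> H''"
    "\<And>b. b \<in> H' \<Longrightarrow> \<theta>'' b = \<theta>' b"
    using extend_character[OF H'(1,2) \<zeta>(1) pow] by metis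
  then show ?case using H'(3-5) by (intro exI[of _ H''] exI[of _ \<theta>'']) auto
qed

text \<open>The character that is trivial on \<open>H\<close> and sends \<open>a\<close> to a
  suitable \<open>\<zeta> \<noteq> 1\<close> extends to all unit vectors; its values there are the
  required \<open>\<mu>\<close>.\<close>

lemma separating_character:
  assumes E: "finite E" and H: "int_subgroup H" and supp: "\<And>\<xi>. \<xi> \<notin> E \<Longrightarrow> a \<xi> = 0"
    "\<forall>b\<in>H. \<forall>\<xi>. \<xi> \<notin> E \<longrightarrow> b \<xi> = 0" and a: "a \<notin> H"
  shows "\<exists>\<mu> :: 'x \<Rightarrow> complex. (\<forall>\<xi>\<in>E. \<mu> \<xi> \<noteq> 0) \<and>
    (\<forall>b\<in>H. (\<Prod>\<xi>\<in>E. \<mu> \<xi> powi b \<xi>) = 1) \<and> (\<Prod>\<xi>\<in>E. \<mu> \<xi> powi a \<xi>) \<noteq> 1"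
proof -
  obtain d :: nat where d: "\<And>n. (\<lambda>\<xi>. n * a \<xi>) \<in> H \<longleftrightarrow> int d dvd n"
    using multiples_in_subgroup[OF H] by blast
  have d1: "d \<noteq> 1" using d[of 1] a by simp
  obtain \<zeta> :: complex where \<zeta>: "\<zeta> \<noteq> 0" "\<zeta> \<noteq> 1" "\<zeta> ^ d = 1"
  proof (cases "d = 0")
    \<comment> \<open>Infinite order of \<open>a\<close> modulo \<open>H\<close> leaves the value
      free; for finite order it must be a root of unity, and \<open>d \<noteq> 1\<close> keeps it
      away from 1.\<close>
    case True
    then show ?thesis using that[of 2] by simp
  next
    case False
    have "exp (2 * of_real pi * \<i> / of_nat d) ^ d = (1 :: complex)"
      using False by (simp flip: exp_of_nat_mult)
    moreover have "exp (2 * of_real pi * \<i> * of_nat 1 / of_nat d) \<noteq> exp (2 * of_real pi * \<i> * of_nat 0 / (of_nat d :: complex))"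
      using complex_root_unity_eq[of d 1 0] False d1 by (auto simp: cong_def)
    ultimately show ?thesis using that[of "exp (2 * of_real pi * \<i> / of_nat d)"] by simp
  qed
  have triv: "is_character H (\<lambda>_. 1)" by (simp add: is_character_def)
  have pow: "1 = \<zeta> powi n" if n: "(\<lambda>\<xi>. n * a \<xi>) \<in> H" for n
  proof -
    obtain m where "n = int d * m" using iffD1[OF d n] by (rule dvdE)
    then show ?thesis by (simp add: power_int_mult \<zeta>(3))
  qed
  obtain H1 \<theta>1 where H1: "int_subgroup H1" "is_character H1 \<theta>1" "H \<subseteq> H1" "a \<in> H1"
    "\<And>b. b \<in> H \<Longrightarrow> \<theta>1 b = 1" "\<theta>1 a = \<zeta>"
    using extend_character[OF H triv \<zeta>(1) pow] by metis
  define \<delta> :: "'x \<Rightarrow> 'x \<Rightarrow> int" where "\<delta> \<xi> \<eta> = of_bool (\<xi> = \<eta>)" for \<xi> \<eta>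
  obtain H2 \<theta> where H2: "int_subgroup H2" "is_character H2 \<theta>" "H1 \<subseteq> H2" "\<And>b. b \<in> H1 \<Longrightarrow> \<theta> b = \<theta>1 b" "\<delta> ` E \<subseteq> H2"
    using extend_character_finite[OF _ H1(1,2), of "\<delta> ` E"] E by blast
  have \<theta>F: "(\<lambda>\<eta>. if \<eta> \<in> F then b \<eta> else 0) \<in> H2 \<and> \<theta> (\<lambda>\<eta>. if \<eta> \<in> F then b \<eta> else 0) = (\<Prod>\<xi>\<in>F. \<theta> (\<delta> \<xi>) powi b \<xi>)"
    if "F \<subseteq> E" for F b using finite_subset[OF that E] that
  proof (induction F)
    case empty
    then show ?case using is_character_0[OF H2(1,2)] H2(1) by (simp add: int_subgroup_def)
  next
    case (insert \<xi> F)
    let ?f = "\<lambda>\<eta>. if \<eta> \<in> F then b \<eta> else 0"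
    have \<xi>: "\<delta> \<xi> \<in> H2" using insert H2(5) by auto
    have eq: "(\<lambda>\<eta>. if \<eta> \<in> insert \<xi> F then b \<eta> else 0) = (\<lambda>\<eta>. b \<xi> * \<delta> \<xi> \<eta> + ?f \<eta>)"
      using insert(2) by (auto simp: fun_eq_iff \<delta>_def)
    have IH: "?f \<in> H2" "\<theta> ?f = (\<Prod>\<xi>\<in>F. \<theta> (\<delta> \<xi>) powi b \<xi>)"
      using insert by auto
    have m: "(\<lambda>\<eta>. b \<xi> * \<delta> \<xi> \<eta>) \<in> H2"
      by (rule int_subgroup_mult[OF H2(1) \<xi>])
    show ?case
      unfolding eq using int_subgroup_add[OF H2(1) m IH(1)] is_character_add[OF H2(1,2) m IH(1)]
        is_character_mult[OF H2(1,2) \<xi>, of "b \<xi>"] IH(2) insert(1,2) by simp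
  qed
  have \<theta>E: "\<theta> b = (\<Prod>\<xi>\<in>E. \<theta> (\<delta> \<xi>) powi b \<xi>)" if "\<And>\<xi>. \<xi> \<notin> E \<Longrightarrow> b \<xi> = 0" for b
  proof -
    have "(\<lambda>\<eta>. if \<eta> \<in> E then b \<eta> else 0) = b" using that by auto
    then show ?thesis using \<theta>F[of E b] by simp
  qed
  show ?thesis
  proof (intro exI[of _ "\<lambda>\<xi>. \<theta> (\<delta> \<xi>)"] conjI ballI)
    show "\<theta> (\<delta> \<xi>) \<noteq> 0" if "\<xi> \<in> E" for \<xi>
      using that H2(2,5) by (auto simp: is_character_def)
    show "(\<Prod>\<xi>\<in>E. \<theta> (\<delta> \<xi>) powi b \<xi>) = 1" if "b \<in> H" for b
      using \<theta>E[of b] supp(2) that H2(4) H1(3,5) by (metis subsetD)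
    show "(\<Prod>\<xi>\<in>E. \<theta> (\<delta> \<xi>) powi a \<xi>) \<noteq> 1"
      using \<theta>E[of a] supp(1) H2(4) H1(4,6) \<zeta>(2) by metis
  qed
qed

section \<open>Polyhedra and their extreme points\<close>

lemma polyhedron_inequalities:
  fixes P :: "'a::euclidean_space set"
  assumes "polyhedron P"
  obtains A where "finite A" "P = {x. \<forall>(a, b)\<in>A. a \<bullet> x \<le> b}"
proof -
  obtain F where F: "finite F" "P = \<Inter>F" "\<forall>h\<in>F. \<exists>a b. a \<noteq> 0 \<and> h = {x. a \<bullet> x \<le> b}"
    using assms by (auto simp: polyhedron_def)
  then obtain a b where ab: "\<And>h. h \<in> F \<Longrightarrow> h = {x. a h \<bullet> x \<le> b h}"
    by metis
  have "P = {x. \<forall>(a, b)\<in>(\<lambda>h. (a h, b h)) ` F. a \<bullet> x \<le> b}"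
    unfolding F(2) using ab by auto
  then show thesis using F(1) by (intro that[of "(\<lambda>h. (a h, b h)) ` F"]) auto
qed

lemma rational_polyhedron_imp_polyhedron:
  assumes "rational_polyhedron L Q"
  shows "polyhedron Q"
proof -
  obtain F where F: "finite F" "Q = {x. \<forall>(u, c)\<in>F. c \<le> u \<bullet> x}"
    using assms unfolding rational_polyhedron_def by blast
  have "polyhedron (\<Inter>(u, c)\<in>F. {x. u \<bullet> x \<ge> c})"
    by (intro polyhedron_Inter) (use F(1) in \<open>auto simp: polyhedron_halfspace_ge\<close>)
  moreover have "Q = (\<Inter>(u, c)\<in>F. {x. u \<bullet> x \<ge> c})" unfolding F(2) by auto
  ultimately show ?thesis by simp
qed

lemma recession_cone_inequalities:
  fixes A :: "('a::euclidean_space \<times> real) set"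
  assumes P: "P = {x. \<forall>(a, b)\<in>A. a \<bullet> x \<le> b}" and "P \<noteq> {}"
  shows "recession_cone P = {d. \<forall>(a, b)\<in>A. a \<bullet> d \<le> 0}"
proof (intro equalityI subsetI)
  fix d assume d: "d \<in> recession_cone P"
  obtain x where x: "x \<in> P" using assms(2) by blast
  have "a \<bullet> d \<le> 0" if ab: "(a, b) \<in> A" for a b
  proof (rule ccontr)
    assume neg: "\<not> a \<bullet> d \<le> 0"
    have ge: "b - a \<bullet> x \<ge> 0" using x ab unfolding P by auto
    \<comment> \<open>One unit beyond the parameter at which the constraint becomes tight.\<close>
    define t where "t = (b - a \<bullet> x) / (a \<bullet> d) + 1"
    have "t \<ge> 0" using ge neg by (simp add: t_def)
    then have "x + t *\<^sub>R d \<in> P" using d x by (auto simp: recession_cone_def)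
    then have "a \<bullet> x + t * (a \<bullet> d) \<le> b"
      using ab unfolding P by (auto simp: inner_add_right)
    moreover have "t * (a \<bullet> d) = b - a \<bullet> x + a \<bullet> d"
      using neg by (simp add: t_def field_simps)
    ultimately show False using neg by simp
  qed
  then show "d \<in> {d. \<forall>(a, b)\<in>A. a \<bullet> d \<le> 0}" by blast
next
  fix d assume d: "d \<in> {d. \<forall>(a, b)\<in>A. a \<bullet> d \<le> 0}"
  show "d \<in> recession_cone P" unfolding recession_cone_def
  proof (safe)
    fix x and t :: real assume x: "x \<in> P" and t: "0 \<le> t"
    show "x + t *\<^sub>R d \<in> P" unfolding P
    proof safe
      fix a b assume ab: "(a, b) \<in> A"
      have "t * (a \<bullet> d) \<le> 0" using d ab t by (auto intro: mult_nonneg_nonpos)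
      moreover have "a \<bullet> x \<le> b" using x ab unfolding P by auto
      ultimately show "a \<bullet> (x + t *\<^sub>R d) \<le> b" by (simp add: inner_add_right)
    qed
  qed
qed

text \<open>The ratio test: \<open>r\<close> is the step length at which a constraint approached by
  \<open>v\<close> becomes tight, and the smallest such length is taken. Constraints that are tight
  at \<open>x\<close> stay tight, so the set of slack ones shrinks strictly.\<close>

lemma move_until_tight:
  fixes A :: "('a::euclidean_space \<times> real) set"
  assumes "finite A" and x: "\<forall>(a, b)\<in>A. a \<bullet> x \<le> b"
    and tight: "\<And>a b. (a, b) \<in> A \<Longrightarrow> a \<bullet> x = b \<Longrightarrow> a \<bullet> v = 0"
    and v: "\<not> (\<forall>(a, b)\<in>A. a \<bullet> v \<le> 0)"
  obtains t where "t > 0" "\<forall>(a, b)\<in>A. a \<bullet> (x + t *\<^sub>R v) \<le> b"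
    "{(a, b) \<in> A. a \<bullet> (x + t *\<^sub>R v) \<noteq> b} \<subset> {(a, b) \<in> A. a \<bullet> x \<noteq> b}"
proof -
  define M where "M = {(a, b) \<in> A. a \<bullet> v > 0}"
  define r where "r = (\<lambda>(a, b). (b - a \<bullet> x) / (a \<bullet> v))"
  have M: "M \<noteq> {}" "M \<subseteq> A" using v by (auto simp: M_def)
  have finM: "finite M" by (rule finite_subset[OF M(2) assms(1)])
  define t where "t = Min (r ` M)"
  have t_le: "t \<le> r p" if "p \<in> M" for p
    unfolding t_def using finM that by (intro Min_le) auto
  have "t \<in> r ` M" unfolding t_def using finM M by (intro Min_in) auto
  then obtain a0 b0 where ab0: "(a0, b0) \<in> M" "t = r (a0, b0)" by force
  have pos: "r (a, b) > 0" if "(a, b) \<in> M" for a b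
  proof -
    have "a \<bullet> x \<le> b" "a \<bullet> x \<noteq> b"
      using x tight[of a b] that by (auto simp: M_def)
    then show ?thesis using that by (auto simp: r_def M_def)
  qed
  have t0: "t > 0" using pos ab0 by simp
  have P: "a \<bullet> (x + t *\<^sub>R v) \<le> b" if ab: "(a, b) \<in> A" for a b
  proof (cases "a \<bullet> v > 0")
    case True
    then have "t \<le> r (a, b)" using ab by (intro t_le) (auto simp: M_def)
    then show ?thesis using True by (simp add: r_def inner_add_right field_simps)
  next
    case False
    then have "t * (a \<bullet> v) \<le> 0" using t0 by (intro mult_nonneg_nonpos) auto
    then show ?thesis using x ab by (auto simp: inner_add_right)
  qed
  have sub: "{(a, b) \<in> A. a \<bullet> (x + t *\<^sub>R v) \<noteq> b} \<subseteq> {(a, b) \<in> A. a \<bullet> x \<noteq> b}"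
    using tight by (auto simp: inner_add_right)
  have "a0 \<bullet> (x + t *\<^sub>R v) = b0" using ab0 by (auto simp: r_def inner_add_right M_def)
  moreover have "a0 \<bullet> x \<noteq> b0" using ab0(1) tight[of a0 b0] by (auto simp: M_def)
  ultimately have "{(a, b) \<in> A. a \<bullet> (x + t *\<^sub>R v) \<noteq> b} \<subset> {(a, b) \<in> A. a \<bullet> x \<noteq> b}"
    using sub ab0(1) M(2) by blast
  then show thesis using that t0 P by blast
qed

text \<open>
  A point that is not extreme can be moved in both directions of a line without losing a tight
  constraint, until a new constraint becomes tight or the direction is in the recession cone.
\<close>

lemma polyhedron_decomposition:
  fixes P :: "'a::euclidean_space set"
  assumes "polyhedron P" and pointed: "\<And>v. v \<in> recession_cone P \<Longrightarrow> - v \<in> recession_cone P \<Longrightarrow> v = 0"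
    and "x \<in> P"
  shows "\<exists>y\<in>convex hull {e. e extreme_point_of P}. \<exists>d\<in>recession_cone P. x = y + d"
proof -
  obtain A where A: "finite A" "P = {x. \<forall>(a, b)\<in>A. a \<bullet> x \<le> b}"
    using polyhedron_inequalities[OF assms(1)] by blast
  have rec: "recession_cone P = {d. \<forall>(a, b)\<in>A. a \<bullet> d \<le> 0}"
    by (rule recession_cone_inequalities) (use A assms(3) in auto)
  have add: "d + e \<in> recession_cone P" if "d \<in> recession_cone P" "e \<in> recession_cone P" for d e
    using that unfolding rec by (fastforce simp: inner_add_right)
  have scale: "c *\<^sub>R d \<in> recession_cone P" if "d \<in> recession_cone P" "c \<ge> 0" for c d
    using that unfolding rec by (auto simp: mult_nonneg_nonpos)
  show ?thesis using assms(3)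
  proof (induction "card {(a, b) \<in> A. a \<bullet> x \<noteq> b}" arbitrary: x rule: less_induct)
    case less
    have xA: "\<forall>(a, b)\<in>A. a \<bullet> x \<le> b" using less.prems A(2) by auto
    have fin: "finite {(a, b) \<in> A. a \<bullet> x \<noteq> b}"
      using A(1) by (rule rev_finite_subset) auto
    show ?case
    proof (cases "x extreme_point_of P")
      case True
      have "0 \<in> recession_cone P" unfolding rec by auto
      then show ?thesis using True by (intro bexI[of _ x] bexI[of _ 0]) (auto intro: hull_inc)
    next
      case False
      then obtain p q where pq: "p \<in> P" "q \<in> P" "x \<in> open_segment p q"
        using less.prems by (auto simp: extreme_point_of_def)
      define v where "v = q - p"
      have "p \<noteq> q" using pq(3) by auto
      then have v0: "v \<noteq> 0" by (simp add: v_def)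
      obtain s where s: "0 < s" "s < 1" "x = (1 - s) *\<^sub>R p + s *\<^sub>R q"
        using pq(3) by (auto simp: in_segment)
      have tight: "a \<bullet> v = 0" if ab: "(a, b) \<in> A" "a \<bullet> x = b" for a b
      proof -
        have le: "a \<bullet> p \<le> b" "a \<bullet> q \<le> b" using pq(1,2) ab(1) A(2) by auto
        have eq: "(1 - s) * (b - a \<bullet> p) + s * (b - a \<bullet> q) = 0"
          using ab(2) s(3) by (simp add: inner_add_right algebra_simps)
        have "(1 - s) * (b - a \<bullet> p) \<ge> 0" "s * (b - a \<bullet> q) \<ge> 0"
          using le s by simp_all
        then have "(1 - s) * (b - a \<bullet> p) = 0" "s * (b - a \<bullet> q) = 0"
          using eq by linarith+
        then show ?thesis using s by (simp add: v_def inner_diff_right)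
      qed
      have step: "\<exists>t>0. \<exists>y\<in>convex hull {e. e extreme_point_of P}. \<exists>d\<in>recession_cone P. x + t *\<^sub>R v' = y + d"
        if v': "v' = v \<or> v' = - v" "v' \<notin> recession_cone P" for v'
      proof -
        have "\<not> (\<forall>(a, b)\<in>A. a \<bullet> v' \<le> 0)"
          using v'(2) unfolding rec by blast
        moreover have "a \<bullet> v' = 0" if "(a, b) \<in> A" "a \<bullet> x = b" for a b
          using tight[OF that] v'(1) by auto
        ultimately obtain t where t: "t > 0" "\<forall>(a, b)\<in>A. a \<bullet> (x + t *\<^sub>R v') \<le> b"
          "{(a, b) \<in> A. a \<bullet> (x + t *\<^sub>R v') \<noteq> b} \<subset> {(a, b) \<in> A. a \<bullet> x \<noteq> b}"
          using move_until_tight[OF A(1) xA, of v'] by blast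
        have "card {(a, b) \<in> A. a \<bullet> (x + t *\<^sub>R v') \<noteq> b} < card {(a, b) \<in> A. a \<bullet> x \<noteq> b}"
          by (rule psubset_card_mono[OF fin t(3)])
        then show ?thesis using less.hyps[of "x + t *\<^sub>R v'"] t(1,2) A(2) by blast
      qed
      \<comment> \<open>Pointedness excludes the case that both directions are recession
        directions.\<close>
      consider (pos) "v \<in> recession_cone P" "- v \<notin> recession_cone P"
        | (neg) "- v \<in> recession_cone P" "v \<notin> recession_cone P"
        | (none) "v \<notin> recession_cone P" "- v \<notin> recession_cone P"
        using pointed v0 by blast
      then show ?thesis
      proof cases
        case pos
        then obtain t y d where t: "t > 0" "y \<in> convex hull {e. e extreme_point_of P}"
          "d \<in> recession_cone P" "x + t *\<^sub>R (- v) = y + d" using step[of "- v"] by blast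
        then have "x = y + (d + t *\<^sub>R v)" by (simp add: algebra_simps)
        then show ?thesis using t pos add scale by (metis less_imp_le)
      next
        case neg
        then obtain t y d where t: "t > 0" "y \<in> convex hull {e. e extreme_point_of P}"
          "d \<in> recession_cone P" "x + t *\<^sub>R v = y + d" using step[of v] by blast
        then have "x = y + (d + t *\<^sub>R (- v))" by (simp add: algebra_simps)
        then show ?thesis using t neg add scale by (metis less_imp_le)
      next
        case none
        then obtain t y d where t: "t > 0" "y \<in> convex hull {e. e extreme_point_of P}"
          "d \<in> recession_cone P" "x + t *\<^sub>R v = y + d" using step[of v] by blast
        obtain t' y' d' where t': "t' > 0" "y' \<in> convex hull {e. e extreme_point_of P}"
          "d' \<in> recession_cone P" "x + t' *\<^sub>R (- v) = y' + d'"
          using step[of "- v"] none by blast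
        \<comment> \<open>The weight for which the displacements by \<open>t v\<close> and
          \<open>- t' v\<close> cancel.\<close>
        define lam where "lam = t / (t + t')"
        have l: "0 \<le> lam" "lam \<le> 1" using t(1) t'(1) by (auto simp: lam_def)
        have "(1 - lam) * t = lam * t'" using t(1) t'(1) by (simp add: lam_def field_simps)
        moreover have "(1 - lam) *\<^sub>R (x + t *\<^sub>R v) + lam *\<^sub>R (x + t' *\<^sub>R (- v)) =
            x + ((1 - lam) * t - lam * t') *\<^sub>R v" by (simp add: algebra_simps)
        ultimately have "(1 - lam) *\<^sub>R (x + t *\<^sub>R v) + lam *\<^sub>R (x + t' *\<^sub>R (- v)) = x"
          by simp
        then have "x = ((1 - lam) *\<^sub>R y + lam *\<^sub>R y') + ((1 - lam) *\<^sub>R d + lam *\<^sub>R d')"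
          unfolding t(4) t'(4) by (simp add: algebra_simps)
        moreover have "(1 - lam) *\<^sub>R y + lam *\<^sub>R y' \<in> convex hull {e. e extreme_point_of P}"
          by (rule convexD_alt[OF convex_convex_hull t(2) t'(2) l])
        moreover have "(1 - lam) *\<^sub>R d + lam *\<^sub>R d' \<in> recession_cone P"
          using l t(3) t'(3) by (intro add scale) auto
        ultimately show ?thesis by blast
      qed
    qed
  qed
qed

text \<open>Recession directions do not decrease \<open>u\<close>, so by
  \<open>polyhedron_decomposition\<close> its minimum is attained among the finitely many
  vertices.\<close>

lemma polyhedron_min_extreme_point:
  fixes P :: "'a::euclidean_space set"
  assumes P: "polyhedron P" "P \<noteq> {}" and pointed: "\<And>v. v \<in> recession_cone P \<Longrightarrow> - v \<in> recession_cone P \<Longrightarrow> v = 0"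
    and u: "\<And>d. d \<in> recession_cone P \<Longrightarrow> u \<bullet> d \<ge> 0"
  obtains q where "q extreme_point_of P" "\<And>x. x \<in> P \<Longrightarrow> u \<bullet> q \<le> u \<bullet> x"
proof -
  let ?V = "{e. e extreme_point_of P}"
  note dec = polyhedron_decomposition[OF P(1) pointed]
  have fin: "finite ?V" by (rule finite_polyhedron_extreme_points[OF P(1)])
  have "?V \<noteq> {}" using dec P(2) by (metis all_not_in_conv convex_hull_empty)
  then obtain q where q: "q \<in> ?V" "\<And>e. e \<in> ?V \<Longrightarrow> u \<bullet> q \<le> u \<bullet> e"
    using fin by (metis (no_types, lifting) arg_min_if_finite(1) arg_min_least)
  have "convex hull ?V \<subseteq> {x. u \<bullet> x \<ge> u \<bullet> q}"
    by (rule hull_minimal) (use q convex_halfspace_ge in auto)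
  then have "u \<bullet> q \<le> u \<bullet> x" if "x \<in> P" for x
    using dec[OF _ _ that] u by (fastforce simp: inner_add_right)
  with q(1) show thesis using that by blast
qed

text \<open>A second solution \<open>x\<close> of the constraints tight at \<open>q\<close> would
  allow moving from \<open>q\<close> both ways along \<open>x - q\<close> inside the
  polyhedron.\<close>

lemma extreme_point_tight_unique:
  fixes A :: "('a::euclidean_space \<times> real) set"
  assumes "finite A" "q extreme_point_of {x. \<forall>(a, b)\<in>A. a \<bullet> x \<le> b}"
    and x: "\<And>a b. (a, b) \<in> A \<Longrightarrow> a \<bullet> q = b \<Longrightarrow> a \<bullet> x = b"
  shows "x = q"
proof (rule ccontr)
  assume "x \<noteq> q"
  define v where "v = x - q"
  have v: "v \<noteq> 0" using \<open>x \<noteq> q\<close> by (simp add: v_def)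
  have q: "\<forall>(a, b)\<in>A. a \<bullet> q \<le> b"
    using assms(2) by (auto simp: extreme_point_of_def)
  have tight: "a \<bullet> v = 0" if "(a, b) \<in> A" "a \<bullet> q = b" for a b
    using x[OF that] that by (simp add: v_def inner_diff_right)
  have *: "\<exists>t>0. \<forall>(a, b)\<in>A. a \<bullet> (q + t *\<^sub>R v') \<le> b" if "v' = v \<or> v' = - v" for v'
  proof (cases "\<forall>(a, b)\<in>A. a \<bullet> v' \<le> 0")
    case True
    then have "\<forall>(a, b)\<in>A. a \<bullet> (q + 1 *\<^sub>R v') \<le> b"
      using q by (fastforce simp: inner_add_right)
    then show ?thesis using zero_less_one by blast
  next
    case False
    have "a \<bullet> v' = 0" if "(a, b) \<in> A" "a \<bullet> q = b" for a b
      using tight[OF that] \<open>v' = v \<or> v' = - v\<close> by auto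
    then show ?thesis using move_until_tight[OF assms(1) q _ False] by metis
  qed
  obtain s where s: "s > 0" "\<forall>(a, b)\<in>A. a \<bullet> (q + s *\<^sub>R v) \<le> b"
    using *[of v] by blast
  obtain t where t: "t > 0" "\<forall>(a, b)\<in>A. a \<bullet> (q + t *\<^sub>R (- v)) \<le> b"
    using *[of "- v"] by blast
  have "q \<in> open_segment (q + s *\<^sub>R v) (q + t *\<^sub>R (- v))" unfolding in_segment
  proof (intro conjI exI[of _ "s / (s + t)"])
    show "q + s *\<^sub>R v \<noteq> q + t *\<^sub>R - v"
    proof
      assume "q + s *\<^sub>R v = q + t *\<^sub>R - v"
      then have "(s + t) *\<^sub>R v = 0" by (simp add: scaleR_add_left)
      then show False using v s t by simp
    qed
    have "(1 - s / (s + t)) * s = s / (s + t) * t" using s(1) t(1) by (simp add: field_simps)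
    moreover have "(1 - c) *\<^sub>R (q + s *\<^sub>R v) + c *\<^sub>R (q + t *\<^sub>R - v) = q + ((1 - c) * s - c * t) *\<^sub>R v" for c
      by (simp add: algebra_simps)
    ultimately show "q = (1 - s / (s + t)) *\<^sub>R (q + s *\<^sub>R v) + (s / (s + t)) *\<^sub>R (q + t *\<^sub>R - v)"
      by simp
  qed (use s t in auto)
  then show False using assms(2) s t by (auto simp: extreme_point_of_def)
qed

section \<open>Lattices, rational points and primitive generators\<close>

lemma full_lattice_lincomb:
  fixes L :: "'v::euclidean_space set"
  assumes "full_lattice L"
  obtains B where "finite B" "independent B" "span B = UNIV" "L = {\<Sum>b\<in>B. of_int (c b) *\<^sub>R b | c :: 'v \<Rightarrow> int. True}"
  using assms independent_imp_finite unfolding full_lattice_def by blast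

lemma full_lattice_0: "full_lattice L \<Longrightarrow> 0 \<in> L"
  by (erule full_lattice_lincomb) (auto intro!: exI[of _ "\<lambda>_. 0"])

lemma full_lattice_diff:
  assumes "full_lattice L" "x \<in> L" "y \<in> L"
  shows "x - y \<in> L"
proof -
  obtain B where B: "L = {\<Sum>b\<in>B. of_int (c b) *\<^sub>R b | c :: 'a \<Rightarrow> int. True}"
    by (rule full_lattice_lincomb[OF assms(1)])
  obtain c d where "x = (\<Sum>b\<in>B. of_int (c b) *\<^sub>R b)" "y = (\<Sum>b\<in>B. of_int (d b) *\<^sub>R b)"
    using assms unfolding B by blast
  then have "x - y = (\<Sum>b\<in>B. of_int (c b - d b) *\<^sub>R b)"
    by (simp add: scaleR_diff_left sum_subtractf)
  then show ?thesis unfolding B by (auto intro!: exI[of _ "\<lambda>b. c b - d b"])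
qed

text \<open>The coordinate functionals of a lattice basis are integral on the lattice, and one of
  them is nonzero at \<open>x\<close>.\<close>

lemma full_lattice_separating:
  assumes L: "full_lattice L" and "x \<noteq> 0"
  obtains u where "u \<in> dual_lattice L" "u \<bullet> x \<noteq> 0"
proof -
  obtain B where B: "finite B" "independent B" "span B = UNIV" "L = {\<Sum>b\<in>B. of_int (c b) *\<^sub>R b | c :: 'a \<Rightarrow> int. True}"
    by (rule full_lattice_lincomb[OF L])
  have "\<exists>u. \<forall>b\<in>B. u \<bullet> b = of_bool (b = b0)" for b0
  proof -
    obtain f :: "'a \<Rightarrow> real" where f: "linear f" "\<forall>b\<in>B. f b = of_bool (b = b0)"
      using linear_independent_extend[OF B(2), of "\<lambda>b. of_bool (b = b0)"] by blast
    \<comment> \<open>The adjoint at 1 is the vector representing the functional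
      \<open>f\<close>.\<close>
    have "adjoint f 1 \<bullet> b = f b" for b
      using adjoint_works[OF f(1), of b 1] by (simp add: inner_commute)
    with f(2) show ?thesis by (intro exI[of _ "adjoint f 1"]) simp
  qed
  then obtain u where u: "\<And>b b0. b \<in> B \<Longrightarrow> u b0 \<bullet> b = of_bool (b = b0)"
    by metis
  have lin: "u b0 \<bullet> (\<Sum>b\<in>B. r b *\<^sub>R b) = r b0" if "b0 \<in> B" for b0 r
  proof -
    have "u b0 \<bullet> (\<Sum>b\<in>B. r b *\<^sub>R b) = (\<Sum>b\<in>B. if b = b0 then r b0 else 0)"
      unfolding inner_sum_right by (intro sum.cong) (auto simp: u)
    then show ?thesis using that B(1) by simp
  qed
  have dual: "u b0 \<in> dual_lattice L" if "b0 \<in> B" for b0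
    unfolding dual_lattice_def B(4) using lin[OF that] by auto
  have "x \<in> range (\<lambda>r. \<Sum>b\<in>B. r b *\<^sub>R b)"
    using B(3) unfolding span_finite[OF B(1)] by simp
  then obtain r where r: "x = (\<Sum>b\<in>B. r b *\<^sub>R b)" by blast
  have "\<exists>b0\<in>B. r b0 \<noteq> 0"
  proof (rule ccontr)
    assume "\<not> (\<exists>b0\<in>B. r b0 \<noteq> 0)"
    then have "x = 0" unfolding r by (intro sum.neutral) auto
    with \<open>x \<noteq> 0\<close> show False ..
  qed
  then obtain b0 where b0: "b0 \<in> B" "r b0 \<noteq> 0" by blast
  show thesis by (rule that[OF dual[OF b0(1)]]) (simp add: r lin b0)
qed

text \<open>
  A \<open>\<rat>\<close>-linear retraction \<open>\<real> \<rightarrow> \<rat>\<close>, applied to coordinates, maps solutions of a rational system of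
  linear equations to rational solutions.
\<close>

lemma rational_retraction:
  obtains g :: "real \<Rightarrow> rat" where "\<And>x y. g (x + y) = g x + g y" "\<And>r. g (of_rat r) = r"
    "\<And>r x. g (of_rat r * x) = r * g x"
proof -
  interpret vector_space_pair "\<lambda>(r::rat) (x::real). of_rat r * x" "\<lambda>(r::rat) (x::rat). r * x"
    by unfold_locales (auto simp: algebra_simps of_rat_add of_rat_mult)
  \<comment> \<open>Over the rationals \<real> has a linear functional with value 1 at 1; its values
    at the rationals are then forced.\<close>
  have "vs1.independent {1}" by (simp add: vs1.independent_insert)
  then obtain g where g: "Vector_Spaces.linear (\<lambda>r. (*) (real_of_rat r)) (*) g" "g 1 = 1"
    using linear_independent_extend[of "{1}" "\<lambda>_. 1"] by auto
  have scale: "g (of_rat r * x) = r * g x" for r x using linear_scale[OF g(1)] .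
  show thesis using that[of g] linear_add[OF g(1)] scale scale[of _ 1] g(2) by simp
qed

lemma finite_rationals_common_denominator:
  fixes r :: "'b \<Rightarrow> rat"
  assumes "finite B"
  obtains m :: nat where "m > 0" "\<And>b. b \<in> B \<Longrightarrow> of_nat m * r b \<in> \<int>"
proof -
  have "\<exists>m::nat. m > 0 \<and> (\<forall>b\<in>B. of_nat m * r b \<in> \<int>)" using assms
  proof (induction B)
    case (insert b B)
    then obtain m :: nat where m: "m > 0" "\<forall>b\<in>B. of_nat m * r b \<in> \<int>" by blast
    obtain p q where pq: "quotient_of (r b) = (p, q)" by fastforce
    have q: "q > 0" "r b = of_int p / of_int q"
      using quotient_of_denom_pos[OF pq] quotient_of_div[OF pq] by auto
    have "of_nat (m * nat q) * r b = of_int (int m * p)" using q by (simp add: field_simps)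
    then have "of_nat (m * nat q) * r b \<in> \<int>" by (metis Ints_of_int)
    moreover have "of_nat (m * nat q) * r c \<in> \<int>" if "c \<in> B" for c
    proof -
      have "of_nat (m * nat q) * r c = of_nat (nat q) * (of_nat m * r c)"
        by (simp only: of_nat_mult mult_ac)
      also have "\<dots> \<in> \<int>" by (intro Ints_mult bspec[OF m(2)] that Ints_of_nat)
      finally show ?thesis .
    qed
    ultimately show ?case using m q by (intro exI[of _ "m * nat q"]) auto
  qed (auto intro: exI[of _ 1])
  then show thesis using that by blast
qed

text \<open>Applying the retraction to the coordinates of \<open>q\<close> preserves the constraints
  tight at \<open>q\<close>, as these have integral coefficients and rational right-hand sides. By
  \<open>extreme_point_tight_unique\<close> the result is \<open>q\<close>, so its coordinates are
  rational and denominators can be cleared.\<close>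

lemma rational_polyhedron_extreme_point:
  assumes L: "full_lattice L" and Q: "rational_polyhedron L Q" and q: "q extreme_point_of Q"
  obtains m :: nat where "m > 0" "of_nat m *\<^sub>R q \<in> L"
proof -
  obtain B where B: "finite B" "independent B" "span B = UNIV" "L = {\<Sum>b\<in>B. of_int (c b) *\<^sub>R b | c :: 'a \<Rightarrow> int. True}"
    by (rule full_lattice_lincomb[OF L])
  obtain F where F: "finite F" "F \<subseteq> dual_lattice L \<times> \<rat>" "Q = {x. \<forall>(u, c)\<in>F. c \<le> u \<bullet> x}"
    using Q unfolding rational_polyhedron_def by blast
  obtain g :: "real \<Rightarrow> rat" where g: "\<And>x y. g (x + y) = g x + g y" "\<And>r. g (of_rat r) = r"
    "\<And>r x. g (of_rat r * x) = r * g x" using rational_retraction by blast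
  have "q \<in> range (\<lambda>r. \<Sum>b\<in>B. r b *\<^sub>R b)"
    using B(3) unfolding span_finite[OF B(1)] by simp
  then obtain r where r: "q = (\<Sum>b\<in>B. r b *\<^sub>R b)" by blast
  define x where "x = (\<Sum>b\<in>B. of_rat (g (r b)) *\<^sub>R b)"
  have basis: "b \<in> L" if "b \<in> B" for b
  proof -
    have "(\<Sum>b'\<in>B. of_int (of_bool (b' = b)) *\<^sub>R b') = (\<Sum>b'\<in>B. if b' = b then b' else 0)"
      by (intro sum.cong) auto
    then have "b = (\<Sum>b'\<in>B. of_int (of_bool (b' = b)) *\<^sub>R b')" using that B(1) by simp
    then show ?thesis
      unfolding B(4) by (intro CollectI exI[of _ "\<lambda>b'. of_bool (b' = b)"] conjI TrueI)
  qed
  have g0: "g 0 = 0" using g(1)[of 0 0] by simp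
  have gsum: "g (\<Sum>b\<in>S. h b) = (\<Sum>b\<in>S. g (h b))" for S and h :: "'a \<Rightarrow> real"
    by (induction S rule: infinite_finite_induct) (auto simp: g0 g(1))
  have eq: "u \<bullet> x = c" if uc: "(u, c) \<in> F" "u \<bullet> q = c" for u c
  proof -
    have "u \<in> dual_lattice L" "c \<in> \<rat>" using F(2) uc by auto
    then obtain c' where c': "c = of_rat c'" by (auto elim: Rats_cases)
    have "u \<bullet> b \<in> \<int>" if "b \<in> B" for b
      using \<open>u \<in> dual_lattice L\<close> basis[OF that] by (auto simp: dual_lattice_def)
    then have ub: "u \<bullet> b = of_rat (of_int \<lfloor>u \<bullet> b\<rfloor>)" if "b \<in> B" for b
      using that by simp
    have "c = (\<Sum>b\<in>B. of_rat (of_int \<lfloor>u \<bullet> b\<rfloor>) * r b)"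
      unfolding uc(2)[symmetric] r inner_sum_right
      by (intro sum.cong refl) (use ub in \<open>simp add: mult.commute\<close>)
    then have "c' = (\<Sum>b\<in>B. of_int \<lfloor>u \<bullet> b\<rfloor> * g (r b))"
      using g(2)[of c'] unfolding c' by (simp only: gsum g(3))
    then have "c = (\<Sum>b\<in>B. of_rat (of_int \<lfloor>u \<bullet> b\<rfloor>) * of_rat (g (r b)))"
      unfolding c' by (simp only: of_rat_sum of_rat_mult)
    also have "\<dots> = u \<bullet> x" unfolding x_def inner_sum_right
      by (intro sum.cong refl) (use ub in \<open>simp add: mult.commute\<close>)
    finally show ?thesis ..
  qed
  have "x = q"
  proof (rule extreme_point_tight_unique)
    show "finite ((\<lambda>(u, c). (- u, - c)) ` F)" using F(1) by simp
    have "Q = {x. \<forall>(a, b)\<in>(\<lambda>(u, c). (- u, - c)) ` F. a \<bullet> x \<le> b}"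
      unfolding F(3) by fastforce
    with q show "q extreme_point_of {x. \<forall>(a, b)\<in>(\<lambda>(u, c). (- u, - c)) ` F. a \<bullet> x \<le> b}"
      by simp
  qed (use eq in auto)
  obtain m :: nat where m: "m > 0" "\<And>b. b \<in> B \<Longrightarrow> of_nat m * g (r b) \<in> \<int>"
    using finite_rationals_common_denominator[OF B(1), of "\<lambda>b. g (r b)"] by blast
  have "of_nat m *\<^sub>R q = (\<Sum>b\<in>B. of_int \<lfloor>of_nat m * g (r b)\<rfloor> *\<^sub>R b)"
    unfolding \<open>x = q\<close>[symmetric] x_def scaleR_sum_right
  proof (intro sum.cong refl)
    fix b assume "b \<in> B"
    then have "of_rat (of_nat m * g (r b)) = (of_rat (of_int \<lfloor>of_nat m * g (r b)\<rfloor>) :: real)"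
      using m(2) by simp
    then have "of_nat m * of_rat (g (r b)) = (of_int \<lfloor>of_nat m * g (r b)\<rfloor> :: real)"
      by (simp only: of_rat_mult of_rat_of_nat_eq of_rat_of_int_eq)
    then show "real m *\<^sub>R real_of_rat (g (r b)) *\<^sub>R b = real_of_int \<lfloor>of_nat m * g (r b)\<rfloor> *\<^sub>R b"
      by simp
  qed
  also have "\<dots> \<in> L"
    unfolding B(4) by (intro CollectI exI[of _ "\<lambda>b. \<lfloor>of_nat m * g (r b)\<rfloor>"] conjI TrueI refl)
  finally show thesis using that m(1) by blast
qed

text \<open>All that primitive generators require of a lattice. Separation by the dual lattice
  expresses discreteness, and for \<open>ext_lattice N\<close> it is verified without exhibiting a
  basis.\<close>

definition discrete_subgroup :: "'v::euclidean_space set \<Rightarrow> bool" where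
  "discrete_subgroup L \<longleftrightarrow> 0 \<in> L \<and> (\<forall>x\<in>L. \<forall>y\<in>L. x - y \<in> L) \<and>
     (\<forall>x. x \<noteq> 0 \<longrightarrow> (\<exists>u\<in>dual_lattice L. u \<bullet> x \<noteq> 0))"

lemma discrete_subgroup_of_nat:
  assumes "discrete_subgroup L" "x \<in> L"
  shows "of_nat n *\<^sub>R x \<in> L"
proof (induction n)
  case 0
  then show ?case using assms by (simp add: discrete_subgroup_def)
next
  case (Suc n)
  have "0 - x \<in> L" using assms unfolding discrete_subgroup_def by blast
  then have "of_nat n *\<^sub>R x - (0 - x) \<in> L"
    using Suc assms unfolding discrete_subgroup_def by blast
  then show ?case by (simp add: algebra_simps)
qed

lemma discrete_subgroup_ext_lattice:
  assumes "full_lattice N"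
  shows "discrete_subgroup (ext_lattice N)" unfolding discrete_subgroup_def
proof (intro conjI ballI allI impI)
  show "0 \<in> ext_lattice N"
    using full_lattice_0[OF assms] by (simp add: ext_lattice_def zero_prod_def)
  show "x - y \<in> ext_lattice N" if "x \<in> ext_lattice N" "y \<in> ext_lattice N" for x y
    using that full_lattice_diff[OF assms] by (auto simp: ext_lattice_def)
  show "\<exists>u\<in>dual_lattice (ext_lattice N). u \<bullet> x \<noteq> 0" if "x \<noteq> 0" for x :: "'a \<times> (real ^ 'k::finite)"
  proof (cases "fst x = 0")
    case True
    then have "snd x \<noteq> 0" using that by (auto simp: prod_eq_iff)
    then obtain i where "snd x $ i \<noteq> 0" by (auto simp: vec_eq_iff)
    then have "(0, axis i 1) \<bullet> x \<noteq> 0" by (cases x) (simp add: inner_axis')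
    moreover have "(0, axis i 1) \<in> dual_lattice (ext_lattice N)"
      by (auto simp: dual_lattice_def ext_lattice_def inner_axis')
    ultimately show ?thesis by blast
  next
    case False
    then obtain u where u: "u \<in> dual_lattice N" "u \<bullet> fst x \<noteq> 0"
      using full_lattice_separating[OF assms] by blast
    then have "(u, 0) \<in> dual_lattice (ext_lattice N)" "(u, 0) \<bullet> x \<noteq> 0"
      by (auto simp: dual_lattice_def ext_lattice_def inner_prod_def)
    then show ?thesis by blast
  qed
qed

lemma dual_ext_lattice:
  assumes "full_lattice N"
  shows "(u, c) \<in> dual_lattice (ext_lattice N) \<longleftrightarrow> u \<in> dual_lattice N \<and> (\<forall>i. c $ i \<in> \<int>)"
proof
  assume uc: "(u, c) \<in> dual_lattice (ext_lattice N)"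
  have "(u, c) \<bullet> (v, 0) \<in> \<int>" if "v \<in> N" for v
  proof -
    have "(v, 0) \<in> ext_lattice N" using that by (simp add: ext_lattice_def)
    then show ?thesis using uc unfolding dual_lattice_def by blast
  qed
  moreover have "(u, c) \<bullet> (0, axis i 1) \<in> \<int>" for i
  proof -
    have "(0, axis i 1) \<in> ext_lattice N"
      using full_lattice_0[OF assms] by (auto simp: ext_lattice_def axis_def)
    then show ?thesis using uc unfolding dual_lattice_def by blast
  qed
  ultimately show "u \<in> dual_lattice N \<and> (\<forall>i. c $ i \<in> \<int>)"
    by (simp add: dual_lattice_def[of N] inner_axis)
next
  assume *: "u \<in> dual_lattice N \<and> (\<forall>i. c $ i \<in> \<int>)"
  have "c \<bullet> d \<in> \<int>" if "\<forall>i. d $ i \<in> \<int>" for d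
    unfolding inner_vec_def using * that by (auto intro!: Ints_sum Ints_mult)
  with * show "(u, c) \<in> dual_lattice (ext_lattice N)"
    by (auto simp: dual_lattice_def ext_lattice_def intro!: Ints_add)
qed

lemma mem_ray: "x \<in> convex_cone hull {t} \<longleftrightarrow> (\<exists>c\<ge>0. x = c *\<^sub>R t)"
  by (auto simp: convex_cone_hull_convex_hull_nonempty)

text \<open>An integral functional with value \<open>d > 0\<close> at \<open>t\<close> forces all
  lattice points on the ray to be multiples of \<open>t / d\<close>. The least positive one
  generates them, by division with remainder.\<close>

lemma primitive_generator_ray:
  assumes L: "discrete_subgroup L" and t: "t \<in> L" "t \<noteq> 0"
  obtains v and m :: nat where "primitive_generator L (convex_cone hull {t}) = v" "v \<in> L" "v \<noteq> 0"
    "m > 0" "t = of_nat m *\<^sub>R v"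
proof -
  obtain u0 where u0: "u0 \<in> dual_lattice L" "u0 \<bullet> t \<noteq> 0"
    using L t(2) unfolding discrete_subgroup_def by blast
  \<comment> \<open>The sign makes the functional positive on the ray.\<close>
  define u where "u = sgn (u0 \<bullet> t) *\<^sub>R u0"
  have u: "u \<bullet> x \<in> \<int>" if "x \<in> L" for x
  proof -
    have "u0 \<bullet> x \<in> \<int>" using u0(1) that by (simp add: dual_lattice_def)
    then show ?thesis by (simp add: u_def sgn_real_def)
  qed
  have ut: "u \<bullet> t > 0" using u0(2) by (simp add: u_def sgn_real_def)
  then obtain d :: nat where d: "u \<bullet> t = of_nat d" "d > 0"
    using u[OF t(1)] by (metis Ints_cases of_int_0_less_iff of_int_of_nat_eq of_nat_0_less_iff zero_less_imp_eq_int)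
  have "(of_nat d / of_nat d) *\<^sub>R t \<in> L" using d t by simp
  then have ex: "\<exists>k::nat. k > 0 \<and> (of_nat k / of_nat d) *\<^sub>R t \<in> L"
    using d(2) by blast
  define k where "k = (LEAST k::nat. k > 0 \<and> (of_nat k / of_nat d) *\<^sub>R t \<in> L)"
  have k: "k > 0" "(of_nat k / of_nat d) *\<^sub>R t \<in> L"
    using LeastI_ex[OF ex] unfolding k_def by auto
  have least: "\<not> (l > 0 \<and> (of_nat l / of_nat d) *\<^sub>R t \<in> L)" if "l < k" for l
    using not_less_Least[OF that[unfolded k_def]] .
  define v where "v = (of_nat k / of_nat d) *\<^sub>R t"
  have v: "v \<in> L" "v \<noteq> 0" using k d t by (auto simp: v_def)
  have mult: "\<exists>n::nat. c *\<^sub>R t = of_nat n *\<^sub>R v" if c: "c \<ge> 0" "c *\<^sub>R t \<in> L" for c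
  proof -
    have "c * of_nat d \<in> \<int>" using u[OF c(2)] d by simp
    moreover have "c * of_nat d \<ge> 0" using c(1) by simp
    ultimately obtain j :: nat where j: "c * of_nat d = of_nat j"
      by (metis Ints_cases of_int_0_le_iff of_int_of_nat_eq zero_le_imp_eq_int)
    have cj: "c = of_nat j / of_nat d" using j d(2) by (simp add: field_simps)
    have "real j = real (j div k) * real k + real (j mod k)"
      by (metis div_mult_mod_eq of_nat_add of_nat_mult)
    then have "c = real (j div k) * (real k / real d) + real (j mod k) / real d"
      using d(2) by (simp add: cj field_simps)
    then have "c *\<^sub>R t = of_nat (j div k) *\<^sub>R v + (of_nat (j mod k) / of_nat d) *\<^sub>R t"
      by (simp only: v_def scaleR_add_left scaleR_scaleR)
    moreover from this have "(of_nat (j mod k) / of_nat d) *\<^sub>R t = c *\<^sub>R t - of_nat (j div k) *\<^sub>R v"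
      by simp
    moreover have "c *\<^sub>R t - of_nat (j div k) *\<^sub>R v \<in> L"
      using c(2) discrete_subgroup_of_nat[OF L v(1)] L unfolding discrete_subgroup_def by blast
    ultimately have "j mod k = 0" using least[of "j mod k"] k(1) by fastforce
    then show ?thesis using \<open>c *\<^sub>R t = _\<close> by (intro exI[of _ "j div k"]) simp
  qed
  obtain m :: nat where m: "t = of_nat m *\<^sub>R v" using mult[of 1] t(1) by auto
  have "m > 0" using m t(2) by (cases m) auto
  have range: "convex_cone hull {t} \<inter> L = range (\<lambda>n::nat. of_nat n *\<^sub>R v)"
  proof (intro equalityI subsetI)
    fix x assume "x \<in> convex_cone hull {t} \<inter> L"
    then show "x \<in> range (\<lambda>n::nat. of_nat n *\<^sub>R v)"
      using mult by (auto simp: mem_ray)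
  next
    fix x assume "x \<in> range (\<lambda>n::nat. of_nat n *\<^sub>R v)"
    then obtain n :: nat where n: "x = of_nat n *\<^sub>R v" by blast
    have "x = (of_nat n * (of_nat k / of_nat d)) *\<^sub>R t" by (simp add: n v_def)
    then have "x \<in> convex_cone hull {t}"
      unfolding mem_ray by (intro exI[of _ "of_nat n * (of_nat k / of_nat d)"]) simp
    then show "x \<in> convex_cone hull {t} \<inter> L"
      using discrete_subgroup_of_nat[OF L v(1)] n by simp
  qed
  have "primitive_generator L (convex_cone hull {t}) = v" unfolding primitive_generator_def
  proof (rule the_equality)
    show "v \<noteq> 0 \<and> convex_cone hull {t} \<inter> L = range (\<lambda>n::nat. of_nat n *\<^sub>R v)"
      using v range by simp
    fix v' assume v': "v' \<noteq> 0 \<and> convex_cone hull {t} \<inter> L = range (\<lambda>n::nat. of_nat n *\<^sub>R v')"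
    have eq: "range (\<lambda>n::nat. of_nat n *\<^sub>R v) = range (\<lambda>n::nat. of_nat n *\<^sub>R v')"
      using v' range by simp
    have "of_nat 1 *\<^sub>R v \<in> range (\<lambda>n::nat. of_nat n *\<^sub>R v)" "of_nat 1 *\<^sub>R v' \<in> range (\<lambda>n::nat. of_nat n *\<^sub>R v')"
      by blast+
    \<comment> \<open>Two generators are natural multiples of each other, hence equal.\<close>
    then obtain a b :: nat where ab: "v = of_nat a *\<^sub>R v'" "v' = of_nat b *\<^sub>R v"
      using eq by (metis (mono_tags, lifting) of_nat_1 rangeE scaleR_one)
    then have "v = of_nat (a * b) *\<^sub>R v" by (metis of_nat_mult scaleR_scaleR)
    then have "real (a * b) = 1" using v(2) by (metis scaleR_cancel_right scaleR_one)
    then have "b = 1" by (metis nat_mult_eq_1_iff of_nat_eq_1_iff)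
    then show "v' = v" using ab by simp
  qed
  then show thesis using that v \<open>m > 0\<close> m by blast
qed

section \<open>Edges of pointed polyhedral cones\<close>

lemma convex_cone_hull_pos:
  assumes "\<And>t. t \<in> T \<Longrightarrow> t = 0 \<or> w \<bullet> t > 0" "x \<in> convex_cone hull T"
  shows "x = 0 \<or> w \<bullet> x > 0"
proof -
  have "convex_cone {x. x = 0 \<or> w \<bullet> x > 0}"
    unfolding convex_cone_iff by (auto simp: inner_add_right zero_less_mult_iff)
  then have "convex_cone hull T \<subseteq> {x. x = 0 \<or> w \<bullet> x > 0}"
    by (intro hull_minimal) (use assms(1) in auto)
  with assms(2) show ?thesis by blast
qed

lemma convex_cone_hull_nonneg:
  assumes "\<And>t. t \<in> T \<Longrightarrow> w \<bullet> t \<ge> 0" "x \<in> convex_cone hull T"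
  shows "w \<bullet> x \<ge> 0"
proof -
  have "convex_cone hull T \<subseteq> {x. w \<bullet> x \<ge> 0}"
    by (intro hull_minimal convex_cone_halfspace_ge) (use assms(1) in auto)
  with assms(2) show ?thesis by blast
qed

text \<open>For \<open>c > 1\<close> a nonzero \<open>x\<close> lies strictly between 0 and
  \<open>c x\<close>, which puts both into the face; with 0 in the face, convexity settles
  \<open>c \<le> 1\<close>.\<close>

lemma face_of_convex_cone_scale:
  assumes C: "convex_cone C" and F: "F face_of C" and x: "x \<in> F" and c: "c > 0"
  shows "c *\<^sub>R x \<in> F"
proof -
  have sub: "F \<subseteq> C" and "convex F" using F by (auto simp: face_of_def)
  have C0: "0 \<in> C" and Cs: "\<And>y c. y \<in> C \<Longrightarrow> c \<ge> 0 \<Longrightarrow> c *\<^sub>R y \<in> C"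
    using C by (auto simp: convex_cone_iff)
  have gt: "0 \<in> F \<and> c *\<^sub>R x \<in> F" if "c > 1" "x \<noteq> 0" for c
  proof -
    have "x \<in> open_segment 0 (c *\<^sub>R x)"
      unfolding in_segment using that by (auto intro!: exI[of _ "1 / c"])
    then show ?thesis
      using F x C0 Cs[of x c] sub that(1) unfolding face_of_def by (meson less_imp_le less_trans subsetD zero_less_one)
  qed
  consider "x = 0" | "x \<noteq> 0" "c > 1" | "x \<noteq> 0" "c \<le> 1" by linarith
  then show ?thesis
  proof cases
    case 3
    have "0 \<in> F" using gt[of 2] 3 by simp
    then have "(1 - c) *\<^sub>R 0 + c *\<^sub>R x \<in> F"
      by (intro convexD_alt[OF \<open>convex F\<close>]) (use x c 3 in auto)
    then show ?thesis by simp
  qed (use gt x in auto)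
qed

text \<open>\<open>x + y\<close> is the midpoint of \<open>2 x\<close> and \<open>2 y\<close>; the
  case \<open>x = y\<close>, where the segment degenerates, needs only scaling.\<close>

lemma face_of_convex_cone_add:
  assumes C: "convex_cone C" and F: "F face_of C" and xy: "x \<in> C" "y \<in> C" "x + y \<in> F"
  shows "x \<in> F"
proof (cases "x = y")
  case True
  then have "(1/2) *\<^sub>R (x + y) = x" by (simp add: scaleR_2[symmetric])
  then show ?thesis using face_of_convex_cone_scale[OF C F xy(3), of "1/2"] by simp
next
  case False
  have "x + y \<in> open_segment (2 *\<^sub>R x) (2 *\<^sub>R y)"
    unfolding in_segment using False by (auto intro!: exI[of _ "1/2"])
  moreover have "2 *\<^sub>R x \<in> C" "2 *\<^sub>R y \<in> C"
    using C xy by (auto simp: convex_cone_iff)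
  ultimately have "2 *\<^sub>R x \<in> F" using F xy(3) unfolding face_of_def by blast
  then show ?thesis using face_of_convex_cone_scale[OF C F, of "2 *\<^sub>R x" "1/2"] by simp
qed

text \<open>In a cone it is enough to test extremality on sums, since the weights of a convex
  combination can be absorbed into its points.\<close>

lemma ray_in_edges:
  fixes C :: "'v::euclidean_space set"
  assumes C: "convex_cone C" and t: "t \<in> C" "t \<noteq> 0"
    and split: "\<And>x y. x \<in> C \<Longrightarrow> y \<in> C \<Longrightarrow> x + y \<in> convex_cone hull {t} \<Longrightarrow> x \<in> convex_cone hull {t}"
  shows "convex_cone hull {t} \<in> edges C"
proof -
  let ?r = "convex_cone hull {t}"
  have Cs: "\<And>y c. y \<in> C \<Longrightarrow> c \<ge> 0 \<Longrightarrow> c *\<^sub>R y \<in> C"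
    using C by (auto simp: convex_cone_iff)
  have split': "a \<in> ?r" if "a \<in> C" "b \<in> C" "c > 0" "d > 0" "c *\<^sub>R a + d *\<^sub>R b \<in> ?r" for a b c d
  proof -
    have "c *\<^sub>R a \<in> ?r" by (rule split[OF _ _ that(5)]) (use Cs that in auto)
    then have "(1 / c) *\<^sub>R (c *\<^sub>R a) \<in> ?r"
      by (rule convex_cone_hull_mul) (use that in simp)
    then show ?thesis using that by simp
  qed
  have "?r face_of C" unfolding face_of_def
  proof (intro conjI ballI impI)
    show "?r \<subseteq> C" using t Cs by (auto simp: mem_ray)
    show "convex ?r" by (rule convex_convex_cone_hull)
    fix a b x assume ab: "a \<in> C" "b \<in> C" "x \<in> ?r" "x \<in> open_segment a b"
    then obtain u where u: "0 < u" "u < 1" "x = (1 - u) *\<^sub>R a + u *\<^sub>R b"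
      by (auto simp: in_segment)
    show "a \<in> ?r" by (rule split'[of a b "1 - u" u]) (use ab u in auto)
    show "b \<in> ?r"
      by (rule split'[of b a u "1 - u"]) (use ab u in \<open>auto simp: add.commute\<close>)
  qed
  moreover have "aff_dim ?r = 1"
  proof -
    have "0 \<in> affine hull ?r" by (intro hull_inc convex_cone_hull_contains_0)
    then have "aff_dim ?r = int (dim ?r)" by (rule aff_dim_zero)
    also have "dim ?r = dim {t}"
    proof (rule antisym)
      show "dim ?r \<le> dim {t}"
      proof (rule dim_subset[of ?r "span {t}", unfolded dim_span])
        show "?r \<subseteq> span {t}" by (auto simp: mem_ray span_base span_scale)
      qed
      show "dim {t} \<le> dim ?r" by (rule dim_subset) (simp add: hull_inc)
    qed
    finally show ?thesis using t(2) by simp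
  qed
  ultimately show ?thesis by (simp add: edges_def edge_of_def)
qed

text \<open>If an edge contained no generator, the points of the cone that are 0 or outside the edge
  would form a convex cone containing \<open>T\<close>, hence everything. The functional
  \<open>w\<close> then makes the edge a ray and not a line.\<close>

lemma edges_subset_rays:
  fixes T :: "'v::euclidean_space set"
  assumes pos: "\<And>t. t \<in> T \<Longrightarrow> w \<bullet> t > 0" and \<xi>: "\<xi> \<in> edges (convex_cone hull T)"
  obtains t where "t \<in> T" "\<xi> = convex_cone hull {t}"
proof -
  let ?C = "convex_cone hull T"
  have C: "convex_cone ?C" by (rule convex_cone_convex_cone_hull)
  have F: "\<xi> face_of ?C" and dim1: "aff_dim \<xi> = 1"
    using \<xi> by (auto simp: edges_def edge_of_def)
  have sub: "\<xi> \<subseteq> ?C" using F by (rule face_of_imp_subset)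
  have not0: "\<not> \<xi> \<subseteq> {0}" using aff_dim_subset[of \<xi> "{0}"] dim1 by auto
  have "\<exists>t\<in>T. t \<in> \<xi>"
  proof (rule ccontr)
    assume none: "\<not> (\<exists>t\<in>T. t \<in> \<xi>)"
    have "convex_cone {x \<in> ?C. x \<in> \<xi> \<longrightarrow> x = 0}"
    proof (rule convex_cone_iff[THEN iffD2], intro conjI ballI allI impI)
      show "0 \<in> {x \<in> ?C. x \<in> \<xi> \<longrightarrow> x = 0}"
        by (simp add: convex_cone_hull_contains_0)
    next
      fix x y assume xy: "x \<in> {x \<in> ?C. x \<in> \<xi> \<longrightarrow> x = 0}" "y \<in> {x \<in> ?C. x \<in> \<xi> \<longrightarrow> x = 0}"
      have "x \<in> \<xi>" "y \<in> \<xi>" if "x + y \<in> \<xi>"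
        using face_of_convex_cone_add[OF C F, of x y] face_of_convex_cone_add[OF C F, of y x] xy that
        by (simp_all add: add.commute)
      then show "x + y \<in> {x \<in> ?C. x \<in> \<xi> \<longrightarrow> x = 0}"
        using xy convex_cone_hull_add by auto
    next
      fix x and c :: real assume x: "x \<in> {x \<in> ?C. x \<in> \<xi> \<longrightarrow> x = 0}" "0 \<le> c"
      have "c *\<^sub>R x = 0" if "c *\<^sub>R x \<in> \<xi>"
      proof (cases "c = 0")
        case False
        then have "inverse c *\<^sub>R (c *\<^sub>R x) \<in> \<xi>"
          by (intro face_of_convex_cone_scale[OF C F that]) (use x in simp)
        then have "x \<in> \<xi>" by (simp only: scaleR_scaleR left_inverse[OF False] scaleR_one)
        then show ?thesis using x by simp
      qed simp
      then show "c *\<^sub>R x \<in> {x \<in> ?C. x \<in> \<xi> \<longrightarrow> x = 0}"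
        using x convex_cone_hull_mul by auto
    qed
    then have "?C \<subseteq> {x \<in> ?C. x \<in> \<xi> \<longrightarrow> x = 0}"
      by (intro hull_minimal) (use none in \<open>auto intro: hull_inc\<close>)
    then show False using sub not0 by blast
  qed
  then obtain t where t: "t \<in> T" "t \<in> \<xi>" by blast
  then have t0: "t \<noteq> 0" using pos by force
  have scale: "c *\<^sub>R t \<in> \<xi>" if "c > 0" for c
    by (rule face_of_convex_cone_scale[OF C F t(2) that])
  have "0 \<in> affine hull \<xi>"
  proof -
    have "2 *\<^sub>R (1 *\<^sub>R t) + (-1) *\<^sub>R (2 *\<^sub>R t) \<in> affine hull \<xi>"
      by (rule mem_affine[OF affine_affine_hull]) (use scale[of 1] scale[of 2] in \<open>auto intro: hull_inc\<close>)
    then show ?thesis by simp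
  qed
  then have "dim \<xi> = 1" using aff_dim_zero[of \<xi>] dim1 by simp
  then have "span {t} = span \<xi>" by (intro dim_eq_span) (use t t0 in auto)
  have "\<xi> = convex_cone hull {t}"
  proof (intro equalityI subsetI)
    fix x assume x: "x \<in> \<xi>"
    then have "x \<in> span {t}" using \<open>span {t} = span \<xi>\<close> by (simp add: span_base)
    then obtain c where c: "x = c *\<^sub>R t" by (auto simp: span_singleton)
    have "x = 0 \<or> w \<bullet> x > 0"
      by (rule convex_cone_hull_pos[of T]) (use pos sub x in blast)+
    then have "c \<ge> 0" using pos[OF t(1)] c by (auto simp: zero_less_mult_iff)
    then show "x \<in> convex_cone hull {t}" using c by (auto simp: mem_ray)
  next
    fix x assume "x \<in> convex_cone hull {t}"
    then obtain c where c: "c \<ge> 0" "x = c *\<^sub>R t" by (auto simp: mem_ray)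
    have "0 \<in> \<xi>"
      using face_of_convex_cone_add[OF C F convex_cone_hull_contains_0 _ , of t] t sub by auto
    then show "x \<in> \<xi>" using c scale[of c] by (cases "c = 0") auto
  qed
  then show thesis using that t by blast
qed

text \<open>In a generating subset of least size every member spans an edge: a member that splits
  otherwise would be generated by the rest.\<close>

lemma convex_cone_hull_edges:
  fixes T :: "'v::euclidean_space set"
  assumes "finite T" and pos: "\<And>t. t \<in> T \<Longrightarrow> w \<bullet> t > 0"
  shows "convex_cone hull T = convex_cone hull {t \<in> T. convex_cone hull {t} \<in> edges (convex_cone hull T)}"
    (is "?C = ?C'")
proof
  define P where "P T' \<longleftrightarrow> T' \<subseteq> T \<and> convex_cone hull T' = ?C" for T'
  have "P T" by (simp add: P_def)
  then obtain T' where "P T'" and min: "\<And>T''. P T'' \<Longrightarrow> card T' \<le> card T''"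
    using ex_has_least_nat[of P T card] by auto
  then have T': "T' \<subseteq> T" "convex_cone hull T' = ?C" by (auto simp: P_def)
  have least: "card T' \<le> card T''" if "T'' \<subseteq> T" "convex_cone hull T'' = ?C" for T''
    by (rule min) (simp add: P_def that)
  have "convex_cone hull {t} \<in> edges ?C" if t: "t \<in> T'" for t
  proof (rule ray_in_edges)
    show "convex_cone ?C" by (rule convex_cone_convex_cone_hull)
    show "t \<in> ?C" "t \<noteq> 0" using t T'(1) pos[of t] by (auto intro: hull_inc)
    define S where "S = T' - {t}"
    have S: "T' = insert t S" "S \<subseteq> T" using t T'(1) by (auto simp: S_def)
    have wS: "x = 0 \<or> w \<bullet> x > 0" if "x \<in> convex_cone hull S" for x
      by (rule convex_cone_hull_pos[OF _ that]) (use S(2) pos in auto)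
    have dec: "\<exists>a\<ge>0. \<exists>x'\<in>convex_cone hull S. x = a *\<^sub>R t + x'" if x: "x \<in> ?C" for x
    proof -
      obtain r x' where "r \<in> convex_cone hull {t}" "x' \<in> convex_cone hull S" "x = r + x'"
        using x unfolding T'(2)[symmetric] S(1) insert_is_Un[of t S] convex_cone_hull_Un by blast
      then show ?thesis unfolding mem_ray by blast
    qed
    have notin: "t \<notin> convex_cone hull S"
    proof
      assume "t \<in> convex_cone hull S"
      then have "convex_cone hull S = ?C" using T'(2) unfolding S(1) by (simp add: hull_redundant)
      then have "card T' \<le> card S" using least S(2) by blast
      moreover have "card S < card T'"
        unfolding S_def using finite_subset[OF T'(1) assms(1)] t by (rule card_Diff1_less)
      ultimately show False by simp
    qed
    fix x y assume "x \<in> ?C" "y \<in> ?C" "x + y \<in> convex_cone hull {t}"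
    then obtain a x' b y' c where *: "a \<ge> 0" "x' \<in> convex_cone hull S" "x = a *\<^sub>R t + x'"
      "b \<ge> 0" "y' \<in> convex_cone hull S" "y = b *\<^sub>R t + y'" "c \<ge> 0" "x + y = c *\<^sub>R t"
      using dec[of x] dec[of y] by (auto simp: mem_ray)
    have eq: "x' + y' = (c - a - b) *\<^sub>R t" using *(3,6,8) by (simp add: algebra_simps)
    show "x \<in> convex_cone hull {t}"
    \<comment> \<open>A positive coefficient would make \<open>t\<close> redundant. Otherwise
      \<open>w\<close> is nonpositive on \<open>x' + y'\<close>, which leaves only
      \<open>x' = 0\<close>.\<close>
    proof (cases "c - a - b > 0")
      case True
      then have "t = (1 / (c - a - b)) *\<^sub>R (x' + y')" unfolding eq by simp
      also have "\<dots> \<in> convex_cone hull S"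
        by (intro convex_cone_hull_mul convex_cone_hull_add) (use * True in auto)
      finally show ?thesis using notin by blast
    next
      case False
      have "w \<bullet> t > 0" using pos t T'(1) by blast
      then have "w \<bullet> x' + w \<bullet> y' \<le> 0"
        using False eq by (simp add: mult_nonpos_nonneg flip: inner_add_right)
      then have "x' = 0" using wS[OF *(2)] wS[OF *(5)] by auto
      then show ?thesis using * by (auto simp: mem_ray)
    qed
  qed
  then show "?C \<subseteq> ?C'"
    unfolding T'(2)[symmetric] using T'(1) by (intro hull_mono) (auto simp: T'(2))
  show "?C' \<subseteq> ?C" by (rule hull_mono) auto
qed

section \<open>Minkowski decompositions and the extended cone\<close>

text \<open>The second component carried by \<open>Qs j\<close> in the extended cone, so that
  \<open>Q\<^sub>0\<close> is treated like the other summands.\<close>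

definition shift :: "'k::finite option \<Rightarrow> real ^ 'k" where
  "shift j = (case j of None \<Rightarrow> - (\<Sum>i\<in>UNIV. axis i 1) | Some i \<Rightarrow> axis i 1)"

lemma sum_UNIV_option:
  fixes f :: "'k::finite option \<Rightarrow> 'b::comm_monoid_add"
  shows "(\<Sum>j\<in>UNIV. f j) = f None + (\<Sum>i\<in>UNIV. f (Some i))"
proof -
  have "(\<Sum>j\<in>range Some. f j) = (\<Sum>i\<in>UNIV. f (Some i))"
    by (subst sum.reindex) (auto simp: o_def)
  then show ?thesis by (simp add: UNIV_option_conv)
qed

text \<open>The only relation among the shifts is that their sum vanishes.\<close>

lemma inner_shift:
  fixes f :: "'k::finite option \<Rightarrow> real"
  assumes "(\<Sum>j\<in>UNIV. f j) = 0"
  shows "(\<chi> i. f (Some i)) \<bullet> shift j = f j"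
proof (cases j)
  case None
  have "(\<chi> i. f (Some i)) \<bullet> shift None = - (\<Sum>i\<in>UNIV. f (Some i))"
    by (simp add: shift_def inner_minus_right inner_sum_right inner_axis)
  then show ?thesis using assms None by (simp add: sum_UNIV_option)
qed (simp add: shift_def inner_axis)

lemma shift_nonzero: "shift j \<noteq> (0 :: real ^ 'k::finite)"
proof
  assume *: "shift j = (0 :: real ^ 'k)"
  \<comment> \<open>A family with sum 0 and no zero entry; pairing with it detects every
    shift.\<close>
  define f :: "'k option \<Rightarrow> real" where "f l = of_bool (l = None) * of_nat CARD('k) - of_bool (l \<noteq> None)" for l
  have "(\<Sum>l\<in>UNIV. f l) = 0" by (simp add: sum_UNIV_option f_def)
  then have "f j = 0" using inner_shift[of f j] * by simp
  then show False by (cases j) (auto simp: f_def)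
qed

text \<open>Each shift has a coordinate 1 or -1. Hence a lattice point on the ray through
  \<open>(q, shift j)\<close> is an integral multiple of \<open>(q, shift j)\<close>.\<close>

lemma integral_multiple_of_shift:
  assumes "\<forall>i. (c *\<^sub>R (shift j :: real ^ 'k::finite)) $ i \<in> \<int>"
  shows "c \<in> \<int>"
proof (cases j)
  case None
  have "(\<Sum>i'\<in>UNIV. axis i' 1 $ i) = (1 :: real)" for i :: 'k
  proof -
    have "(\<Sum>i'\<in>UNIV. axis i' 1 $ i) = (\<Sum>i'\<in>UNIV. if i' = i then 1 else (0 :: real))"
      by (intro sum.cong) (auto simp: axis_def)
    then show ?thesis by simp
  qed
  then have "- c \<in> \<int>" using assms None by (simp add: shift_def)
  then show ?thesis by (metis Ints_minus minus_minus)
next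
  case (Some i)
  then show ?thesis using assms[rule_format, of i] by (simp add: shift_def axis_def)
qed

lemma tilde_cone_shift:
  "tilde_cone \<sigma> Qs = convex_cone hull ((\<lambda>s. (s, 0)) ` \<sigma> \<union> (\<Union>j. (\<lambda>q. (q, shift j)) ` Qs j))"
proof -
  have "({(s, 0) |s. s \<in> \<sigma>} \<union> {(q, - (\<Sum>i\<in>UNIV. axis i 1)) |q. q \<in> Qs None} \<union> (\<Union>i. {(q, axis i 1) |q. q \<in> Qs (Some i)}))
     = ((\<lambda>s. (s, 0)) ` \<sigma> \<union> (\<Union>j. (\<lambda>q. (q, shift j)) ` Qs j))"
    (is "?A \<union> ?B \<union> ?C = ?A' \<union> ?D")
  proof -
    have "?A = ?A'" by auto
    moreover have "?D = (\<lambda>q. (q, shift None)) ` Qs None \<union> (\<Union>i. (\<lambda>q. (q, shift (Some i))) ` Qs (Some i))"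
      by (auto simp: UNIV_option_conv)
    moreover have "(\<lambda>q. (q, shift None)) ` Qs None = ?B" "(\<Union>i. (\<lambda>q. (q, shift (Some i))) ` Qs (Some i)) = ?C"
      by (auto simp: shift_def)
    ultimately show ?thesis by auto
  qed
  then show ?thesis by (simp only: tilde_cone_def)
qed

text \<open>If 0 were a convex combination of the nonzero generators, isolating one term would give
  a nonzero point whose negative is in the cone. So the compact hull of these generators can be
  separated strictly from 0.\<close>

lemma strongly_convex_pos_functional:
  fixes S :: "'v::euclidean_space set"
  assumes "finite S" "strongly_convex (convex_cone hull S)"
  obtains w where "\<And>x. x \<in> convex_cone hull S \<Longrightarrow> x \<noteq> 0 \<Longrightarrow> w \<bullet> x > 0"
proof (cases "S - {0} = {}")
  case True
  then have "w \<bullet> x > 0" if "x \<in> convex_cone hull S" "x \<noteq> 0" for w x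
    using convex_cone_hull_pos[of S w x] that by auto
  then show thesis using that by blast
next
  case False
  let ?S = "S - {0}"
  have fin: "finite ?S" using assms(1) by simp
  have "0 \<notin> convex hull ?S"
  proof
    assume "0 \<in> convex hull ?S"
    then obtain u where u: "\<forall>s\<in>?S. 0 \<le> u s" "sum u ?S = 1" "(\<Sum>s\<in>?S. u s *\<^sub>R s) = 0"
      unfolding convex_hull_finite[OF fin] by auto
    then obtain s where s: "s \<in> ?S" "u s \<noteq> 0" by (metis sum.neutral zero_neq_one)
    have mem: "(\<Sum>t\<in>A. u t *\<^sub>R t) \<in> convex_cone hull S" if "A \<subseteq> ?S" for A
      using finite_subset[OF that fin] that
    proof (induction A)
      case (insert t A)
      then have "u t *\<^sub>R t \<in> convex_cone hull S"
        by (intro convex_cone_hull_mul hull_inc) (use u in auto)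
      then show ?case using insert convex_cone_hull_add by auto
    qed (simp add: convex_cone_hull_contains_0)
    have "u s *\<^sub>R s + (\<Sum>t\<in>?S - {s}. u t *\<^sub>R t) = 0"
      using sum.remove[OF fin s(1), of "\<lambda>t. u t *\<^sub>R t"] u(3) by simp
    then have "u s *\<^sub>R s = - (\<Sum>t\<in>?S - {s}. u t *\<^sub>R t)"
      by (simp add: eq_neg_iff_add_eq_0)
    moreover have "(\<Sum>t\<in>?S - {s}. u t *\<^sub>R t) \<in> convex_cone hull S"
      by (rule mem) auto
    moreover have "u s *\<^sub>R s \<in> convex_cone hull S" using mem[of "{s}"] s by simp
    ultimately have "u s *\<^sub>R s \<in> convex_cone hull S \<inter> uminus ` (convex_cone hull S)"
      by blast
    then have "u s *\<^sub>R s = 0"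
      unfolding assms(2)[unfolded strongly_convex_def] by (rule singletonD)
    then show False using s by simp
  qed
  moreover have "closed (convex hull ?S)"
    by (rule compact_imp_closed[OF finite_imp_compact_convex_hull[OF fin]])
  ultimately obtain w b where w: "0 < b" "\<forall>x\<in>convex hull ?S. w \<bullet> x > b"
    using separating_hyperplane_closed_0[OF convex_convex_hull] by blast
  have "s = 0 \<or> w \<bullet> s > 0" if "s \<in> S" for s
  proof (cases "s = 0")
    case False
    then have "s \<in> convex hull ?S" using that by (intro hull_inc) auto
    then show ?thesis using w by force
  qed simp
  then have "w \<bullet> x > 0" if "x \<in> convex_cone hull S" "x \<noteq> 0" for x
    using convex_cone_hull_pos[of S w x] that by auto
  then show thesis using that by blast
qed

lemma recession_coneD: "d \<in> recession_cone P \<Longrightarrow> x \<in> P \<Longrightarrow> 0 \<le> t \<Longrightarrow> x + t *\<^sub>R d \<in> P"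
  by (simp add: recession_cone_def)

section \<open>Recession cones and vertices of the summands\<close>

locale minkowski_data =
  fixes N \<sigma> Q :: "'a::euclidean_space set" and Qs :: "'k::finite option \<Rightarrow> 'a set"
  assumes lattice_N: "full_lattice N"
    and cone_\<sigma>: "rational_polyhedral_cone N \<sigma>" "strongly_convex \<sigma>" "dim \<sigma> = DIM('a)"
    and polyhedron_Q: "rational_polyhedron N Q" "Q \<noteq> {}" "Q \<subseteq> \<sigma>" "0 \<notin> Q"
    and decomp: "minkowski_decomposition Q Qs" "almost_integral_decomposition N Q Qs"
begin

abbreviation N' :: "('a \<times> (real ^ 'k)) set" where "N' \<equiv> ext_lattice N"
abbreviation \<sigma>' :: "('a \<times> (real ^ 'k)) set" where "\<sigma>' \<equiv> tilde_cone \<sigma> Qs"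

lemma \<sigma>_generators:
  obtains S where "finite S" "S \<subseteq> N" "\<sigma> = convex_cone hull S"
  using cone_\<sigma>(1) unfolding rational_polyhedral_cone_def by blast

lemma convex_cone_\<sigma>: "convex_cone \<sigma>"
  by (rule \<sigma>_generators) (simp add: convex_cone_convex_cone_hull)

lemma pos_functional:
  obtains w where "\<And>x. x \<in> \<sigma> \<Longrightarrow> x \<noteq> 0 \<Longrightarrow> w \<bullet> x > 0"
proof -
  obtain S where S: "finite S" "\<sigma> = convex_cone hull S" using \<sigma>_generators by metis
  show thesis
    using strongly_convex_pos_functional[OF S(1)] cone_\<sigma>(2) that unfolding S(2) by blast
qed

lemma polyhedron_Qs: "polyhedron (Qs j)"
  and sum_Qs: "Q = {\<Sum>j\<in>UNIV. s j |s. \<forall>j. s j \<in> Qs j}"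
  and recession_Qs: "recession_cone (Qs j) = recession_cone Q"
  using decomp(1) set_sum_alt[of UNIV Qs] unfolding minkowski_decomposition_def by auto

lemma Qs_nonempty: "Qs j \<noteq> {}" using polyhedron_Q(2) unfolding sum_Qs by blast

lemma convex_Qs: "convex (Qs j)" by (rule polyhedron_imp_convex[OF polyhedron_Qs])

text \<open>The points \<open>x / n + d\<close> are positive multiples of the points
  \<open>x + n d\<close> of \<open>Q\<close>; they lie in \<sigma> and tend to \<open>d\<close>, and
  \<sigma> is closed.\<close>

lemma recession_Q_subset: "recession_cone Q \<subseteq> \<sigma>"
proof
  fix d assume d: "d \<in> recession_cone Q"
  obtain x where x: "x \<in> Q" using polyhedron_Q(2) by blast
  have mem: "inverse (real (Suc n)) *\<^sub>R x + d \<in> \<sigma>" for n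
  proof -
    have "x + real (Suc n) *\<^sub>R d \<in> \<sigma>"
      using d x polyhedron_Q(3) unfolding recession_cone_def by fastforce
    then have "inverse (real (Suc n)) *\<^sub>R (x + real (Suc n) *\<^sub>R d) \<in> \<sigma>"
      by (intro convex_cone_scaleR[OF convex_cone_\<sigma>]) auto
    then show ?thesis by (simp add: scaleR_add_right del: of_nat_Suc)
  qed
  have lim: "(\<lambda>n. inverse (real (Suc n)) *\<^sub>R x + d) \<longlonglongrightarrow> 0 *\<^sub>R x + d"
    by (intro tendsto_intros LIMSEQ_inverse_real_of_nat)
  have "closed \<sigma>" by (rule \<sigma>_generators) (simp add: closed_convex_cone_hull)
  then have "0 *\<^sub>R x + d \<in> \<sigma>" by (rule closed_sequentially[OF _ mem lim])
  then show "d \<in> \<sigma>" by simp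
qed

lemma recession_pointed:
  assumes "v \<in> recession_cone Q" "- v \<in> recession_cone Q"
  shows "v = 0"
proof -
  have "v \<in> uminus ` \<sigma>"
    using assms(2) recession_Q_subset by (intro image_eqI[of _ _ "- v"]) auto
  then have "v \<in> \<sigma> \<inter> uminus ` \<sigma>" using assms(1) recession_Q_subset by blast
  then show ?thesis unfolding cone_\<sigma>(2)[unfolded strongly_convex_def] by (rule singletonD)
qed

text \<open>A segment through \<open>qs j\<close> in its summand, translated by the other
  \<open>qs l\<close>, is a segment in \<open>Q\<close>.\<close>

lemma extreme_point_summand:
  assumes "(\<Sum>j\<in>UNIV. qs j) extreme_point_of Q" "\<And>j. qs j \<in> Qs j"
  shows "qs j extreme_point_of Qs j" unfolding extreme_point_of_def
proof (intro conjI ballI notI)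
  show "qs j \<in> Qs j" by fact
  fix a b assume ab: "a \<in> Qs j" "b \<in> Qs j" "qs j \<in> open_segment a b"
  define r where "r = (\<Sum>l\<in>UNIV - {j}. qs l)"
  have split: "(\<Sum>l\<in>UNIV. (qs(j := x)) l) = x + r" for x
  proof -
    have "(\<Sum>l\<in>UNIV. (qs(j := x)) l) = (qs(j := x)) j + (\<Sum>l\<in>UNIV - {j}. (qs(j := x)) l)"
      by (rule sum.remove) auto
    also have "(\<Sum>l\<in>UNIV - {j}. (qs(j := x)) l) = r"
      unfolding r_def by (intro sum.cong) auto
    finally show ?thesis by simp
  qed
  have mem: "x + r \<in> Q" if "x \<in> Qs j" for x
    unfolding sum_Qs split[symmetric] using that assms(2) by (intro CollectI exI[of _ "qs(j := x)"]) auto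
  obtain u where u: "0 < u" "u < 1" "qs j = (1 - u) *\<^sub>R a + u *\<^sub>R b" "a \<noteq> b"
    using ab(3) by (auto simp: in_segment)
  have q: "(\<Sum>l\<in>UNIV. qs l) = qs j + r" using split[of "qs j"] by simp
  have "qs j + r \<in> open_segment (a + r) (b + r)"
    unfolding in_segment using u by (auto intro!: exI[of _ u] simp: algebra_simps)
  then show False
    using assms(1) mem[OF ab(1)] mem[OF ab(2)] unfolding extreme_point_of_def q by blast
qed

text \<open>At a minimizing vertex of \<open>Q\<close> all summands are minimal at the same time,
  since exchanging one of them for a better point would improve the sum.\<close>

lemma vertex_decomposition:
  assumes u: "\<And>d. d \<in> recession_cone Q \<Longrightarrow> u \<bullet> d \<ge> 0"
  obtains qs where "(\<Sum>j\<in>UNIV. qs j) extreme_point_of Q" "\<And>j. qs j extreme_point_of Qs j"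
    "\<And>j x. x \<in> Qs j \<Longrightarrow> u \<bullet> qs j \<le> u \<bullet> x"
proof -
  obtain q where q: "q extreme_point_of Q" "\<And>x. x \<in> Q \<Longrightarrow> u \<bullet> q \<le> u \<bullet> x"
  proof (rule polyhedron_min_extreme_point)
    show "polyhedron Q" by (rule rational_polyhedron_imp_polyhedron[OF polyhedron_Q(1)])
    show "u \<bullet> d \<ge> 0" if "d \<in> recession_cone Q" for d by (rule u[OF that])
  qed (use polyhedron_Q recession_pointed in auto)
  have "q \<in> Q" using q(1) by (simp add: extreme_point_of_def)
  then obtain qs where qs: "q = (\<Sum>j\<in>UNIV. qs j)" "\<And>j. qs j \<in> Qs j"
    unfolding sum_Qs by blast
  have "u \<bullet> qs j \<le> u \<bullet> x" if x: "x \<in> Qs j" for j x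
  proof -
    have "(\<Sum>l\<in>UNIV. (qs(j := x)) l) \<in> Q"
      unfolding sum_Qs using x qs(2) by (intro CollectI exI[of _ "qs(j := x)"]) auto
    then have "(\<Sum>l\<in>UNIV. u \<bullet> qs l) \<le> (\<Sum>l\<in>UNIV. u \<bullet> (qs(j := x)) l)"
      using q(2)[of "\<Sum>l\<in>UNIV. (qs(j := x)) l"] unfolding qs(1) inner_sum_right by blast
    moreover have "(\<Sum>l\<in>UNIV. u \<bullet> f l) = u \<bullet> f j + (\<Sum>l\<in>UNIV - {j}. u \<bullet> f l)" for f :: "'k option \<Rightarrow> 'a"
      by (rule sum.remove) auto
    moreover have "(\<Sum>l\<in>UNIV - {j}. u \<bullet> (qs(j := x)) l) = (\<Sum>l\<in>UNIV - {j}. u \<bullet> qs l)"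
      by (intro sum.cong) auto
    ultimately show ?thesis by simp
  qed
  then show thesis using that[of qs] extreme_point_summand[of qs] q(1) qs by blast
qed

lemma almost_integral:
  assumes "(\<Sum>j\<in>UNIV. qs j) extreme_point_of Q" "\<And>j. qs j extreme_point_of Qs j"
  obtains j\<^sub>0 where "\<And>j. j \<noteq> j\<^sub>0 \<Longrightarrow> qs j \<in> N"
proof -
  have "card {j. qs j \<notin> N} \<le> 1"
    using decomp(2) assms unfolding almost_integral_decomposition_def by blast
  then have "\<exists>j0. {j. qs j \<notin> N} \<subseteq> {j0}"
    by (metis card_le_Suc0_iff_eq One_nat_def empty_iff finite insertCI subsetI)
  then show thesis using that by blast
qed

lemma lattice_N_add: "x \<in> N \<Longrightarrow> y \<in> N \<Longrightarrow> x + y \<in> N"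
  using full_lattice_diff[OF lattice_N, of x "0 - y"] full_lattice_diff[OF lattice_N full_lattice_0[OF lattice_N], of y] by simp

lemma lattice_N_of_nat: "x \<in> N \<Longrightarrow> of_nat n *\<^sub>R x \<in> N"
  by (induction n) (auto simp: full_lattice_0[OF lattice_N] scaleR_add_left intro: lattice_N_add)

lemma lattice_N_sum: "(\<And>i. i \<in> A \<Longrightarrow> f i \<in> N) \<Longrightarrow> sum f A \<in> N"
  by (induction A rule: infinite_finite_induct) (auto simp: full_lattice_0[OF lattice_N] intro: lattice_N_add)

text \<open>The functional exposing \<open>p\<close> in \<open>Qs j\<close> is bounded on
  \<open>Q\<close> too, and the vertex of \<open>Q\<close> optimal for it has \<open>p\<close> as
  its summand. That vertex is rational; either \<open>p\<close> is integral, or it is the vertex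
  minus lattice points.\<close>

lemma extreme_point_Qs_rational:
  assumes p: "p extreme_point_of Qs j"
  obtains m :: nat where "m > 0" "of_nat m *\<^sub>R p \<in> N"
proof -
  have "{p} exposed_face_of Qs j"
    using p exposed_face_of_polyhedron[OF polyhedron_Qs] by (simp add: face_of_singleton)
  then obtain a b where ab: "Qs j \<subseteq> {x. a \<bullet> x \<le> b}" "{p} = Qs j \<inter> {x. a \<bullet> x = b}"
    unfolding exposed_face_of_def by blast
  have p_mem: "p \<in> Qs j" "a \<bullet> p = b" using ab(2) by auto
  have "- a \<bullet> d \<ge> 0" if d: "d \<in> recession_cone Q" for d
  proof -
    have "d \<in> recession_cone (Qs j)" using d by (simp only: recession_Qs)
    then have "p + 1 *\<^sub>R d \<in> Qs j" by (rule recession_coneD[OF _ p_mem(1) zero_le_one])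
    then show ?thesis using ab(1) p_mem(2) by (auto simp: inner_add_right)
  qed
  then obtain qs where qs: "(\<Sum>j\<in>UNIV. qs j) extreme_point_of Q" "\<And>j. qs j extreme_point_of Qs j"
    "\<And>j x. x \<in> Qs j \<Longrightarrow> - a \<bullet> qs j \<le> - a \<bullet> x"
    using vertex_decomposition[of "- a"] by metis
  have "qs j \<in> Qs j" using qs(2) by (auto simp: extreme_point_of_def)
  moreover from this have "a \<bullet> qs j = b" using qs(3)[OF p_mem(1)] ab(1) p_mem(2) by auto
  ultimately have "qs j = p" using ab(2) by blast
  obtain m :: nat where m: "m > 0" "of_nat m *\<^sub>R (\<Sum>j\<in>UNIV. qs j) \<in> N"
    by (rule rational_polyhedron_extreme_point[OF lattice_N polyhedron_Q(1) qs(1)])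
  obtain j\<^sub>0 where j\<^sub>0: "\<And>l. l \<noteq> j\<^sub>0 \<Longrightarrow> qs l \<in> N"
    using almost_integral[OF qs(1,2)] by blast
  show thesis
  proof (cases "j = j\<^sub>0")
    case False
    then have "of_nat 1 *\<^sub>R p \<in> N" using j\<^sub>0 \<open>qs j = p\<close> by force
    then show thesis by (intro that[of 1]) simp_all
  next
    case True
    have "(\<Sum>l\<in>UNIV. qs l) = p + (\<Sum>l\<in>UNIV - {j}. qs l)"
      using sum.remove[of UNIV j qs] \<open>qs j = p\<close> by simp
    then have "of_nat m *\<^sub>R p = of_nat m *\<^sub>R (\<Sum>l\<in>UNIV. qs l) - of_nat m *\<^sub>R (\<Sum>l\<in>UNIV - {j}. qs l)"
      by (simp add: algebra_simps)
    also have "\<dots> \<in> N"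
      by (intro full_lattice_diff[OF lattice_N] m lattice_N_of_nat lattice_N_sum) (use j\<^sub>0 True in auto)
    finally show thesis by (rule that[OF m(1)])
  qed
qed

section \<open>Duality and generators of the extended cone\<close>

lemma \<sigma>_subset_tilde: "s \<in> \<sigma> \<Longrightarrow> (s, 0) \<in> \<sigma>'"
  unfolding tilde_cone_shift by (rule hull_inc) blast

lemma Qs_subset_tilde: "q \<in> Qs j \<Longrightarrow> (q, shift j) \<in> \<sigma>'"
  unfolding tilde_cone_shift by (rule hull_inc) blast

lemma convex_cone_tilde: "convex_cone \<sigma>'"
  unfolding tilde_cone_shift by (rule convex_cone_convex_cone_hull)

text \<open>By \<open>inner_shift\<close>, the second component of a functional can be given by its
  values \<open>f j\<close> on the shifts, subject only to sum 0.\<close>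

lemma dual_tilde_coneI:
  fixes f :: "'k option \<Rightarrow> real"
  assumes "(\<Sum>j\<in>UNIV. f j) = 0" "\<And>s. s \<in> \<sigma> \<Longrightarrow> u \<bullet> s \<ge> 0" "\<And>j x. x \<in> Qs j \<Longrightarrow> u \<bullet> x + f j \<ge> 0"
  shows "(u, \<chi> i. f (Some i)) \<in> dual_cone \<sigma>'"
  unfolding dual_cone_def tilde_cone_shift
proof (intro CollectI ballI)
  fix x :: "'a \<times> (real ^ 'k)"
  assume x: "x \<in> convex_cone hull ((\<lambda>s. (s, 0)) ` \<sigma> \<union> (\<Union>j. (\<lambda>q. (q, shift j)) ` Qs j))"
  show "0 \<le> (u, \<chi> i. f (Some i)) \<bullet> x"
    by (rule convex_cone_hull_nonneg[OF _ x]) (use assms in \<open>auto simp: inner_shift\<close>)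
qed

lemma dual_tilde_cone_fst: "u \<in> dual_cone \<sigma>' \<Longrightarrow> fst u \<in> dual_cone \<sigma>"
  using \<sigma>_subset_tilde by (cases u) (fastforce simp: dual_cone_def)

text \<open>\<sigma> has full dimension, and a point of \<open>Qs (Some i)\<close> adds the
  direction \<open>e\<^sub>i\<close>.\<close>

lemma tilde_cone_full: "(\<And>x. x \<in> \<sigma>' \<Longrightarrow> u \<bullet> x = 0) \<Longrightarrow> u = 0"
proof -
  assume u: "\<And>x. x \<in> \<sigma>' \<Longrightarrow> u \<bullet> x = 0"
  have "fst u \<bullet> s = 0" if "s \<in> \<sigma>" for s
    using u[OF \<sigma>_subset_tilde[OF that]] by (cases u) simp
  moreover have "span \<sigma> = UNIV" using cone_\<sigma>(3) by (metis dim_eq_full)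
  ultimately have "fst u \<bullet> x = 0" for x
    using orthogonal_to_span[of x \<sigma> "fst u"] by (simp add: orthogonal_def)
  then have fst: "fst u = 0" using inner_eq_zero_iff by blast
  have "snd u $ i = 0" for i
  proof -
    obtain q where "q \<in> Qs (Some i)" using Qs_nonempty by blast
    then have "u \<bullet> (q, shift (Some i)) = 0" by (rule u[OF Qs_subset_tilde])
    then show ?thesis using fst by (cases u) (simp add: shift_def inner_axis)
  qed
  with fst show "u = 0" by (simp add: prod_eq_iff vec_eq_iff)
qed

text \<open>Recession directions of the summands are not listed, as they lie in \<sigma>. A member
  need not span an edge; 0 is left out so that every member spans a ray.\<close>

definition generators :: "'a set \<Rightarrow> ('a \<times> (real ^ 'k)) set" where
  "generators S = (\<lambda>s. (s, 0)) ` (S - {0}) \<union> (\<Union>j. (\<lambda>q. (q, shift j)) ` {q. q extreme_point_of Qs j})"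

lemma finite_generators: "finite S \<Longrightarrow> finite (generators S)"
  unfolding generators_def using finite_polyhedron_extreme_points[OF polyhedron_Qs] by auto

text \<open>A point of \<open>Qs j\<close> is a convex combination of vertices plus a recession
  direction; the latter contributes \<open>(d, 0)\<close> with
  \<open>d \<in> \<sigma>\<close>.\<close>

lemma tilde_cone_generators:
  assumes S: "\<sigma> = convex_cone hull S"
  shows "\<sigma>' = convex_cone hull (generators S)"
proof
  let ?C = "convex_cone hull (generators S)"
  have \<sigma>C: "(s, 0) \<in> ?C" if "s \<in> \<sigma>" for s
  proof -
    have lin: "linear (\<lambda>s::'a. (s, 0 :: real ^ 'k))" by (rule linearI) auto
    have "(\<lambda>s. (s, 0)) ` S \<subseteq> ?C"
    proof (intro image_subsetI)
      fix s assume "s \<in> S"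
      show "(s, 0) \<in> ?C"
      proof (cases "s = 0")
        case True
        then show ?thesis
          using convex_cone_hull_contains_0[of "generators S"] by (simp add: zero_prod_def)
      next
        case False
        then show ?thesis
          using \<open>s \<in> S\<close> by (intro hull_inc) (auto simp: generators_def)
      qed
    qed
    then have "convex_cone hull ((\<lambda>s. (s, 0)) ` S) \<subseteq> ?C"
      by (intro hull_minimal convex_cone_convex_cone_hull)
    moreover have "(s, 0) \<in> (\<lambda>s. (s, 0)) ` (convex_cone hull S)" using that S by blast
    ultimately show ?thesis unfolding convex_cone_hull_linear_image[OF lin] by blast
  qed
  have QC: "(q, shift j) \<in> ?C" if q: "q \<in> Qs j" for q j
  proof -
    obtain y d where yd: "y \<in> convex hull {e. e extreme_point_of Qs j}" "d \<in> recession_cone Q" "q = y + d"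
      using polyhedron_decomposition[OF polyhedron_Qs _ q] recession_pointed unfolding recession_Qs by blast
    have "(y, shift j) \<in> (convex hull {e. e extreme_point_of Qs j}) \<times> {shift j}"
      using yd(1) by simp
    also have "\<dots> = convex hull ({e. e extreme_point_of Qs j} \<times> {shift j})"
      by (simp add: convex_hull_Times)
    also have "\<dots> \<subseteq> ?C"
    proof (rule hull_minimal)
      show "{e. e extreme_point_of Qs j} \<times> {shift j} \<subseteq> ?C"
        by (auto intro!: hull_inc simp: generators_def)
    qed (rule convex_convex_cone_hull)
    finally have "(y, shift j) + (d, 0) \<in> ?C"
      by (intro convex_cone_hull_add \<sigma>C) (use yd(2) recession_Q_subset in auto)
    then show ?thesis using yd(3) by simp
  qed
  show "\<sigma>' \<subseteq> ?C" unfolding tilde_cone_shift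
    by (intro hull_minimal convex_cone_convex_cone_hull) (use \<sigma>C QC in auto)
  have "S \<subseteq> \<sigma>" unfolding S by (rule hull_subset)
  then have "generators S \<subseteq> \<sigma>'"
    using \<sigma>_subset_tilde Qs_subset_tilde by (auto simp: generators_def extreme_point_of_def)
  then show "?C \<subseteq> \<sigma>'" by (intro hull_minimal convex_cone_tilde)
qed

text \<open>
  Since \<open>0 \<notin> Q\<close>, the minimum over \<open>Q\<close> is positive, so it can be distributed as slack among the
  summands.
\<close>

definition minimal_vertex :: "'a \<Rightarrow> ('k option \<Rightarrow> 'a) \<Rightarrow> bool" where
  "minimal_vertex w qs \<longleftrightarrow> (\<forall>x\<in>\<sigma>. x = 0 \<or> w \<bullet> x > 0) \<and> (\<Sum>j\<in>UNIV. qs j) extreme_point_of Q \<and>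
     (\<forall>j. qs j extreme_point_of Qs j) \<and> (\<forall>j. \<forall>x\<in>Qs j. w \<bullet> qs j \<le> w \<bullet> x)"

lemma minimal_vertex_exists: "\<exists>w qs. minimal_vertex w qs"
proof -
  obtain w where w: "\<And>x. x \<in> \<sigma> \<Longrightarrow> x \<noteq> 0 \<Longrightarrow> w \<bullet> x > 0"
    using pos_functional by blast
  have "w \<bullet> d \<ge> 0" if "d \<in> recession_cone Q" for d
    using w[of d] that recession_Q_subset by (cases "d = 0") (auto intro: less_imp_le)
  then obtain qs where "(\<Sum>j\<in>UNIV. qs j) extreme_point_of Q" "\<And>j. qs j extreme_point_of Qs j"
    "\<And>j x. x \<in> Qs j \<Longrightarrow> w \<bullet> qs j \<le> w \<bullet> x"
    using vertex_decomposition[of w] by metis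
  then have "minimal_vertex w qs" using w unfolding minimal_vertex_def by blast
  then show ?thesis by blast
qed

section \<open>Slack functionals and the edges above a minimal vertex\<close>

lemma minimal_vertex_pos:
  assumes "minimal_vertex w qs"
  shows "(\<Sum>j\<in>UNIV. w \<bullet> qs j) > 0"
proof -
  have "(\<Sum>j\<in>UNIV. qs j) \<in> Q"
    using assms by (auto simp: minimal_vertex_def extreme_point_of_def)
  then have "(\<Sum>j\<in>UNIV. qs j) \<in> \<sigma>" "(\<Sum>j\<in>UNIV. qs j) \<noteq> 0"
    using polyhedron_Q(3,4) by auto
  then have "w \<bullet> (\<Sum>j\<in>UNIV. qs j) > 0"
    using assms unfolding minimal_vertex_def by blast
  then show ?thesis by (simp only: inner_sum_right)
qed

text \<open>If the \<open>\<delta> j\<close> add up to the minimum of \<open>w\<close> on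
  \<open>Q\<close>, then \<open>\<delta> j\<close> is the value at \<open>(qs j, shift j)\<close>,
  and so the minimum on \<open>Qs j\<close> lifted by its shift.\<close>

definition slack_functional :: "'a \<Rightarrow> ('k option \<Rightarrow> 'a) \<Rightarrow> ('k option \<Rightarrow> real) \<Rightarrow> 'a \<times> (real ^ 'k)" where
  "slack_functional w qs \<delta> = (w, \<chi> i. \<delta> (Some i) - w \<bullet> qs (Some i))"

lemma slack_functional_inner:
  assumes "(\<Sum>j\<in>UNIV. \<delta> j) = (\<Sum>j\<in>UNIV. w \<bullet> qs j)"
  shows "slack_functional w qs \<delta> \<bullet> (c *\<^sub>R (x, shift j)) = c * (w \<bullet> x - w \<bullet> qs j + \<delta> j)"
proof -
  have "(\<chi> i. \<delta> (Some i) - w \<bullet> qs (Some i)) \<bullet> shift j = \<delta> j - w \<bullet> qs j"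
    by (rule inner_shift) (simp add: sum_subtractf assms)
  moreover have "slack_functional w qs \<delta> \<bullet> (x, shift j)
      = w \<bullet> x + (\<chi> i. \<delta> (Some i) - w \<bullet> qs (Some i)) \<bullet> shift j"
    by (simp add: slack_functional_def)
  ultimately have "slack_functional w qs \<delta> \<bullet> (x, shift j) = w \<bullet> x - w \<bullet> qs j + \<delta> j"
    by simp
  then show ?thesis by (simp only: inner_scaleR_right)
qed

lemma tilde_pos_functional:
  obtains g where "\<And>x. x \<in> \<sigma>' \<Longrightarrow> x \<noteq> 0 \<Longrightarrow> g \<bullet> x > 0"
proof -
  obtain w qs where mv: "minimal_vertex w qs" using minimal_vertex_exists by blast
  \<comment> \<open>Equal slack for all summands, so that the functional is positive on every
    block.\<close>
  define \<mu> where "\<mu> = (\<Sum>j\<in>UNIV. w \<bullet> qs j) / real (CARD('k option))"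
  have card: "real CARD('k option) > 0"
    by (simp only: of_nat_0_less_iff) (rule finite_UNIV_card_ge_0, simp)
  have \<mu>: "\<mu> > 0" "(\<Sum>j\<in>(UNIV :: 'k option set). \<mu>) = (\<Sum>j\<in>UNIV. w \<bullet> qs j)"
    using minimal_vertex_pos[OF mv] card by (simp_all add: \<mu>_def del: card_option)
  define g where "g = slack_functional w qs (\<lambda>_. \<mu>)"
  have "x = 0 \<or> g \<bullet> x > 0" if x: "x \<in> \<sigma>'" for x
    using x unfolding tilde_cone_shift
  proof (rule convex_cone_hull_pos[rotated])
    fix t :: "'a \<times> (real ^ 'k)"
    assume "t \<in> (\<lambda>s. (s, 0)) ` \<sigma> \<union> (\<Union>j. (\<lambda>q. (q, shift j)) ` Qs j)"
    then consider s where "s \<in> \<sigma>" "t = (s, 0)" | q j where "q \<in> Qs j" "t = (q, shift j)"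
      by blast
    then show "t = 0 \<or> g \<bullet> t > 0"
    proof cases
      case 1
      then show ?thesis
        using mv by (auto simp: minimal_vertex_def g_def slack_functional_def zero_prod_def)
    next
      case 2
      then have "g \<bullet> t = w \<bullet> q - w \<bullet> qs j + \<mu>"
        using slack_functional_inner[OF \<mu>(2), of 1 q j] by (simp add: g_def)
      moreover have "w \<bullet> q - w \<bullet> qs j \<ge> 0"
        using mv 2 by (simp add: minimal_vertex_def)
      ultimately show ?thesis using \<mu>(1) by linarith
    qed
  qed
  then show thesis using that by blast
qed

text \<open>With no slack at \<open>j\<close> and positive slack elsewhere, the functional vanishes
  on the extended cone only above the points of \<open>Qs j\<close> where \<open>w\<close> is
  minimal. Extremality of \<open>qs j\<close> then cuts out the ray.\<close>

lemma minimal_vertex_edge: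
  assumes mv: "minimal_vertex w qs"
  shows "convex_cone hull {(qs j, shift j)} \<in> edges \<sigma>'"
proof (rule ray_in_edges)
  show "convex_cone \<sigma>'" by (rule convex_cone_tilde)
  have qsj: "qs j extreme_point_of Qs j" "qs j \<in> Qs j" "\<And>x l. x \<in> Qs l \<Longrightarrow> w \<bullet> qs l \<le> w \<bullet> x"
    using mv by (auto simp: minimal_vertex_def extreme_point_of_def)
  show "(qs j, shift j) \<in> \<sigma>'" by (rule Qs_subset_tilde[OF qsj(2)])
  show "(qs j, shift j) \<noteq> 0" using shift_nonzero by (auto simp: zero_prod_def)
  \<comment> \<open>The minimum is shared by the summands other than \<open>j\<close>, which are
    \<open>CARD('k)\<close> in number.\<close>
  define \<mu> where "\<mu> = (\<Sum>j\<in>UNIV. w \<bullet> qs j) / real CARD('k)"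
  define \<delta> where "\<delta> l = (if l = j then 0 else \<mu>)" for l
  have \<mu>: "\<mu> > 0" using minimal_vertex_pos[OF mv] by (simp add: \<mu>_def)
  have "(\<Sum>l\<in>UNIV. \<delta> l) = \<delta> j + (\<Sum>l\<in>UNIV - {j}. \<delta> l)"
    by (rule sum.remove) auto
  also have "\<dots> = (\<Sum>l\<in>UNIV - {j}. \<mu>)" by (simp add: \<delta>_def)
  also have "\<dots> = (\<Sum>j\<in>UNIV. w \<bullet> qs j)"
    by (simp add: \<mu>_def card_Diff_singleton)
  finally have \<delta>: "(\<Sum>l\<in>UNIV. \<delta> l) = (\<Sum>j\<in>UNIV. w \<bullet> qs j)" .
  define g where "g = slack_functional w qs \<delta>"
  note g_inner = slack_functional_inner[OF \<delta>, folded g_def]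
  \<comment> \<open>\<open>w\<close> may attain its minimum on \<open>Qs j\<close> at several
    points, so the zero set of \<open>g\<close> can be larger than the ray.\<close>
  define face where "face x \<longleftrightarrow> (\<exists>a\<ge>0. \<exists>p\<in>Qs j. x = a *\<^sub>R (p, shift j) \<and> w \<bullet> p = w \<bullet> qs j)" for x
  have g_face: "g \<bullet> x = 0" if "face x" for x
    using that g_inner by (auto simp: face_def \<delta>_def)
  have face_0: "face 0"
    unfolding face_def by (intro exI[of _ 0] conjI bexI[of _ "qs j"]) (use qsj(2) in \<open>simp_all add: zero_prod_def\<close>)
  have face_add: "face (x + y)" if face_xy: "face x" "face y" for x y
  proof -
    obtain a p b r where *: "a \<ge> 0" "p \<in> Qs j" "x = a *\<^sub>R (p, shift j)" "w \<bullet> p = w \<bullet> qs j"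
      "b \<ge> 0" "r \<in> Qs j" "y = b *\<^sub>R (r, shift j)" "w \<bullet> r = w \<bullet> qs j"
      using face_xy unfolding face_def by blast
    show ?thesis
    proof (cases "a + b = 0")
      case True
      then have "b = 0" using *(1,5) by linarith
      then have "y = 0" using *(7) by (simp add: zero_prod_def)
      then show ?thesis using face_xy by simp
    next
      case False
      then have ab: "a + b > 0" using * by linarith
      define c where "c = b / (a + b)"
      have c: "0 \<le> c" "c \<le> 1" "(a + b) * (1 - c) = a" "(a + b) * c = b"
        using ab * by (auto simp: c_def field_simps)
      define z where "z = (1 - c) *\<^sub>R p + c *\<^sub>R r"
      have "z \<in> Qs j" unfolding z_def by (rule convexD_alt[OF convex_Qs *(2,6) c(1,2)])
      moreover have "w \<bullet> z = w \<bullet> qs j"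
        by (simp add: z_def inner_add_right *(4,8) algebra_simps)
      moreover have "x + y = (a + b) *\<^sub>R (z, shift j)"
        by (simp add: z_def *(3,7) scaleR_add_right c(3,4) scaleR_add_left)
      ultimately show ?thesis unfolding face_def using ab by (intro exI[of _ "a + b"]) auto
    qed
  qed
  have K: "g \<bullet> x > 0 \<or> face x" if x: "x \<in> \<sigma>'" for x
  proof -
    have "convex_cone {x. g \<bullet> x > 0 \<or> face x}"
    proof (rule convex_cone_iff[THEN iffD2], intro conjI ballI allI impI)
      show "0 \<in> {x. g \<bullet> x > 0 \<or> face x}" using face_0 by simp
      fix x assume x: "x \<in> {x. g \<bullet> x > 0 \<or> face x}"
      show "x + y \<in> {x. g \<bullet> x > 0 \<or> face x}" if "y \<in> {x. g \<bullet> x > 0 \<or> face x}" for y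
        using x that g_face[of x] g_face[of y] face_add[of x y] by (auto simp: inner_add_right)
      fix c :: real assume c: "0 \<le> c"
      have "face (c *\<^sub>R x)" if "face x"
      proof -
        obtain a p where "a \<ge> 0" "p \<in> Qs j" "x = a *\<^sub>R (p, shift j)" "w \<bullet> p = w \<bullet> qs j"
          using \<open>face x\<close> unfolding face_def by blast
        then show ?thesis unfolding face_def using c by (intro exI[of _ "c * a"]) auto
      qed
      moreover have "face (c *\<^sub>R x)" if "c = 0" using face_0 that by simp
      ultimately show "c *\<^sub>R x \<in> {x. g \<bullet> x > 0 \<or> face x}"
        using x c by (cases "c = 0") auto
    qed
    then have "\<sigma>' \<subseteq> {x. g \<bullet> x > 0 \<or> face x}" unfolding tilde_cone_shift
    proof (intro hull_minimal Un_least UN_least image_subsetI CollectI)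
      fix s assume s: "s \<in> \<sigma>"
      show "g \<bullet> (s, 0) > 0 \<or> face (s, 0)"
      proof (cases "s = 0")
        case True
        then show ?thesis using face_0 by (simp add: zero_prod_def)
      next
        case False
        then show ?thesis using mv s by (auto simp: minimal_vertex_def g_def slack_functional_def)
      qed
    next
      fix l q assume q: "q \<in> Qs l"
      have "g \<bullet> (q, shift l) = w \<bullet> q - w \<bullet> qs l + \<delta> l"
        using g_inner[of 1 q l] by simp
      moreover have "w \<bullet> qs l \<le> w \<bullet> q" by (rule qsj(3)[OF q])
      moreover have "face (q, shift l)" if "l = j" "w \<bullet> q = w \<bullet> qs l"
        unfolding face_def using q that by (intro exI[of _ 1]) auto
      ultimately show "g \<bullet> (q, shift l) > 0 \<or> face (q, shift l)"
        using \<mu> by (cases "l = j"; cases "w \<bullet> q = w \<bullet> qs l") (auto simp: \<delta>_def)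
    qed
    with x show ?thesis by blast
  qed
  fix x y assume xy: "x \<in> \<sigma>'" "y \<in> \<sigma>'" "x + y \<in> convex_cone hull {(qs j, shift j)}"
  obtain c where c: "c \<ge> 0" "x + y = c *\<^sub>R (qs j, shift j)"
    using xy(3) by (auto simp: mem_ray)
  have "g \<bullet> (x + y) = 0" unfolding c(2) g_inner by (simp add: \<delta>_def)
  then have "face x" "face y"
    using K[OF xy(1)] K[OF xy(2)] g_face[of x] g_face[of y] by (auto simp: inner_add_right)
  then obtain a p b r where *: "a \<ge> 0" "p \<in> Qs j" "x = a *\<^sub>R (p, shift j)"
      "b \<ge> 0" "r \<in> Qs j" "y = b *\<^sub>R (r, shift j)" unfolding face_def by blast
  show "x \<in> convex_cone hull {(qs j, shift j)}"
  proof (cases "a = 0 \<or> b = 0")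
    case True
    then have "x = 0 \<or> x = x + y" using *(3,6) by (auto simp: zero_prod_def)
    then show ?thesis using xy(3) convex_cone_hull_contains_0 by metis
  next
    case False
    then have ab: "a > 0" "b > 0" using * by auto
    \<comment> \<open>The second components fix \<open>c = a + b\<close>, which exhibits
      \<open>qs j\<close> as a convex combination of \<open>p\<close> and \<open>r\<close> with
      positive weights.\<close>
    have "(a + b) *\<^sub>R shift j = c *\<^sub>R shift j" and eq: "a *\<^sub>R p + b *\<^sub>R r = c *\<^sub>R qs j"
      using c(2) *(3,6) by (simp_all add: scaleR_add_left)
    then have cab: "c = a + b" using shift_nonzero[of j] by simp
    have "qs j = (1 / c) *\<^sub>R (a *\<^sub>R p + b *\<^sub>R r)"
      unfolding eq using cab ab by simp
    also have "\<dots> = (a / c) *\<^sub>R p + (b / c) *\<^sub>R r" by (simp add: scaleR_add_right)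
    also have "a / c = 1 - b / c" using cab ab by (simp add: field_simps)
    finally have "qs j = (1 - b / c) *\<^sub>R p + (b / c) *\<^sub>R r" .
    moreover have "0 < b / c" "b / c < 1" using cab ab by simp_all
    ultimately have "p \<noteq> r \<Longrightarrow> qs j \<in> open_segment p r"
      unfolding in_segment by blast
    then have "p = r" using qsj(1) *(2,5) unfolding extreme_point_of_def by blast
    then have "c *\<^sub>R p = c *\<^sub>R qs j" using eq cab by (simp add: scaleR_add_left)
    then have "p = qs j" using cab ab by simp
    then show ?thesis using * by (auto simp: mem_ray)
  qed
qed

text \<open>Every edge is the ray of one of the \<open>generators\<close>. In the second case
  integrality of the shift component makes the primitive generator a natural multiple of
  \<open>(q, shift j)\<close>.\<close>

lemma edge_primitive_generator:
  assumes "\<xi> \<in> edges \<sigma>'"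
  obtains (cone) s where "primitive_generator N' \<xi> = (s, 0)" "(s, 0) \<in> N'" "\<xi> = convex_cone hull {(s, 0)}" "s \<noteq> 0"
  | (summand) j and q and m :: nat where "primitive_generator N' \<xi> = of_nat m *\<^sub>R (q, shift j)" "m > 0"
    "q extreme_point_of Qs j" "of_nat m *\<^sub>R (q, shift j) \<in> N'" "\<xi> = convex_cone hull {of_nat m *\<^sub>R (q, shift j)}"
    "q \<in> N \<Longrightarrow> m = 1"
proof -
  note disc = discrete_subgroup_ext_lattice[OF lattice_N]
  obtain S where S: "finite S" "S \<subseteq> N" "\<sigma> = convex_cone hull S"
    by (rule \<sigma>_generators)
  have gen: "\<sigma>' = convex_cone hull (generators S)" by (rule tilde_cone_generators[OF S(3)])
  obtain g where g: "\<And>x. x \<in> \<sigma>' \<Longrightarrow> x \<noteq> 0 \<Longrightarrow> g \<bullet> x > 0"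
    using tilde_pos_functional by blast
  have nz: "t \<noteq> 0" if "t \<in> generators S" for t
    using that shift_nonzero[where 'k = 'k] by (auto simp: generators_def zero_prod_def)
  have pos: "g \<bullet> t > 0" if "t \<in> generators S" for t
    by (rule g) (use nz that gen in \<open>auto intro: hull_inc\<close>)
  obtain t where t: "t \<in> generators S" "\<xi> = convex_cone hull {t}"
    using edges_subset_rays[OF pos, of "generators S" \<xi>] assms unfolding gen by blast
  have ray: "convex_cone hull {c *\<^sub>R x} = convex_cone hull {x}" if "c > 0" for c and x :: "'a \<times> (real ^ 'k)"
  proof (intro equalityI subsetI)
    fix y assume "y \<in> convex_cone hull {x}"
    then obtain d where "d \<ge> 0" "y = d *\<^sub>R x" by (auto simp: mem_ray)
    then show "y \<in> convex_cone hull {c *\<^sub>R x}"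
      unfolding mem_ray using that by (intro exI[of _ "d / c"]) auto
  next
    fix y assume "y \<in> convex_cone hull {c *\<^sub>R x}"
    then obtain d where "d \<ge> 0" "y = d *\<^sub>R c *\<^sub>R x" by (auto simp: mem_ray)
    then show "y \<in> convex_cone hull {x}"
      unfolding mem_ray using that by (intro exI[of _ "d * c"]) auto
  qed
  from t(1) consider s where "s \<in> S" "s \<noteq> 0" "t = (s, 0)" | j q where "q extreme_point_of Qs j" "t = (q, shift j)"
    by (auto simp: generators_def)
  then show thesis
  proof cases
    case 1
    have "t \<in> N'" using 1 S(2) by (auto simp: ext_lattice_def)
    then obtain v and m :: nat where v: "primitive_generator N' \<xi> = v" "v \<in> N'" "v \<noteq> 0" "m > 0" "t = of_nat m *\<^sub>R v"
      using primitive_generator_ray[OF disc, of t] nz[OF t(1)] t(2) by metis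
    have "snd v = 0"
      using v(4,5) 1(3) by (metis of_nat_0_less_iff less_irrefl scaleR_eq_0_iff snd_conv snd_scaleR)
    then have v': "v = (fst v, 0)" by (simp add: prod_eq_iff)
    show thesis
    proof (rule cone)
      show "primitive_generator N' \<xi> = (fst v, 0)" "(fst v, 0) \<in> N'" using v v' by simp_all
      show "\<xi> = convex_cone hull {(fst v, 0)}" using t(2) ray[of "of_nat m" v] v(4,5) v' by simp
      show "fst v \<noteq> 0" using v(3) v' by (metis zero_prod_def)
    qed
  next
    case 2
    have main: "\<exists>m::nat. m > 0 \<and> primitive_generator N' \<xi> = of_nat m *\<^sub>R (q, shift j) \<and>
        of_nat m *\<^sub>R (q, shift j) \<in> N' \<and> (l = 1 \<longrightarrow> m = 1)"
      if l: "l > 0" "of_nat l *\<^sub>R q \<in> N" for l :: nat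
    proof -
      have shiftZ: "shift j $ i \<in> \<int>" for i
        by (cases j) (auto simp: shift_def axis_def intro!: Ints_sum)
      have lt: "of_nat l *\<^sub>R t \<in> N'"
        using l(2) shiftZ by (auto simp: 2 ext_lattice_def intro!: Ints_mult)
      have "of_nat l *\<^sub>R t \<noteq> 0" using nz[OF t(1)] l(1) by simp
      then obtain v and n :: nat where v: "primitive_generator N' \<xi> = v" "v \<in> N'" "n > 0" "of_nat l *\<^sub>R t = of_nat n *\<^sub>R v"
        using primitive_generator_ray[OF disc lt] ray[of "of_nat l" t] t(2) l(1) by (metis of_nat_0_less_iff)
      define c where "c = real l / real n"
      have "(1 / real n) *\<^sub>R (of_nat l *\<^sub>R t) = v" unfolding v(4) using v(3) by simp
      then have vc: "v = c *\<^sub>R t" by (simp add: c_def)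
      have "\<forall>i. (c *\<^sub>R shift j) $ i \<in> \<int>"
        using v(2) unfolding vc 2(2) by (auto simp: ext_lattice_def)
      then have "c \<in> \<int>" by (rule integral_multiple_of_shift)
      moreover have c0: "c > 0" using l(1) v(3) by (simp add: c_def)
      ultimately obtain m :: nat where m: "c = of_nat m"
        by (metis Ints_cases less_imp_le of_int_0_le_iff of_int_of_nat_eq zero_le_imp_eq_int)
      \<comment> \<open>If \<open>(q, shift j)\<close> is a lattice point itself, then
        \<open>c = 1 / n\<close> is a natural number only for \<open>n = 1\<close>.\<close>
      have "m = 1" if "l = 1"
      proof -
        have "real m * real n = 1" using m that v(3) by (simp add: c_def field_simps)
        then have "m * n = 1" by (metis of_nat_eq_1_iff of_nat_mult)
        then show ?thesis by simp
      qed
      then show ?thesis using m c0 v(1,2) vc 2(2) by (intro exI[of _ m]) auto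
    qed
    obtain l :: nat where l: "l > 0" "of_nat l *\<^sub>R q \<in> N" "q \<in> N \<Longrightarrow> l = 1"
    proof (cases "q \<in> N")
      case True
      then show ?thesis using that[of 1] by simp
    next
      case False
      then show ?thesis using extreme_point_Qs_rational[OF 2(1)] that by metis
    qed
    obtain m :: nat where m: "m > 0 \<and> primitive_generator N' \<xi> = of_nat m *\<^sub>R (q, shift j) \<and>
        of_nat m *\<^sub>R (q, shift j) \<in> N' \<and> (l = 1 \<longrightarrow> m = 1)"
      using main[OF l(1,2)] by (rule exE)
    show thesis
    proof (rule summand)
      show "primitive_generator N' \<xi> = of_nat m *\<^sub>R (q, shift j)" "m > 0"
        "of_nat m *\<^sub>R (q, shift j) \<in> N'"
        by (rule m[THEN conjunct2, THEN conjunct1] m[THEN conjunct1] m[THEN conjunct2, THEN conjunct2, THEN conjunct1])+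
      show "q extreme_point_of Qs j" by (rule 2)
      show "\<xi> = convex_cone hull {of_nat m *\<^sub>R (q, shift j)}"
        using m t(2) 2(2) by (subst ray) auto
      show "m = 1" if "q \<in> N" using m l(3)[OF that] by blast
    qed
  qed
qed

lemma dual_cone_lift:
  assumes u: "u \<in> dual_cone \<sigma>" "u \<in> dual_lattice N"
  obtains c where "(u, c) \<in> dual_cone \<sigma>'" "(u, c) \<in> dual_lattice N'"
proof -
  have u_nonneg: "u \<bullet> s \<ge> 0" if "s \<in> \<sigma>" for s
    using u(1) that by (simp add: dual_cone_def)
  obtain qs where qs: "(\<Sum>j\<in>UNIV. qs j) extreme_point_of Q" "\<And>j. qs j extreme_point_of Qs j"
    "\<And>j x. x \<in> Qs j \<Longrightarrow> u \<bullet> qs j \<le> u \<bullet> x"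
    using vertex_decomposition[of u] u_nonneg recession_Q_subset by blast
  obtain j\<^sub>0 where j\<^sub>0: "\<And>j. j \<noteq> j\<^sub>0 \<Longrightarrow> qs j \<in> N"
    using almost_integral[OF qs(1,2)] by blast
  define fl where "fl j = \<lfloor>u \<bullet> qs j\<rfloor>" for j
  have int: "u \<bullet> qs j = of_int (fl j)" if "j \<noteq> j\<^sub>0" for j
  proof -
    have "u \<bullet> qs j \<in> \<int>"
      using u(2) j\<^sub>0[OF that] by (simp add: dual_lattice_def)
    then show ?thesis by (simp add: fl_def)
  qed
  have "(\<Sum>j\<in>UNIV. qs j) \<in> \<sigma>"
    using qs(1) polyhedron_Q(3) by (auto simp: extreme_point_of_def)
  then have "0 \<le> (\<Sum>j\<in>UNIV. u \<bullet> qs j)"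
    using u_nonneg by (simp flip: inner_sum_right)
  also have "\<dots> = u \<bullet> qs j\<^sub>0 + (\<Sum>j\<in>UNIV - {j\<^sub>0}. u \<bullet> qs j)"
    by (rule sum.remove) auto
  also have "(\<Sum>j\<in>UNIV - {j\<^sub>0}. u \<bullet> qs j) = of_int (\<Sum>j\<in>UNIV - {j\<^sub>0}. fl j)"
    using int by simp
  \<comment> \<open>An integer below a real number is below its floor; as the other values are
    integers, the one at \<open>j\<^sub>0\<close> can be rounded without making the sum
    negative.\<close>
  finally have "- (\<Sum>j\<in>UNIV - {j\<^sub>0}. fl j) \<le> fl j\<^sub>0"
    unfolding fl_def le_floor_iff by simp
  moreover have "(\<Sum>j\<in>UNIV. fl j) = fl j\<^sub>0 + (\<Sum>j\<in>UNIV - {j\<^sub>0}. fl j)"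
    by (rule sum.remove) auto
  ultimately have fl_sum: "(\<Sum>j\<in>UNIV. fl j) \<ge> 0" by simp
  \<comment> \<open>The negated floors, with their nonnegative surplus returned at
    \<open>None\<close> to reach sum 0; adding it only helps the inequality there.\<close>
  define f where "f j = - of_int (fl j) + (case j of None \<Rightarrow> of_int (\<Sum>j\<in>UNIV. fl j) | Some _ \<Rightarrow> (0 :: real))" for j
  have "(\<Sum>j\<in>UNIV. f j) = 0" by (simp add: sum_UNIV_option f_def sum_negf)
  moreover have "u \<bullet> x + f j \<ge> 0" if x: "x \<in> Qs j" for j x
  proof -
    have "of_int (fl j) \<le> u \<bullet> qs j" by (simp add: fl_def)
    moreover have "f j \<ge> - of_int (fl j)"
    proof -
      have "real_of_int (\<Sum>j\<in>UNIV. fl j) \<ge> 0"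
        using fl_sum by (simp only: of_int_0_le_iff)
      then have "(case j of None \<Rightarrow> of_int (\<Sum>j\<in>UNIV. fl j) | Some _ \<Rightarrow> (0 :: real)) \<ge> 0"
        by (cases j) (simp_all only: option.case order_refl)
      then show ?thesis unfolding f_def by linarith
    qed
    ultimately show ?thesis using qs(3)[OF x] by linarith
  qed
  ultimately have "(u, \<chi> i. f (Some i)) \<in> dual_cone \<sigma>'"
    by (intro dual_tilde_coneI) (use u_nonneg in auto)
  moreover have "(u, \<chi> i. f (Some i)) \<in> dual_lattice N'"
    using u(2) by (simp add: dual_ext_lattice[OF lattice_N] f_def)
  ultimately show thesis using that by blast
qed

end

section \<open>The binomials of the extended cone\<close>

lemma single_power: "single a (1::complex) ^ n = single (\<Sum>t<n. a) 1"
  by (induction n) (auto simp: mult_single add.commute)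

lemma prod_cox_var_power:
  "finite A \<Longrightarrow> (\<Prod>\<xi>\<in>A. cox_var \<xi> ^ n \<xi>) = single (\<Sum>\<xi>\<in>A. single \<xi> (n \<xi>)) 1"
proof (induction A rule: finite_induct)
  case (insert \<xi> A)
  have "(\<Sum>t<n \<xi>. single \<xi> (1::nat)) = single \<xi> (n \<xi>)"
    by (rule poly_mapping_eqI) (simp add: lookup_sum lookup_single when_def)
  then show ?case using insert by (simp add: cox_var_def single_power mult_single)
qed simp

lemma lookup_sum_single:
  fixes n :: "'x \<Rightarrow> nat"
  assumes "finite A"
  shows "lookup (\<Sum>\<xi>\<in>A. single \<xi> (n \<xi>)) \<eta> = (if \<eta> \<in> A then n \<eta> else 0)"
  using assms by (simp add: lookup_sum lookup_single when_def)

text \<open>Distinct shifts lie on distinct rays: the family with 1 at \<open>j\<close> and -1 at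
  \<open>l\<close> pairs with them with opposite signs. So a ray determines its summand.\<close>

lemma shift_nonneg_multiple:
  assumes "shift j = a *\<^sub>R (shift l :: real ^ 'k::finite)" "a \<ge> 0"
  shows "l = j \<and> a = 1"
proof -
  have "l = j"
  proof (rule ccontr)
    assume lj: "l \<noteq> j"
    define f :: "'k option \<Rightarrow> real" where "f i = of_bool (i = j) - of_bool (i = l)" for i
    have "(\<Sum>i\<in>UNIV. f i) = 0" by (simp add: f_def sum_subtractf of_bool_def)
    then have "f j = a * f l" using inner_shift[of f j] inner_shift[of f l] assms(1) by simp
    then show False using lj assms(2) by (simp add: f_def)
  qed
  moreover from this have "(1 - a) *\<^sub>R shift j = 0"
    using assms(1) by (simp add: algebra_simps)
  ultimately show ?thesis using shift_nonzero[of j] by simp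
qed

context minkowski_data
begin

abbreviation E where "E \<equiv> edges \<sigma>'"
abbreviation v where "v \<equiv> primitive_generator N'"

definition weight :: "'k \<Rightarrow> ('a \<times> (real ^ 'k)) set \<Rightarrow> int" where
  "weight i \<xi> = pairing (dual_basis_vector i) (v \<xi>)"

lemma edge_generator:
  assumes "\<xi> \<in> E"
  shows "v \<xi> \<in> N'" "\<xi> = convex_cone hull {v \<xi>}"
  using assms by (cases rule: edge_primitive_generator[OF assms]; simp)+

lemma edge_generator_mem: "\<xi> \<in> E \<Longrightarrow> v \<xi> \<in> \<sigma>'"
  using edge_generator(2)[of \<xi>] face_of_imp_subset[of \<xi> \<sigma>'] hull_inc[of "v \<xi>" "{v \<xi>}"]
  by (auto simp: edges_def edge_of_def)

lemma pairing_edge: "\<xi> \<in> E \<Longrightarrow> u \<in> dual_lattice N' \<Longrightarrow> of_int (pairing u (v \<xi>)) = u \<bullet> v \<xi>"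
  using edge_generator(1)[of \<xi>] by (simp add: pairing_def dual_lattice_def)

lemma generating_set:
  obtains T where "finite T" "\<sigma>' = convex_cone hull T" "\<And>t. t \<in> T \<Longrightarrow> t \<noteq> 0"
proof -
  obtain S where S: "finite S" "\<sigma> = convex_cone hull S" using \<sigma>_generators by metis
  show thesis
  proof (rule that)
    show "finite (generators S)" by (rule finite_generators[OF S(1)])
    show "\<sigma>' = convex_cone hull (generators S)" by (rule tilde_cone_generators[OF S(2)])
    show "t \<noteq> 0" if "t \<in> generators S" for t
      using that shift_nonzero[where 'k = 'k] by (auto simp: generators_def zero_prod_def)
  qed
qed

lemma finite_E: "finite E"
  and tilde_cone_edges: "\<sigma>' = convex_cone hull (v ` E)"
proof -
  obtain T where T: "finite T" "\<sigma>' = convex_cone hull T" "\<And>t. t \<in> T \<Longrightarrow> t \<noteq> 0"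
    using generating_set by blast
  obtain g where g: "\<And>x. x \<in> \<sigma>' \<Longrightarrow> x \<noteq> 0 \<Longrightarrow> g \<bullet> x > 0"
    using tilde_pos_functional by blast
  have pos: "g \<bullet> t > 0" if "t \<in> T" for t
    by (rule g) (use T that in \<open>auto intro: hull_inc\<close>)
  have "E \<subseteq> (\<lambda>t. convex_cone hull {t}) ` T"
  proof
    fix \<xi> assume "\<xi> \<in> E"
    then have "\<xi> \<in> edges (convex_cone hull T)" unfolding T(2) .
    then obtain t where "t \<in> T" "\<xi> = convex_cone hull {t}"
      using edges_subset_rays[of T g \<xi>, OF pos] by blast
    then show "\<xi> \<in> (\<lambda>t. convex_cone hull {t}) ` T" by blast
  qed
  then show "finite E" using T(1) finite_surj by blast
  have "{t \<in> T. convex_cone hull {t} \<in> E} \<subseteq> convex_cone hull (v ` E)"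
  proof safe
    fix t assume t: "convex_cone hull {t} \<in> E"
    have "t \<in> convex_cone hull {t}" by (simp add: hull_inc)
    then obtain c where c: "c \<ge> 0" "t = c *\<^sub>R v (convex_cone hull {t})"
      using edge_generator(2)[OF t] by (metis mem_ray)
    have "v (convex_cone hull {t}) \<in> convex_cone hull (v ` E)" using t by (intro hull_inc) blast
    then show "t \<in> convex_cone hull (v ` E)" using convex_cone_hull_mul[OF _ c(1)] c(2) by metis
  qed
  then have "convex_cone hull {t \<in> T. convex_cone hull {t} \<in> E} \<subseteq> convex_cone hull (v ` E)"
    by (intro hull_minimal convex_cone_convex_cone_hull)
  then have "\<sigma>' \<subseteq> convex_cone hull (v ` E)"
    using convex_cone_hull_edges[OF T(1) pos] unfolding T(2) by blast
  moreover have "convex_cone hull (v ` E) \<subseteq> \<sigma>'"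
    by (intro hull_minimal convex_cone_tilde) (use edge_generator_mem in blast)
  ultimately show "\<sigma>' = convex_cone hull (v ` E)" by blast
qed

lemma dual_cone_edges: "u \<in> dual_cone \<sigma>' \<longleftrightarrow> (\<forall>\<xi>\<in>E. 0 \<le> u \<bullet> v \<xi>)"
proof
  assume u: "\<forall>\<xi>\<in>E. 0 \<le> u \<bullet> v \<xi>"
  show "u \<in> dual_cone \<sigma>'" unfolding dual_cone_def
  proof (intro CollectI ballI)
    fix x assume "x \<in> \<sigma>'"
    then have "x \<in> convex_cone hull (v ` E)" using tilde_cone_edges by simp
    then show "0 \<le> u \<bullet> x" by (rule convex_cone_hull_nonneg[rotated]) (use u in auto)
  qed
qed (use edge_generator_mem in \<open>auto simp: dual_cone_def\<close>)

text \<open>The primitive generators generate the extended cone, which spans the whole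
  space.\<close>

lemma edges_separate:
  assumes "\<And>\<xi>. \<xi> \<in> E \<Longrightarrow> u \<bullet> v \<xi> = 0"
  shows "u = 0"
proof (rule tilde_cone_full)
  have "u \<in> dual_cone \<sigma>'" "- u \<in> dual_cone \<sigma>'"
    using assms by (simp_all add: dual_cone_edges)
  then show "u \<bullet> x = 0" if "x \<in> \<sigma>'" for x
    using that by (force simp: dual_cone_def)
qed

lemma weight_eq: "\<xi> \<in> E \<Longrightarrow> of_int (weight i \<xi>) = snd (v \<xi>) $ i"
proof -
  assume \<xi>: "\<xi> \<in> E"
  have "(0 :: 'a) \<in> dual_lattice N" "\<forall>l. axis i (1 :: real) $ l \<in> \<int>"
    by (simp_all add: dual_lattice_def axis_def)
  then have "dual_basis_vector i \<in> dual_lattice N'"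
    by (simp add: dual_basis_vector_def dual_ext_lattice[OF lattice_N])
  then have "of_int (weight i \<xi>) = dual_basis_vector i \<bullet> v \<xi>"
    unfolding weight_def by (rule pairing_edge[OF \<xi>])
  then show ?thesis by (cases "v \<xi>") (simp add: dual_basis_vector_def inner_axis')
qed

text \<open>The weights of an edge are the coordinates of a multiple of a shift or of 0. Hence all
  binomials share their negative monomial, and distinct blocks involve distinct variables.\<close>

lemma edge_weights:
  assumes "\<xi> \<in> E"
  obtains (zero) "\<And>i. weight i \<xi> = 0"
  | (none) m :: nat where "m > 0" "\<And>i. weight i \<xi> = - int m"
  | (some) j and m :: nat where "m > 0" "\<And>i. weight i \<xi> = (if i = j then int m else 0)"
  using assms
proof (cases rule: edge_primitive_generator)
  case (cone s)
  have "weight i \<xi> = 0" for i using weight_eq[OF assms, of i] cone(1) by simp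
  then show thesis by (rule zero)
next
  case (summand j q m)
  have w: "real_of_int (weight i \<xi>) = real m * shift j $ i" for i
    using weight_eq[OF assms, of i] summand(1) by simp
  show thesis
  proof (cases j)
    case None
    have "(\<Sum>i'\<in>UNIV. axis i' 1 $ i) = (1 :: real)" for i :: 'k by (simp add: axis_def)
    then have "real_of_int (weight i \<xi>) = real_of_int (- int m)" for i
      using w[of i] None by (simp add: shift_def)
    then show thesis using none[OF summand(2)] by (simp only: of_int_eq_iff)
  next
    case (Some l)
    have "real_of_int (weight i \<xi>) = real_of_int (if i = l then int m else 0)" for i
      using w[of i] Some by (simp add: shift_def axis_def)
    then show thesis using some[OF summand(2)] by (simp only: of_int_eq_iff)
  qed
qed

text \<open>
  The index \<open>SOME i. True\<close> is immaterial: by \<open>edge_weights\<close>, the negative part of \<open>weight i\<close> does not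
  depend on \<open>i\<close>.
\<close>

definition block_weight :: "'k option \<Rightarrow> ('a \<times> (real ^ 'k)) set \<Rightarrow> nat" where
  "block_weight j \<xi> = (case j of None \<Rightarrow> nat (- weight (SOME i. True) \<xi>) | Some i \<Rightarrow> nat (weight i \<xi>))"

text \<open>The exponent of the monomial \<open>y\<^sub>j\<close>.\<close>

definition block :: "'k option \<Rightarrow> ('a \<times> (real ^ 'k)) set \<Rightarrow>\<^sub>0 nat" where
  "block j = (\<Sum>\<xi>\<in>E. single \<xi> (block_weight j \<xi>))"

lemma lookup_block: "lookup (block j) \<xi> = (if \<xi> \<in> E then block_weight j \<xi> else 0)"
  unfolding block_def by (rule lookup_sum_single[OF finite_E])

lemma block_weight_None: "\<xi> \<in> E \<Longrightarrow> block_weight None \<xi> = nat (- weight i \<xi>)"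
  by (erule edge_weights) (auto simp: block_weight_def)

lemma weight_blocks: "\<xi> \<in> E \<Longrightarrow> weight i \<xi> = int (block_weight (Some i) \<xi>) - int (block_weight None \<xi>)"
  by (simp add: block_weight_None[of \<xi> i]) (simp add: block_weight_def)

lemma block_weight_disjoint:
  assumes "\<xi> \<in> E" "i \<noteq> j"
  shows "block_weight i \<xi> = 0 \<or> block_weight j \<xi> = 0" using assms(1)
  by (cases rule: edge_weights; cases i; cases j) (use assms(2) in \<open>auto simp: block_weight_def\<close>)

text \<open>The edge through \<open>(qs j, shift j)\<close> lies in block \<open>j\<close>, and its
  weight there is the multiplicity of its primitive generator.\<close>

lemma minimal_vertex_weight:
  assumes "minimal_vertex w qs"
  obtains \<xi> where "\<xi> \<in> E" "block_weight j \<xi> > 0" "qs j \<in> N \<Longrightarrow> block_weight j \<xi> = 1"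
proof -
  define \<xi> where "\<xi> = convex_cone hull {(qs j, shift j)}"
  have \<xi>: "\<xi> \<in> E" unfolding \<xi>_def by (rule minimal_vertex_edge[OF assms])
  have mem: "(qs j, shift j) \<in> \<xi>" unfolding \<xi>_def by (simp add: hull_inc)
  have "\<exists>m::nat. m > 0 \<and> v \<xi> = of_nat m *\<^sub>R (qs j, shift j) \<and> (qs j \<in> N \<longrightarrow> m = 1)"
    using \<xi>
  proof (cases rule: edge_primitive_generator)
    case (cone s)
    then have "shift j = 0" using mem by (auto simp: mem_ray)
    then show ?thesis using shift_nonzero[of j] by simp
  next
    case (summand l q m)
    obtain c where c: "c \<ge> 0" "(qs j, shift j) = c *\<^sub>R of_nat m *\<^sub>R (q, shift l)"
      using mem unfolding summand(5) mem_ray by blast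
    then have lj: "l = j \<and> c * of_nat m = 1" by (intro shift_nonneg_multiple) auto
    then have "q = qs j" using c(2) by simp
    then show ?thesis using summand(1,2,6) lj by (intro exI[of _ m] conjI impI) auto
  qed
  then obtain m :: nat where m: "m > 0 \<and> v \<xi> = of_nat m *\<^sub>R (qs j, shift j) \<and> (qs j \<in> N \<longrightarrow> m = 1)"
    by (rule exE)
  have w: "real_of_int (weight i \<xi>) = real m * shift j $ i" for i
    using weight_eq[OF \<xi>, of i] m by simp
  have "block_weight j \<xi> = m"
  proof (cases j)
    case None
    have "(\<Sum>i'\<in>UNIV. axis i' 1 $ i) = (1 :: real)" for i :: 'k by (simp add: axis_def)
    then have "real_of_int (weight i \<xi>) = real_of_int (- int m)" for i
      using w[of i] None by (simp add: shift_def)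
    then have "weight i \<xi> = - int m" for i by (simp only: of_int_eq_iff)
    then show ?thesis using None by (simp add: block_weight_def)
  next
    case (Some i)
    have "real_of_int (weight i \<xi>) = real_of_int (int m)"
      using w[of i] Some by (simp add: shift_def axis_def)
    then show ?thesis using Some by (simp add: block_weight_def)
  qed
  then show thesis using that[OF \<xi>] m by blast
qed

sublocale cox: binomial_data E block None
proof
  show "finite E" by (rule finite_E)
  show "keys (block j) \<subseteq> E" for j
    by (auto simp: in_keys_iff lookup_block split: if_splits)
  show "keys (block i) \<inter> keys (block j) = {}" if "i \<noteq> j" for i j
    using block_weight_disjoint[OF _ that] by (fastforce simp: in_keys_iff lookup_block split: if_splits)
  obtain w qs where mv: "minimal_vertex w qs" using minimal_vertex_exists by blast
  show "block j \<noteq> 0" for j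
  proof
    assume "block j = 0"
    moreover obtain \<xi> where "\<xi> \<in> E" "block_weight j \<xi> > 0"
      using minimal_vertex_weight[OF mv] by metis
    ultimately show False using lookup_block[of j \<xi>] by simp
  qed
  \<comment> \<open>One vertex has to serve all blocks, since the exceptional index depends on the
    vertex.\<close>
  obtain j\<^sub>0 where j\<^sub>0: "\<And>j. j \<noteq> j\<^sub>0 \<Longrightarrow> qs j \<in> N"
    using almost_integral[of qs] mv unfolding minimal_vertex_def by blast
  have "\<exists>\<xi>. lookup (block j) \<xi> = 1" if "j \<noteq> j\<^sub>0" for j
    using minimal_vertex_weight[OF mv, of j] j\<^sub>0[OF that] lookup_block[of j] by metis
  then show "\<exists>j\<^sub>0. \<forall>j. j \<noteq> j\<^sub>0 \<longrightarrow> (\<exists>\<xi>. lookup (block j) \<xi> = 1)"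
    by blast
qed

section \<open>Ring, binomials and ideal in terms of the extended cone\<close>

lemma poly_ring_eq: "cox.poly_ring = cox_ring \<sigma>'"
  by (simp add: cox.poly_ring_def cox_ring_def cox.exponents_def)

lemma binom_Some: "cox.binom (Some i) = cox_binomial N \<sigma>' i"
proof -
  have "(\<Prod>\<xi> | \<xi> \<in> E \<and> weight i \<xi> > 0. cox_var \<xi> ^ nat (weight i \<xi>)) = single (block (Some i)) 1"
  proof -
    have "(\<Prod>\<xi> | \<xi> \<in> E \<and> weight i \<xi> > 0. cox_var \<xi> ^ nat (weight i \<xi>)) = (\<Prod>\<xi>\<in>E. cox_var \<xi> ^ nat (weight i \<xi>))"
    proof (rule prod.mono_neutral_left)
      show "\<forall>\<xi>\<in>E - {\<xi> \<in> E. weight i \<xi> > 0}. cox_var \<xi> ^ nat (weight i \<xi>) = 1"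
      proof
        fix \<xi> assume "\<xi> \<in> E - {\<xi> \<in> E. weight i \<xi> > 0}"
        then have "nat (weight i \<xi>) = 0" by auto
        then show "cox_var \<xi> ^ nat (weight i \<xi>) = 1" by (simp only: power_0)
      qed
    qed (use finite_E in auto)
    then show ?thesis by (simp add: prod_cox_var_power[OF finite_E] block_def block_weight_def)
  qed
  moreover have "(\<Prod>\<xi> | \<xi> \<in> E \<and> weight i \<xi> < 0. cox_var \<xi> ^ nat (- weight i \<xi>)) = single (block None) 1"
  proof -
    have "(\<Prod>\<xi> | \<xi> \<in> E \<and> weight i \<xi> < 0. cox_var \<xi> ^ nat (- weight i \<xi>)) = (\<Prod>\<xi>\<in>E. cox_var \<xi> ^ nat (- weight i \<xi>))"
    proof (rule prod.mono_neutral_left)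
      show "\<forall>\<xi>\<in>E - {\<xi> \<in> E. weight i \<xi> < 0}. cox_var \<xi> ^ nat (- weight i \<xi>) = 1"
      proof
        fix \<xi> assume "\<xi> \<in> E - {\<xi> \<in> E. weight i \<xi> < 0}"
        then have "nat (- weight i \<xi>) = 0" by auto
        then show "cox_var \<xi> ^ nat (- weight i \<xi>) = 1" by (simp only: power_0)
      qed
    qed (use finite_E in auto)
    also have "\<dots> = (\<Prod>\<xi>\<in>E. cox_var \<xi> ^ block_weight None \<xi>)"
      by (intro prod.cong) (auto simp: block_weight_None[of _ i])
    finally show ?thesis by (simp add: prod_cox_var_power[OF finite_E] block_def)
  qed
  ultimately show ?thesis by (simp add: cox.binom_def cox_binomial_def Let_def weight_def)
qed

lemma binom_ideal_eq: "cox.binom_ideal (range Some) = Idl\<^bsub>cox_ring \<sigma>'\<^esub> (range (cox_binomial N \<sigma>'))"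
  by (simp add: cox.binom_ideal_def poly_ring_eq image_image binom_Some)

text \<open>Coefficients with sum 0 amount to a free choice at the \<open>Some i\<close>. So the
  relations are the pairings of integral combinations of the \<open>e\<^sub>i\<^sup>*\<close> with
  the primitive generators.\<close>

lemma lattice_equiv_weights:
  assumes "a \<in> cox.exponents" "b \<in> cox.exponents"
  shows "cox.lattice_equiv (range Some) a b \<longleftrightarrow>
    (\<exists>c. \<forall>\<xi>\<in>E. int (lookup a \<xi>) - int (lookup b \<xi>) = (\<Sum>i\<in>UNIV. c i * weight i \<xi>))"
proof -
  have UN: "insert None (range Some) = (UNIV :: 'k option set)" by (simp add: UNIV_option_conv)
  have eq: "(\<Sum>j\<in>UNIV. c j * int (lookup (block j) \<xi>)) = (\<Sum>i\<in>UNIV. c (Some i) * weight i \<xi>)"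
    if "(\<Sum>j\<in>UNIV. c j) = 0" "\<xi> \<in> E" for c :: "'k option \<Rightarrow> int" and \<xi>
  proof -
    have "c None = - (\<Sum>i\<in>UNIV. c (Some i))" using that(1) by (simp add: sum_UNIV_option)
    then show ?thesis
      using that(2) by (simp add: sum_UNIV_option lookup_block weight_blocks right_diff_distrib sum_subtractf sum_distrib_right)
  qed
  have out: "lookup a \<xi> = 0" "lookup b \<xi> = 0" if "\<xi> \<notin> E" for \<xi>
    using assms that by (auto simp: cox.exponents_def in_keys_iff)
  show ?thesis
  proof
    assume "cox.lattice_equiv (range Some) a b"
    then obtain c where c: "(\<Sum>j\<in>UNIV. c j) = 0" "\<And>\<xi>. int (lookup a \<xi>) - int (lookup b \<xi>) = (\<Sum>j\<in>UNIV. c j * int (lookup (block j) \<xi>))"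
      unfolding cox.lattice_equiv_def UN by blast
    show "\<exists>c. \<forall>\<xi>\<in>E. int (lookup a \<xi>) - int (lookup b \<xi>) = (\<Sum>i\<in>UNIV. c i * weight i \<xi>)"
      using c(2) eq[OF c(1)] by (intro exI[of _ "\<lambda>i. c (Some i)"]) simp
  next
    assume "\<exists>c. \<forall>\<xi>\<in>E. int (lookup a \<xi>) - int (lookup b \<xi>) = (\<Sum>i\<in>UNIV. c i * weight i \<xi>)"
    then obtain c where c: "\<And>\<xi>. \<xi> \<in> E \<Longrightarrow> int (lookup a \<xi>) - int (lookup b \<xi>) = (\<Sum>i\<in>UNIV. c i * weight i \<xi>)"
      by blast
    define d where "d j = (case j of None \<Rightarrow> - (\<Sum>i\<in>UNIV. c i) | Some i \<Rightarrow> c i)" for j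
    have d: "(\<Sum>j\<in>UNIV. d j) = 0" by (simp add: sum_UNIV_option d_def)
    have "int (lookup a \<xi>) - int (lookup b \<xi>) = (\<Sum>j\<in>UNIV. d j * int (lookup (block j) \<xi>))" for \<xi>
    proof (cases "\<xi> \<in> E")
      case True
      then show ?thesis using c eq[OF d] by (simp add: d_def)
    next
      case False
      then show ?thesis using out by (simp add: lookup_block)
    qed
    with d show "cox.lattice_equiv (range Some) a b" unfolding cox.lattice_equiv_def UN by blast
  qed
qed

section \<open>The group and its invariant monomials\<close>

abbreviation M' where "M' \<equiv> dual_cone \<sigma>' \<inter> dual_lattice N'"
abbreviation M where "M \<equiv> dual_cone \<sigma> \<inter> dual_lattice N"
abbreviation G where "G \<equiv> cox_group N' \<sigma>'"
abbreviation cexp where "cexp \<equiv> cox_exponent N' \<sigma>'"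

lemma lookup_cexp: "lookup (cexp u) \<xi> = (if \<xi> \<in> E then nat (pairing u (v \<xi>)) else 0)"
  unfolding cox_exponent_def by (rule lookup_sum_single[OF finite_E])

lemma cexp_exponents: "cexp u \<in> cox.exponents"
  by (auto simp: cox.exponents_def in_keys_iff lookup_cexp split: if_splits)

lemma pairing_nonneg: "u \<in> M' \<Longrightarrow> \<xi> \<in> E \<Longrightarrow> pairing u (v \<xi>) \<ge> 0"
  using pairing_edge[of \<xi> u] by (auto simp: dual_cone_edges simp flip: of_int_0_le_iff[where 'a = real])

lemma int_cexp: "u \<in> M' \<Longrightarrow> \<xi> \<in> E \<Longrightarrow> int (lookup (cexp u) \<xi>) = pairing u (v \<xi>)"
  using pairing_nonneg by (simp add: lookup_cexp)

lemma dual_lattice_add: "u \<in> dual_lattice L \<Longrightarrow> u' \<in> dual_lattice L \<Longrightarrow> u + u' \<in> dual_lattice L"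
  by (simp add: dual_lattice_def inner_add_left)

lemma dual_lattice_diff: "u \<in> dual_lattice L \<Longrightarrow> u' \<in> dual_lattice L \<Longrightarrow> u - u' \<in> dual_lattice L"
  by (simp add: dual_lattice_def inner_diff_left)

lemma dual_cone_add: "u \<in> dual_cone C \<Longrightarrow> u' \<in> dual_cone C \<Longrightarrow> u + u' \<in> dual_cone C"
  by (simp add: dual_cone_def inner_add_left)

lemma pairing_add:
  "\<xi> \<in> E \<Longrightarrow> u \<in> dual_lattice N' \<Longrightarrow> u' \<in> dual_lattice N' \<Longrightarrow> pairing (u + u') (v \<xi>) = pairing u (v \<xi>) + pairing u' (v \<xi>)"
  using pairing_edge[of \<xi> u] pairing_edge[of \<xi> u'] pairing_edge[of \<xi> "u + u'"] dual_lattice_add[of u N' u']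
  by (simp add: inner_add_left flip: of_int_eq_iff[where 'a = real])

lemma pairing_diff:
  "\<xi> \<in> E \<Longrightarrow> u \<in> dual_lattice N' \<Longrightarrow> u' \<in> dual_lattice N' \<Longrightarrow> pairing (u - u') (v \<xi>) = pairing u (v \<xi>) - pairing u' (v \<xi>)"
  using pairing_edge[of \<xi> u] pairing_edge[of \<xi> u'] pairing_edge[of \<xi> "u - u'"] dual_lattice_diff[of u N' u']
  by (simp add: inner_diff_left flip: of_int_eq_iff[where 'a = real])

lemma cexp_add:
  assumes "u \<in> M'" "u' \<in> M'"
  shows "cexp (u + u') = cexp u + cexp u'"
proof (rule poly_mapping_eqI)
  fix \<xi>
  show "lookup (cexp (u + u')) \<xi> = lookup (cexp u + cexp u') \<xi>"
    using assms pairing_nonneg[of u \<xi>] pairing_nonneg[of u' \<xi>]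
    by (auto simp: lookup_add lookup_cexp pairing_add nat_add_distrib)
qed

lemma submonoid_M': "submonoid_add M'"
  unfolding submonoid_add_def by (auto intro: dual_cone_add dual_lattice_add) (auto simp: dual_cone_def dual_lattice_def)

lemma weight_lincomb:
  assumes "\<xi> \<in> E"
  shows "(0, \<chi> i. of_int (c i)) \<in> dual_lattice N'"
    and "pairing (0, \<chi> i. of_int (c i)) (v \<xi>) = (\<Sum>i\<in>UNIV. c i * weight i \<xi>)"
proof -
  show mem: "(0, \<chi> i. of_int (c i)) \<in> dual_lattice N'"
    unfolding dual_ext_lattice[OF lattice_N] by (simp add: dual_lattice_def)
  have "real_of_int (pairing (0, \<chi> i. of_int (c i)) (v \<xi>)) = (0, \<chi> i. of_int (c i)) \<bullet> v \<xi>"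
    by (rule pairing_edge[OF assms mem])
  also have "\<dots> = (\<Sum>i\<in>UNIV. of_int (c i) * snd (v \<xi>) $ i)"
    by (simp add: inner_prod_def inner_vec_def)
  also have "\<dots> = real_of_int (\<Sum>i\<in>UNIV. c i * weight i \<xi>)"
    by (simp add: weight_eq[OF assms])
  finally show "pairing (0, \<chi> i. of_int (c i)) (v \<xi>) = (\<Sum>i\<in>UNIV. c i * weight i \<xi>)"
    by (simp only: of_int_eq_iff)
qed

text \<open>By \<open>edges_separate\<close>, congruent exponents come from functionals that differ
  by an integral combination of the \<open>e\<^sub>i\<^sup>*\<close>, which is the kernel of the
  projection to the first component.\<close>

lemma lattice_equiv_cexp:
  assumes u: "u \<in> M'" and u': "u' \<in> M'"
  shows "cox.lattice_equiv (range Some) (cexp u) (cexp u') \<longleftrightarrow> fst u = fst u'"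
proof
  assume "cox.lattice_equiv (range Some) (cexp u) (cexp u')"
  then obtain c where c: "\<And>\<xi>. \<xi> \<in> E \<Longrightarrow> int (lookup (cexp u) \<xi>) - int (lookup (cexp u') \<xi>) = (\<Sum>i\<in>UNIV. c i * weight i \<xi>)"
    unfolding lattice_equiv_weights[OF cexp_exponents cexp_exponents] by blast
  define d :: "'a \<times> (real ^ 'k)" where "d = (0, \<chi> i. of_int (c i))"
  have "(u - u' - d) \<bullet> v \<xi> = 0" if \<xi>: "\<xi> \<in> E" for \<xi>
  proof -
    have "pairing u (v \<xi>) - pairing u' (v \<xi>) = pairing d (v \<xi>)"
      using c[OF \<xi>] int_cexp[OF u \<xi>] int_cexp[OF u' \<xi>] weight_lincomb(2)[OF \<xi>] by (simp add: d_def)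
    then have "real_of_int (pairing u (v \<xi>)) - real_of_int (pairing u' (v \<xi>)) = real_of_int (pairing d (v \<xi>))"
      by (simp only: flip: of_int_diff)
    then show ?thesis
      using pairing_edge[OF \<xi>] u u' weight_lincomb(1)[OF \<xi>] by (simp add: d_def inner_diff_left)
  qed
  then have "u - u' - d = 0" by (rule edges_separate)
  then show "fst u = fst u'" by (simp add: d_def prod_eq_iff)
next
  assume fst: "fst u = fst u'"
  have int: "\<forall>i. snd u $ i \<in> \<int>" "\<forall>i. snd u' $ i \<in> \<int>"
    using u u' dual_ext_lattice[OF lattice_N, of "fst u" "snd u"] dual_ext_lattice[OF lattice_N, of "fst u'" "snd u'"] by auto
  define c where "c i = \<lfloor>snd u $ i\<rfloor> - \<lfloor>snd u' $ i\<rfloor>" for i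
  have eq: "u - u' = (0, \<chi> i. of_int (c i))"
    using int fst by (simp add: prod_eq_iff vec_eq_iff c_def)
  have "int (lookup (cexp u) \<xi>) - int (lookup (cexp u') \<xi>) = (\<Sum>i\<in>UNIV. c i * weight i \<xi>)" if \<xi>: "\<xi> \<in> E" for \<xi>
    using int_cexp[OF u \<xi>] int_cexp[OF u' \<xi>] weight_lincomb(2)[OF \<xi>, of c] pairing_diff[OF \<xi>, of u u'] u u' eq by simp
  then show "cox.lattice_equiv (range Some) (cexp u) (cexp u')"
    unfolding lattice_equiv_weights[OF cexp_exponents cexp_exponents] by blast
qed

lemma monomial_weight_powi:
  assumes "a \<in> cox.exponents"
  shows "monomial_weight \<mu> a = (\<Prod>\<xi>\<in>E. \<mu> \<xi> powi int (lookup a \<xi>))"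
  using assms by (simp add: monomial_weight_superset[OF finite_E] cox.exponents_def)

lemma group_nonzero: "\<mu> \<in> G \<Longrightarrow> \<xi> \<in> E \<Longrightarrow> \<mu> \<xi> \<noteq> 0"
  by (auto simp: cox_group_def)

lemma group_relation: "\<mu> \<in> G \<Longrightarrow> u \<in> dual_lattice N' \<Longrightarrow> (\<Prod>\<xi>\<in>E. \<mu> \<xi> powi pairing u (v \<xi>)) = 1"
  by (simp add: cox_group_def)

text \<open>Integral combinations of the \<open>e\<^sub>i\<^sup>*\<close> belong to the dual
  lattice, so they are among the relations defining the group.\<close>

lemma lattice_invariant_group:
  assumes \<mu>: "\<mu> \<in> G"
  shows "cox.lattice_invariant (range Some) \<mu>" unfolding cox.lattice_invariant_def
proof (intro ballI impI)
  fix a b assume a: "a \<in> cox.exponents" and b: "b \<in> cox.exponents" and "cox.lattice_equiv (range Some) a b"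
  then obtain c where c: "\<And>\<xi>. \<xi> \<in> E \<Longrightarrow> int (lookup a \<xi>) - int (lookup b \<xi>) = (\<Sum>i\<in>UNIV. c i * weight i \<xi>)"
    unfolding lattice_equiv_weights[OF a b] by blast
  define d :: "'a \<times> (real ^ 'k)" where "d = (0, \<chi> i. of_int (c i))"
  have d: "d \<in> dual_lattice N'"
    unfolding d_def dual_ext_lattice[OF lattice_N] by (simp add: dual_lattice_def)
  have "(\<Prod>\<xi>\<in>E. \<mu> \<xi> powi int (lookup a \<xi>)) = (\<Prod>\<xi>\<in>E. \<mu> \<xi> powi int (lookup b \<xi>) * \<mu> \<xi> powi pairing d (v \<xi>))"
  proof (rule prod.cong[OF refl])
    fix \<xi> assume \<xi>: "\<xi> \<in> E"
    have "int (lookup a \<xi>) = int (lookup b \<xi>) + pairing d (v \<xi>)"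
      using c[OF \<xi>] weight_lincomb(2)[OF \<xi>, of c] by (simp add: d_def)
    then show "\<mu> \<xi> powi int (lookup a \<xi>) = \<mu> \<xi> powi int (lookup b \<xi>) * \<mu> \<xi> powi pairing d (v \<xi>)"
      using power_int_add[of "\<mu> \<xi>" "int (lookup b \<xi>)" "pairing d (v \<xi>)"] group_nonzero[OF \<mu> \<xi>]
      by (simp only: simp_thms)
  qed
  also have "\<dots> = (\<Prod>\<xi>\<in>E. \<mu> \<xi> powi int (lookup b \<xi>))"
    by (simp only: prod.distrib group_relation[OF \<mu> d] mult_1_right)
  finally show "monomial_weight \<mu> a = monomial_weight \<mu> b"
    by (simp only: monomial_weight_powi a b)
qed

lemma weight_cexp:
  assumes "\<mu> \<in> G" "u \<in> M'"
  shows "monomial_weight \<mu> (cexp u) = 1"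
proof -
  have "monomial_weight \<mu> (cexp u) = (\<Prod>\<xi>\<in>E. \<mu> \<xi> powi int (lookup (cexp u) \<xi>))"
    by (rule monomial_weight_powi[OF cexp_exponents])
  also have "\<dots> = (\<Prod>\<xi>\<in>E. \<mu> \<xi> powi pairing u (v \<xi>))"
    by (intro prod.cong refl) (simp only: int_cexp[OF assms(2)])
  also have "\<dots> = 1" using assms by (intro group_relation) auto
  finally show ?thesis .
qed

text \<open>An exponent that is not a family of pairings with some \<open>u\<close> in the dual
  lattice is moved by a character trivial on all such families, and such a character is an element
  of the group.\<close>

lemma invariant_exponent:
  assumes a: "a \<in> cox.exponents" and inv: "\<And>\<mu>. \<mu> \<in> G \<Longrightarrow> monomial_weight \<mu> a = 1"
  shows "a \<in> cexp ` M'"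
proof -
  define H where "H = (\<lambda>u \<xi>. if \<xi> \<in> E then pairing u (v \<xi>) else 0) ` dual_lattice N'"
  have "(\<lambda>\<xi>. int (lookup a \<xi>)) \<in> H"
  proof (rule ccontr)
    assume notin: "(\<lambda>\<xi>. int (lookup a \<xi>)) \<notin> H"
    have H1: "int_subgroup H" unfolding int_subgroup_def
    proof (intro conjI ballI)
      have "(\<lambda>_. 0) = (\<lambda>\<xi>. if \<xi> \<in> E then pairing 0 (v \<xi>) else 0)"
        by (auto simp: pairing_def)
      moreover have "0 \<in> dual_lattice N'" by (simp add: dual_lattice_def)
      ultimately show "(\<lambda>_. 0) \<in> H" unfolding H_def by (rule image_eqI)
      fix x y assume "x \<in> H" "y \<in> H"
      then obtain u u' where u: "u \<in> dual_lattice N'" "u' \<in> dual_lattice N'"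
        "x = (\<lambda>\<xi>. if \<xi> \<in> E then pairing u (v \<xi>) else 0)" "y = (\<lambda>\<xi>. if \<xi> \<in> E then pairing u' (v \<xi>) else 0)"
        unfolding H_def by blast
      have "(\<lambda>\<xi>. x \<xi> - y \<xi>) = (\<lambda>\<xi>. if \<xi> \<in> E then pairing (u - u') (v \<xi>) else 0)"
        using u(1,2) by (auto simp: u(3,4) pairing_diff)
      then show "(\<lambda>\<xi>. x \<xi> - y \<xi>) \<in> H"
        unfolding H_def using dual_lattice_diff[OF u(1,2)] by (rule image_eqI)
    qed
    have H2: "int (lookup a \<xi>) = 0" if "\<xi> \<notin> E" for \<xi>
      using a that by (auto simp: cox.exponents_def in_keys_iff)
    have H3: "\<forall>b\<in>H. \<forall>\<xi>. \<xi> \<notin> E \<longrightarrow> b \<xi> = 0"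
      by (auto simp: H_def)
    have "\<exists>\<mu>. (\<forall>\<xi>\<in>E. \<mu> \<xi> \<noteq> 0) \<and> (\<forall>b\<in>H. (\<Prod>\<xi>\<in>E. \<mu> \<xi> powi b \<xi>) = 1) \<and>
        (\<Prod>\<xi>\<in>E. \<mu> \<xi> powi int (lookup a \<xi>)) \<noteq> (1 :: complex)"
      by (rule separating_character[OF finite_E H1 _ H3 notin]) (rule H2)
    then obtain \<mu> :: "('a \<times> (real ^ 'k)) set \<Rightarrow> complex" where \<mu>: "\<forall>\<xi>\<in>E. \<mu> \<xi> \<noteq> 0"
      "\<forall>b\<in>H. (\<Prod>\<xi>\<in>E. \<mu> \<xi> powi b \<xi>) = 1" "(\<Prod>\<xi>\<in>E. \<mu> \<xi> powi int (lookup a \<xi>)) \<noteq> 1"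
      by (elim exE conjE)
    \<comment> \<open>\<open>cox_group\<close> requires its elements to be undefined outside the
      edges.\<close>
    define \<nu> where "\<nu> = restrict \<mu> E"
    have "\<nu> \<in> G" unfolding cox_group_def
    proof (intro CollectI conjI ballI)
      show "\<nu> \<in> E \<rightarrow>\<^sub>E UNIV - {0}" using \<mu>(1) by (auto simp: \<nu>_def)
      fix u assume "u \<in> dual_lattice N'"
      then have "(\<lambda>\<xi>. if \<xi> \<in> E then pairing u (v \<xi>) else 0) \<in> H"
        unfolding H_def by blast
      then have "(\<Prod>\<xi>\<in>E. \<mu> \<xi> powi (if \<xi> \<in> E then pairing u (v \<xi>) else 0)) = 1"
        by (rule \<mu>(2)[rule_format])
      then show "(\<Prod>\<xi>\<in>E. \<nu> \<xi> powi pairing u (v \<xi>)) = 1"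
        by (simp add: \<nu>_def)
    qed
    then have "monomial_weight \<nu> a = 1" by (rule inv)
    then show False using \<mu>(3) by (simp add: monomial_weight_powi[OF a] \<nu>_def)
  qed
  then obtain u where u: "u \<in> dual_lattice N'" "(\<lambda>\<xi>. int (lookup a \<xi>)) = (\<lambda>\<xi>. if \<xi> \<in> E then pairing u (v \<xi>) else 0)"
    unfolding H_def by blast
  have au: "int (lookup a \<xi>) = (if \<xi> \<in> E then pairing u (v \<xi>) else 0)" for \<xi>
    using u(2) by (rule fun_cong)
  \<comment> \<open>The entries of an exponent are natural numbers, which puts \<open>u\<close> into
    the dual cone.\<close>
  have "0 \<le> u \<bullet> v \<xi>" if "\<xi> \<in> E" for \<xi>
  proof -
    have "pairing u (v \<xi>) \<ge> 0" using au[of \<xi>] that by (metis of_nat_0_le_iff)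
    then show ?thesis using pairing_edge[OF that u(1)] by (metis of_int_0_le_iff)
  qed
  then have "u \<in> M'" using u(1) by (simp add: dual_cone_edges)
  moreover have "a = cexp u"
    by (rule poly_mapping_eqI) (metis au lookup_cexp nat_int nat_zero_as_int)
  ultimately show ?thesis by blast
qed

section \<open>The isomorphism\<close>

abbreviation I where "I \<equiv> cox.binom_ideal (range Some)"
abbreviation R where "R \<equiv> cox.poly_ring"
abbreviation proj :: "('a \<times> (real ^ 'k) \<Rightarrow>\<^sub>0 complex) \<Rightarrow> ('a \<Rightarrow>\<^sub>0 complex)" where
  "proj \<equiv> monoid_algebra_map fst"
abbreviation cox_map where "cox_map \<equiv> monoid_algebra_map cexp"

text \<open>A section of the projection, chosen point by point and not claimed to be
  additive.\<close>

definition lift :: "'a \<Rightarrow> 'a \<times> (real ^ 'k)" where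
  "lift u = (u, SOME c. (u, c) \<in> M')"

lemma fst_lift [simp]: "fst (lift u) = u" by (simp add: lift_def)

lemma lift_mem: "u \<in> M \<Longrightarrow> lift u \<in> M'"
proof -
  assume "u \<in> M"
  then have "\<exists>c. (u, c) \<in> M'" using dual_cone_lift[of u] by blast
  then show ?thesis unfolding lift_def by (rule someI_ex)
qed

lemma fst_mem: "u \<in> M' \<Longrightarrow> fst u \<in> M"
  using dual_tilde_cone_fst[of u] dual_ext_lattice[OF lattice_N, of "fst u" "snd u"] by simp

lemma cox_map_carrier: "cox_map f \<in> carrier R"
  using keys_monoid_algebra_map[of cexp f] cexp_exponents by (auto simp: cox.carrier_poly_ring)

lemma cox_map_mult:
  "keys f \<subseteq> M' \<Longrightarrow> keys g \<subseteq> M' \<Longrightarrow> cox_map (f * g) = cox_map f * cox_map g"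
  by (rule monoid_algebra_map_mult[of M']) (auto intro: cexp_add)

lemma proj_mult: "proj (f * g) = proj f * proj g" by (rule monoid_algebra_map_mult[of UNIV]) auto

text \<open>Followed by \<open>h\<close>, the map \<open>cexp\<close> has the same fibres as
  \<open>fst\<close>, so it factors through the projection by an injective map of exponents.\<close>

lemma cox_map_mem_iff:
  assumes f: "keys f \<subseteq> M'"
  shows "cox_map f \<in> I \<longleftrightarrow> proj f = 0"
proof -
  obtain h :: "(('a \<times> (real ^ 'k)) set \<Rightarrow>\<^sub>0 nat) \<Rightarrow> (nat \<Rightarrow>\<^sub>0 int)" where h: "\<And>a b. h (a + b) = h a + h b"
    "\<And>a b. a \<in> cox.exponents \<Longrightarrow> b \<in> cox.exponents \<Longrightarrow> h a = h b \<longleftrightarrow> cox.lattice_equiv (range Some) a b"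
    using cox.ordered_quotient[of "range Some"] by blast
  have hc: "h (cexp u) = h (cexp u') \<longleftrightarrow> fst u = fst u'" if "u \<in> M'" "u' \<in> M'" for u u'
    by (simp only: h(2)[OF cexp_exponents cexp_exponents] lattice_equiv_cexp[OF that])
  define \<theta> where "\<theta> u = h (cexp (lift u))" for u
  have inj: "inj_on \<theta> M"
  proof (rule inj_onI)
    fix u u' assume "u \<in> M" "u' \<in> M" "\<theta> u = \<theta> u'"
    then show "u = u'" using hc[OF lift_mem lift_mem, of u u'] by (simp add: \<theta>_def)
  qed
  have "cox_map f \<in> I \<longleftrightarrow> monoid_algebra_map h (cox_map f) = 0"
    by (rule cox.binom_ideal_iff[OF h(1) _ cox_map_carrier]) (rule h(2))
  also have "monoid_algebra_map h (cox_map f) = monoid_algebra_map \<theta> (proj f)"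
    unfolding monoid_algebra_map_comp
  proof (rule monoid_algebra_map_cong)
    fix u assume "u \<in> keys f"
    then have u: "u \<in> M'" using f by blast
    show "h (cexp u) = \<theta> (fst u)"
      unfolding \<theta>_def using hc[OF u lift_mem[OF fst_mem[OF u]]] by simp
  qed
  also have "monoid_algebra_map \<theta> (proj f) = 0 \<longleftrightarrow> proj f = 0"
  proof
    have "keys (proj f) \<subseteq> M" using keys_monoid_algebra_map[of fst f] f fst_mem by blast
    then show "monoid_algebra_map \<theta> (proj f) = 0 \<Longrightarrow> proj f = 0"
      by (rule monoid_algebra_map_eq_0_imp[OF inj])
  qed simp
  finally show ?thesis .
qed

lemma coset_eq_iff:
  "p \<in> carrier R \<Longrightarrow> q \<in> carrier R \<Longrightarrow> I +>\<^bsub>R\<^esub> p = I +>\<^bsub>R\<^esub> q \<longleftrightarrow> p - q \<in> I"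
  using r_coset_monoid_algebra_eq_iff[OF cox.submonoid_exponents, of I p q]
    cox.ideal_binom_ideal[of "range Some"] unfolding cox.poly_ring_def by simp

text \<open>Read from right to left this makes the isomorphism well defined, from left to right
  injective.\<close>

lemma coset_cox_map_eq_iff:
  assumes "keys f \<subseteq> M'" "keys g \<subseteq> M'"
  shows "I +>\<^bsub>R\<^esub> cox_map f = I +>\<^bsub>R\<^esub> cox_map g \<longleftrightarrow> proj f = proj g"
proof -
  have "keys (f - g) \<subseteq> M'"
    using assms by (auto simp: in_keys_iff lookup_minus subset_iff) (metis diff_self)+
  then show ?thesis
    using cox_map_mem_iff[of "f - g"] coset_eq_iff[OF cox_map_carrier cox_map_carrier, of f g]
    by (simp add: monoid_algebra_map_diff)
qed

lemma group_inverse: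
  assumes "\<mu> \<in> G"
  obtains \<nu> where "\<nu> \<in> G" "\<And>\<xi>. \<xi> \<in> E \<Longrightarrow> \<mu> \<xi> * \<nu> \<xi> = 1"
proof -
  define \<nu> where "\<nu> = restrict (\<lambda>\<xi>. inverse (\<mu> \<xi>)) E"
  have "\<nu> \<in> G" unfolding cox_group_def
  proof (intro CollectI conjI ballI)
    show "\<nu> \<in> E \<rightarrow>\<^sub>E UNIV - {0}"
      using group_nonzero[OF assms] by (auto simp: \<nu>_def)
    fix u assume u: "u \<in> dual_lattice N'"
    have "(\<Prod>\<xi>\<in>E. \<nu> \<xi> powi pairing u (v \<xi>)) = inverse (\<Prod>\<xi>\<in>E. \<mu> \<xi> powi pairing u (v \<xi>))"
      unfolding prod_inversef[symmetric] o_def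
      by (intro prod.cong) (simp_all add: \<nu>_def power_int_inverse)
    then show "(\<Prod>\<xi>\<in>E. \<nu> \<xi> powi pairing u (v \<xi>)) = 1"
      using group_relation[OF assms u] by simp
  qed
  moreover have "\<mu> \<xi> * \<nu> \<xi> = 1" if "\<xi> \<in> E" for \<xi>
    using group_nonzero[OF assms that] that by (simp add: \<nu>_def)
  ultimately show thesis using that by blast
qed

text \<open>Equality as sets requires \<open>\<mu>\<close> to map the ideal onto itself, which is
  where its inverse in the group enters.\<close>

lemma diag_act_coset:
  assumes \<mu>: "\<mu> \<in> G" and inv: "\<And>a. a \<in> keys p \<Longrightarrow> monomial_weight \<mu> a = 1"
  shows "diag_act \<mu> ` (I +>\<^bsub>R\<^esub> p) = I +>\<^bsub>R\<^esub> p"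
proof -
  obtain \<nu> where \<nu>: "\<nu> \<in> G" "\<And>\<xi>. \<xi> \<in> E \<Longrightarrow> \<mu> \<xi> * \<nu> \<xi> = 1"
    using group_inverse[OF \<mu>] by blast
  have "diag_act \<mu> ` I = I"
  proof
    show "diag_act \<mu> ` I \<subseteq> I"
      using cox.diag_act_mem_binom_ideal[OF lattice_invariant_group[OF \<mu>]] by blast
    show "I \<subseteq> diag_act \<mu> ` I"
    proof
      fix q assume q: "q \<in> I"
      have "diag_act \<mu> (diag_act \<nu> q) = q"
      proof (rule diag_act_inverse[OF finite_E _ \<nu>(2)])
        show "keys a \<subseteq> E" if "a \<in> keys q" for a
          using cox.binom_ideal_subset[of "range Some"] q that by (auto simp: cox.carrier_poly_ring cox.exponents_def)
      qed
      then show "q \<in> diag_act \<mu> ` I"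
        using cox.diag_act_mem_binom_ideal[OF lattice_invariant_group[OF \<nu>(1)] q] by (metis image_eqI)
    qed
  qed
  then have "(\<lambda>q. q + p) ` (diag_act \<mu> ` I) = (\<lambda>q. q + p) ` I" by simp
  moreover have "diag_act \<mu> (q + p) = diag_act \<mu> q + p" for q
    using diag_act_trivial[of p \<mu>] inv by (simp add: diag_act_add)
  ultimately show ?thesis
    unfolding cox.poly_ring_def r_coset_monoid_algebra by (simp add: image_image)
qed

text \<open>Surjectivity of the isomorphism: an invariant class has a representative with invariant
  monomials, and these are of the form \<open>x\<^sup>u\<close>.\<close>

lemma invariant_coset:
  assumes X: "X \<in> carrier (R Quot I)" "\<And>\<mu>. \<mu> \<in> G \<Longrightarrow> diag_act \<mu> ` X = X"
  obtains f where "keys f \<subseteq> M'" "X = I +>\<^bsub>R\<^esub> cox_map f"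
proof -
  obtain p where p: "p \<in> carrier R" "X = I +>\<^bsub>R\<^esub> p"
    using X(1) by (auto simp: FactRing_def A_RCOSETS_def')
  have "diag_act \<mu> p - p \<in> I" if \<mu>: "\<mu> \<in> G" for \<mu>
  proof -
    have "p \<in> X" unfolding p(2) cox.poly_ring_def r_coset_monoid_algebra
      using cox.zero_in_binom_ideal[of "range Some"] by (intro image_eqI[of _ _ 0]) auto
    then have "diag_act \<mu> p \<in> X" using X(2)[OF \<mu>] by blast
    then obtain q where "q \<in> I" "diag_act \<mu> p = q + p"
      unfolding p(2) cox.poly_ring_def r_coset_monoid_algebra by blast
    then show ?thesis by simp
  qed
  then obtain q where q: "q \<in> carrier R" "p - q \<in> I" "\<And>a \<mu>. a \<in> keys q \<Longrightarrow> \<mu> \<in> G \<Longrightarrow> monomial_weight \<mu> a = 1"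
    using cox.invariant_representative[OF lattice_invariant_group p(1)] by metis
  have im: "keys q \<subseteq> cexp ` M'"
    using invariant_exponent q(1,3) by (auto simp: cox.carrier_poly_ring)
  define r where "r = inv_into M' cexp"
  have r: "r a \<in> M'" "cexp (r a) = a" if "a \<in> keys q" for a
  proof -
    have a: "a \<in> cexp ` M'" using im that by blast
    show "r a \<in> M'" unfolding r_def by (rule inv_into_into[OF a])
    show "cexp (r a) = a" unfolding r_def by (rule f_inv_into_f[OF a])
  qed
  define f where "f = monoid_algebra_map r q"
  have "keys f \<subseteq> M'" unfolding f_def using keys_monoid_algebra_map[of r q] r(1) by blast
  moreover have "cox_map f = q"
  proof -
    have "cox_map f = monoid_algebra_map (\<lambda>a. a) q"
      unfolding f_def monoid_algebra_map_comp by (rule monoid_algebra_map_cong) (rule r(2))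
    also have "\<dots> = q"
      unfolding monoid_algebra_map_def by (rule poly_mapping_eq_sum_single[symmetric])
    finally show ?thesis .
  qed
  moreover have "X = I +>\<^bsub>R\<^esub> q" using coset_eq_iff[OF p(1) q(1)] q(2) p(2) by simp
  ultimately show thesis using that by blast
qed

theorem toric_ring_iso:
  "\<exists>\<phi>\<in>ring_iso (toric_ring N \<sigma>) (invariant_quotient G R I).
     \<forall>f\<in>carrier (toric_ring N' \<sigma>'). \<phi> (proj f) = I +>\<^bsub>R\<^esub> cox_map f"
proof -
  interpret ideal I R by (rule cox.ideal_binom_ideal)
  define s where "s = monoid_algebra_map lift"
  have s: "keys (s g) \<subseteq> M'" if "keys g \<subseteq> M" for g
    unfolding s_def using keys_monoid_algebra_map[of lift g] that lift_mem by blast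
  have proj_s: "proj (s g) = g" for g
    unfolding s_def monoid_algebra_map_comp by (simp add: monoid_algebra_map_def flip: poly_mapping_eq_sum_single)
  have proj_M: "keys (proj f) \<subseteq> M" if "keys f \<subseteq> M'" for f
    using keys_monoid_algebra_map[of fst f] that fst_mem by blast
  \<comment> \<open>Naturality forces this definition, since \<open>s g\<close> projects to
    \<open>g\<close>.\<close>
  define \<phi> where "\<phi> g = I +>\<^bsub>R\<^esub> cox_map (s g)" for g
  have natural: "\<phi> (proj f) = I +>\<^bsub>R\<^esub> cox_map f" if f: "keys f \<subseteq> M'" for f
    unfolding \<phi>_def coset_cox_map_eq_iff[OF s[OF proj_M[OF f]] f] by (rule proj_s)
  have mult_M': "keys (f * g) \<subseteq> M'" if "keys f \<subseteq> M'" "keys g \<subseteq> M'" for f g :: "'a \<times> (real ^ 'k) \<Rightarrow>\<^sub>0 complex"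
    using cring.cring_simprules(5)[OF cring_monoid_algebra[OF submonoid_M'], of f g] that by simp
  have add_M': "keys (f + g) \<subseteq> M'" if "keys f \<subseteq> M'" "keys g \<subseteq> M'" for f g :: "'a \<times> (real ^ 'k) \<Rightarrow>\<^sub>0 complex"
    using keys_add[of f g] that by blast
  have closed: "\<phi> g \<in> carrier (invariant_quotient G R I)" if "g \<in> carrier (toric_ring N \<sigma>)" for g
  proof -
    have g: "keys g \<subseteq> M" using that by (simp add: toric_ring_def)
    show ?thesis unfolding invariant_quotient_def
    proof (simp, intro conjI ballI)
      show "\<phi> g \<in> carrier (R Quot I)"
        using cox_map_carrier[of "s g"] by (auto simp: \<phi>_def FactRing_def A_RCOSETS_def')
      show "diag_act \<mu> ` \<phi> g = \<phi> g" if \<mu>: "\<mu> \<in> G" for \<mu>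
        unfolding \<phi>_def
      proof (rule diag_act_coset[OF \<mu>])
        fix a assume "a \<in> keys (cox_map (s g))"
        then obtain u where "u \<in> M'" "a = cexp u"
          using keys_monoid_algebra_map[of cexp "s g"] s[OF g] by blast
        then show "monomial_weight \<mu> a = 1" using weight_cexp[OF \<mu>] by simp
      qed
    qed
  qed
  have "\<phi> \<in> ring_iso (toric_ring N \<sigma>) (invariant_quotient G R I)"
  proof (rule ring_iso_memI)
    fix g assume "g \<in> carrier (toric_ring N \<sigma>)"
    then have g: "keys g \<subseteq> M" by (simp add: toric_ring_def)
    show "\<phi> g \<in> carrier (invariant_quotient G R I)" by (rule closed) fact
    fix g' assume "g' \<in> carrier (toric_ring N \<sigma>)"
    then have g': "keys g' \<subseteq> M" by (simp add: toric_ring_def)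
    \<comment> \<open>\<open>s g * s g'\<close> is one preimage of \<open>g * g'\<close>, in general
      not the chosen one; \<open>natural\<close> accepts any.\<close>
    have "\<phi> (g * g') = I +>\<^bsub>R\<^esub> (cox_map (s g) \<otimes>\<^bsub>R\<^esub> cox_map (s g'))"
      using natural[OF mult_M'[OF s[OF g] s[OF g']]] cox_map_mult[OF s[OF g] s[OF g']]
      by (simp add: proj_mult proj_s cox.poly_ring_def)
    also have "\<dots> = \<phi> g \<otimes>\<^bsub>R Quot I\<^esub> \<phi> g'"
      unfolding \<phi>_def by (simp add: FactRing_def rcoset_mult_add cox_map_carrier)
    finally show "\<phi> (g \<otimes>\<^bsub>toric_ring N \<sigma>\<^esub> g') = \<phi> g \<otimes>\<^bsub>invariant_quotient G R I\<^esub> \<phi> g'"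
      by (simp add: toric_ring_def invariant_quotient_def)
    have "\<phi> (g + g') = I +>\<^bsub>R\<^esub> (cox_map (s g) \<oplus>\<^bsub>R\<^esub> cox_map (s g'))"
      using natural[OF add_M'[OF s[OF g] s[OF g']]]
      by (simp add: monoid_algebra_map_add proj_s cox.poly_ring_def)
    also have "\<dots> = \<phi> g \<oplus>\<^bsub>R Quot I\<^esub> \<phi> g'"
      unfolding \<phi>_def by (simp add: FactRing_def a_rcos_sum cox_map_carrier)
    finally show "\<phi> (g \<oplus>\<^bsub>toric_ring N \<sigma>\<^esub> g') = \<phi> g \<oplus>\<^bsub>invariant_quotient G R I\<^esub> \<phi> g'"
      by (simp add: toric_ring_def invariant_quotient_def)
  next
    have "cexp 0 = 0" by (rule poly_mapping_eqI) (simp add: lookup_cexp pairing_def)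
    moreover have "keys (1 :: 'a \<times> (real ^ 'k) \<Rightarrow>\<^sub>0 complex) \<subseteq> M'"
      using submonoid_M' by (simp add: submonoid_add_def)
    ultimately have "\<phi> 1 = I +>\<^bsub>R\<^esub> 1" using natural[of 1] by simp
    then show "\<phi> \<one>\<^bsub>toric_ring N \<sigma>\<^esub> = \<one>\<^bsub>invariant_quotient G R I\<^esub>"
      by (simp add: toric_ring_def invariant_quotient_def FactRing_def cox.poly_ring_def)
  next
    show "bij_betw \<phi> (carrier (toric_ring N \<sigma>)) (carrier (invariant_quotient G R I))"
      unfolding bij_betw_def
    proof
      show "inj_on \<phi> (carrier (toric_ring N \<sigma>))"
      proof (rule inj_onI)
        fix g g' assume "g \<in> carrier (toric_ring N \<sigma>)" "g' \<in> carrier (toric_ring N \<sigma>)" "\<phi> g = \<phi> g'"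
        then have "proj (s g) = proj (s g')"
          using coset_cox_map_eq_iff[OF s s, of g g'] by (simp add: toric_ring_def \<phi>_def)
        then show "g = g'" by (simp only: proj_s)
      qed
      show "\<phi> ` carrier (toric_ring N \<sigma>) = carrier (invariant_quotient G R I)"
      proof (intro equalityI subsetI)
        fix X assume "X \<in> carrier (invariant_quotient G R I)"
        then have "X \<in> carrier (R Quot I)" "\<And>\<mu>. \<mu> \<in> G \<Longrightarrow> diag_act \<mu> ` X = X"
          by (auto simp: invariant_quotient_def)
        then obtain f where f: "keys f \<subseteq> M'" "X = I +>\<^bsub>R\<^esub> cox_map f"
          by (rule invariant_coset)
        then show "X \<in> \<phi> ` carrier (toric_ring N \<sigma>)"
          using natural[OF f(1)] proj_M[OF f(1)] by (intro image_eqI[of _ _ "proj f"]) (auto simp: toric_ring_def)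
      next
        fix X assume "X \<in> \<phi> ` carrier (toric_ring N \<sigma>)"
        then show "X \<in> carrier (invariant_quotient G R I)" using closed by blast
      qed
    qed
  qed
  moreover have "\<forall>f\<in>carrier (toric_ring N' \<sigma>'). \<phi> (proj f) = I +>\<^bsub>R\<^esub> cox_map f"
    using natural by (simp add: toric_ring_def)
  ultimately show ?thesis by blast
qed

end

theorem proposition2p8:
  fixes N \<sigma> Q :: "'a::euclidean_space set"
    and Qs :: "'k::{finite,linorder} option \<Rightarrow> 'a set"
  assumes "full_lattice N"
    and "rational_polyhedral_cone N \<sigma>" and "strongly_convex \<sigma>" and "dim \<sigma> = DIM('a)"
    and "rational_polyhedron N Q" and "Q \<noteq> {}" and "Q \<subseteq> \<sigma>" and "0 \<notin> Q"
    and "minkowski_decomposition Q Qs"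
    and "almost_integral_decomposition N Q Qs"
  defines "N' \<equiv> ext_lattice N"
  defines "\<sigma>' \<equiv> tilde_cone \<sigma> Qs"
  defines "R \<equiv> cox_ring \<sigma>'"
  defines "I \<equiv> Idl\<^bsub>R\<^esub> (range (cox_binomial N \<sigma>'))"
  shows "(\<exists>\<phi> \<in> ring_iso (toric_ring N \<sigma>) (invariant_quotient (cox_group N' \<sigma>') R I).
            \<forall>f \<in> carrier (toric_ring N' \<sigma>').
              \<phi> (monoid_algebra_map fst f) = I +>\<^bsub>R\<^esub> monoid_algebra_map (cox_exponent N' \<sigma>') f)
         \<and> regular_sequence R (map (cox_binomial N \<sigma>') (sorted_list_of_set UNIV))
         \<and> primeideal I R"
proof -
  interpret data: minkowski_data N \<sigma> Q Qs by unfold_locales (use assms(1-10) in auto)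
  have "regular_sequence data.R (map data.cox.binom (map Some (sorted_list_of_set UNIV)))"
    by (rule data.cox.regular_sequence_binom) (auto simp: distinct_map)
  then have "regular_sequence R (map (cox_binomial N \<sigma>') (sorted_list_of_set UNIV))"
    unfolding R_def \<sigma>'_def by (simp add: data.poly_ring_eq data.binom_Some comp_def)
  moreover have "primeideal I R" using data.cox.primeideal_binom_ideal[of "range Some"]
    unfolding I_def R_def \<sigma>'_def by (simp only: data.poly_ring_eq data.binom_ideal_eq)
  moreover have "\<exists>\<phi> \<in> ring_iso (toric_ring N \<sigma>) (invariant_quotient (cox_group N' \<sigma>') R I).
      \<forall>f \<in> carrier (toric_ring N' \<sigma>').
        \<phi> (monoid_algebra_map fst f) = I +>\<^bsub>R\<^esub> monoid_algebra_map (cox_exponent N' \<sigma>') f"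
    using data.toric_ring_iso
    unfolding N'_def I_def R_def \<sigma>'_def by (simp only: data.poly_ring_eq data.binom_ideal_eq)
  ultimately show ?thesis by blast
qed

end
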